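(* Let $k$ be an algebraically closed field of characteristic $p>0$ and let $n=p^ad$ be an integer, where $a>0$ and $d\geq 1$ are integers. Let $V$ be a $k$-vector space of dimension $n$. Then there exist a $(p^a-1)$-dimensional torus $T\le \mathrm{SL}(V)$, with $d$-dimensional weight spaces on $V$, and a unipotent element $u\in\mathrm{SL}(V)$ with a single Jordan block on $V$ such that $u$ normalises $T$. Moreover, $T\langle u\rangle$ lies in a proper parabolic subgroup of $\mathrm{SL}(V)$ if and only if $d>1$.
   Context: The weight spaces of a torus $T$ on $V$ are the non-zero simultaneous eigenspaces $V_\chi=\{v\in V: tv=\chi(t)v \text{ for all } t\in T\}$ for characters $\chi$ of $T$. *)

theory Defs
  imports
    "HOL-Analysis.Abstract_Topology"
    "HOL-Algebra.Group_Action"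
    "HOL-Algebra.Product_Groups"
    "HOL-Algebra.Solvable_Groups"
    "Jordan_Normal_Form.Determinant"
    "Jordan_Normal_Form.Jordan_Normal_Form"
begin

section \<open>Regular functions and morphisms\<close>

text \<open>
  An affine variety over an algebraically closed field \<open>'k\<close> is represented by its set of points
  \<open>X\<close> together with a set \<open>A\<close> of functions on the ambient type whose restrictions to \<open>X\<close>
  form the coordinate ring of \<open>X\<close>. All coordinate rings below are given by generators.
\<close>

inductive_set fun_algebra :: "('x \<Rightarrow> 'k::comm_ring_1) set \<Rightarrow> ('x \<Rightarrow> 'k) set"
  for F :: "('x \<Rightarrow> 'k) set"
where
  gen: "f \<in> F \<Longrightarrow> f \<in> fun_algebra F"
| const: "(\<lambda>_. c) \<in> fun_algebra F"
| add: "f \<in> fun_algebra F \<Longrightarrow> g \<in> fun_algebra F \<Longrightarrow> (\<lambda>x. f x + g x) \<in> fun_algebra F"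
| mult: "f \<in> fun_algebra F \<Longrightarrow> g \<in> fun_algebra F \<Longrightarrow> (\<lambda>x. f x * g x) \<in> fun_algebra F"

text \<open>
  For varieties \<open>(X, A)\<close>, \<open>(Y, B)\<close>, a map \<open>\<phi>\<close> from \<open>X\<close> to \<open>Y\<close> is a morphism iff it
  pulls regular functions on \<open>Y\<close> back to regular functions on \<open>X\<close>.
\<close>

definition regular_map ::
  "'x set \<Rightarrow> ('x \<Rightarrow> 'k) set \<Rightarrow> 'y set \<Rightarrow> ('y \<Rightarrow> 'k) set \<Rightarrow> ('x \<Rightarrow> 'y) \<Rightarrow> bool"
  where "regular_map X A Y B \<phi> \<longleftrightarrow>
    \<phi> \<in> X \<rightarrow> Y \<and> (\<forall>b\<in>B. \<exists>a\<in>A. \<forall>x\<in>X. b (\<phi> x) = a x)"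

definition mult_grp :: "'k::field monoid"
  where "mult_grp = \<lparr>carrier = - {0}, monoid.mult = (*), one = 1\<rparr>"

definition mult_grp_coords :: "('k::field \<Rightarrow> 'k) set"
  where "mult_grp_coords = fun_algebra {\<lambda>x. x, inverse}"

definition mult_grp_power :: "nat \<Rightarrow> (nat \<Rightarrow> 'k::field) monoid"
  where "mult_grp_power r = product_group {..<r} (\<lambda>_. mult_grp)"

definition mult_grp_power_coords :: "nat \<Rightarrow> ((nat \<Rightarrow> 'k::field) \<Rightarrow> 'k) set"
  where "mult_grp_power_coords r =
    fun_algebra ((\<lambda>i x. x i) ` {..<r} \<union> (\<lambda>i x. inverse (x i)) ` {..<r})"


section \<open>The algebraic group SL(V)\<close>

text \<open>
  The locale adds nothing to \<open>vector_space\<close>; it only keeps the names below apart from the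
  global interpretations of \<open>vector_space\<close>.
\<close>

locale linear_group = vector_space
begin

definition ordered_basis :: "'b list \<Rightarrow> bool"
  where "ordered_basis bs \<longleftrightarrow> distinct bs \<and> independent (set bs) \<and> span (set bs) = UNIV"

definition matrix_wrt :: "'b list \<Rightarrow> ('b \<Rightarrow> 'b) \<Rightarrow> 'a mat"
  where "matrix_wrt bs g =
    mat (length bs) (length bs) (\<lambda>(i, j). representation (set bs) (g (bs ! j)) (bs ! i))"

text \<open>The determinant of an endomorphism does not depend on the chosen basis.\<close>

definition lin_det :: "('b \<Rightarrow> 'b) \<Rightarrow> 'a"
  where "lin_det g = Determinant.det (matrix_wrt (SOME bs. ordered_basis bs) g)"

definition SL :: "('b \<Rightarrow> 'b) monoid"
  where "SL = \<lparr>carrier = {g. Vector_Spaces.linear scale scale g \<and> lin_det g = 1},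
               monoid.mult = (\<circ>), one = id\<rparr>"

text \<open>
  The polynomial functions on \<open>End(V)\<close>, generated by the matrix coefficients
  \<open>g \<mapsto> \<phi> (g v)\<close>. As \<open>SL(V)\<close> is Zariski closed in \<open>End(V)\<close>, the coordinate ring of a closed
  subset of \<open>SL(V)\<close> consists of the restrictions of these functions.
\<close>

definition end_coords :: "(('b \<Rightarrow> 'b) \<Rightarrow> 'a) set"
  where "end_coords =
    fun_algebra {\<lambda>g. \<phi> (g v) | \<phi> v. Vector_Spaces.linear scale (*) \<phi>}"

definition zariski :: "('b \<Rightarrow> 'b) topology"
  where "zariski = topology_generated_by {{g \<in> carrier SL. f g \<noteq> 0} | f. f \<in> end_coords}"

abbreviation subgrp :: "('b \<Rightarrow> 'b) set \<Rightarrow> ('b \<Rightarrow> 'b) monoid"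
  where "subgrp H \<equiv> SL\<lparr>carrier := H\<rparr>"

definition closed_subgroup :: "('b \<Rightarrow> 'b) set \<Rightarrow> bool"
  where "closed_subgroup H \<longleftrightarrow> subgroup H SL \<and> closedin zariski H"


subsection \<open>Tori and weight spaces\<close>

text \<open>
  An \<open>r\<close>-dimensional torus is a closed subgroup that is isomorphic, as an algebraic group, to
  the \<open>r\<close>-th power of the multiplicative group.
\<close>

definition torus :: "nat \<Rightarrow> ('b \<Rightarrow> 'b) set \<Rightarrow> bool"
  where "torus r T \<longleftrightarrow> closed_subgroup T \<and>
    (\<exists>\<phi> \<psi>. group_isomorphisms (mult_grp_power r) (subgrp T) \<phi> \<psi> \<and>
       regular_map (carrier (mult_grp_power r)) (mult_grp_power_coords r) T end_coords \<phi> \<and>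
       regular_map T end_coords (carrier (mult_grp_power r)) (mult_grp_power_coords r) \<psi>)"

definition alg_character :: "('b \<Rightarrow> 'b) set \<Rightarrow> (('b \<Rightarrow> 'b) \<Rightarrow> 'a) \<Rightarrow> bool"
  where "alg_character T \<chi> \<longleftrightarrow> \<chi> \<in> hom (subgrp T) mult_grp \<and>
    regular_map T end_coords (carrier mult_grp) mult_grp_coords \<chi>"

definition weight_spaces :: "('b \<Rightarrow> 'b) set \<Rightarrow> 'b set set"
  where "weight_spaces T =
    {{v. \<forall>t\<in>T. t v = scale (\<chi> t) v} | \<chi>. alg_character T \<chi>} - {{0}}"


subsection \<open>Unipotent elements and Jordan blocks\<close>

definition unipotent :: "('b \<Rightarrow> 'b) \<Rightarrow> bool"
  where "unipotent u \<longleftrightarrow> (\<exists>m. (\<lambda>v. u v - v) ^^ m = (\<lambda>_. 0))"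

definition single_jordan_block :: "('b \<Rightarrow> 'b) \<Rightarrow> bool"
  where "single_jordan_block u \<longleftrightarrow>
    (\<exists>bs c. ordered_basis bs \<and> matrix_wrt bs u = jordan_block (length bs) c)"


subsection \<open>Borel and parabolic subgroups\<close>

definition conn_solvable_subgroup :: "('b \<Rightarrow> 'b) set \<Rightarrow> bool"
  where "conn_solvable_subgroup H \<longleftrightarrow>
    closed_subgroup H \<and> connectedin zariski H \<and> solvable (subgrp H)"

definition borel_subgroup :: "('b \<Rightarrow> 'b) set \<Rightarrow> bool"
  where "borel_subgroup B \<longleftrightarrow> conn_solvable_subgroup B \<and>
    (\<forall>H. conn_solvable_subgroup H \<longrightarrow> B \<subseteq> H \<longrightarrow> H = B)"

definition parabolic_subgroup :: "('b \<Rightarrow> 'b) set \<Rightarrow> bool"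
  where "parabolic_subgroup P \<longleftrightarrow> closed_subgroup P \<and> (\<exists>B. borel_subgroup B \<and> B \<subseteq> P)"

end

end

theory Submission
  imports Defs
begin

text \<open>
  Let \<open>q = p\<^sup>a\<close> and group a basis \<open>e 0, \<dots>, e (n - 1)\<close> of \<open>V\<close> by the residue of the index modulo \<open>q\<close>.
  The torus \<open>T\<close> scales the \<open>q\<close> groups, each of size \<open>d\<close>, by \<open>t 0, \<dots>, t (q - 1)\<close> with product 1; its
  weight spaces are the spans of the groups, because \<open>k\<close> is infinite and so any two weights differ at
  some element of \<open>T\<close>. The element \<open>u\<close> permutes the weight spaces cyclically and is chosen such
  that \<open>u\<^sup>q - 1\<close> shifts the index down by \<open>q\<close>. In characteristic \<open>p\<close> one has
  \<open>(u - 1)\<^sup>q = u\<^sup>q - 1\<close>, hence \<open>(u - 1)\<^sup>n = 0\<close> and \<open>(u - 1)\<^sup>n\<^sup>-\<^sup>1 \<noteq> 0\<close>: \<open>u\<close> is unipotent with a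
  single Jordan block (lemma \<open>u_unipotent_single_block\<close>).

  If \<open>d > 1\<close>, then \<open>T\<close> and \<open>u\<close> stabilise the proper subspace spanned by \<open>e 0, \<dots>, e (q - 1)\<close>, whose
  stabiliser is a parabolic subgroup, as it contains the upper triangular subgroup. If \<open>d = 1\<close>, then
  the weight spaces are lines permuted transitively by \<open>u\<close>, so \<open>T\<close> and \<open>u\<close> act irreducibly, while a
  proper parabolic subgroup acts reducibly (lemma \<open>parabolic_reducible\<close>).

  Both directions rest on the identification of the Borel subgroups, that is the maximal closed
  connected solvable subgroups, with the stabilisers of complete flags. Such a stabiliser is
  connected, because each of its elements lies on a rational curve through the identity, and it is
  solvable. Conversely the Lie--Kolchin theorem puts every connected solvable subgroup into the
  stabiliser of some complete flag. Its proof goes up the derived series from its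
  trivial last term: on an irreducible quotient, a normal subgroup with scalar commutators
  consists of scalars, since connectedness of the whole group makes functions of \<open>h\<close> such as the
  commutator of \<open>x\<close> with \<open>h g h\<inverse>\<close>, which only take finitely many values, constant.

  Finally, a subgroup that contains a flag stabiliser and acts irreducibly contains all
  transvections and is therefore all of \<open>SL(V)\<close> (lemma \<open>irreducible_overgroup_eq_SL\<close>).
\<close>

section \<open>Coordinates and determinants of endomorphisms\<close>

context linear_group
begin

abbreviation lin :: "('b \<Rightarrow> 'b) \<Rightarrow> bool"
  where "lin \<equiv> Vector_Spaces.linear scale scale"

abbreviation fnl :: "('b \<Rightarrow> 'a) \<Rightarrow> bool"
  where "fnl \<equiv> Vector_Spaces.linear scale (*)"

lemma linI:
  assumes "\<And>x y. f (x + y) = f x + f y" "\<And>c x. f (c *s x) = c *s f x"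
  shows "lin f"
  using assms vector_space_axioms by (simp add: Vector_Spaces.linear_iff)

lemma vector_space_mult: "vector_space ((*) :: 'a \<Rightarrow> 'a \<Rightarrow> 'a)"
  by unfold_locales (simp_all add: algebra_simps)

lemma fnlI:
  assumes "\<And>x y. f (x + y) = f x + f y" "\<And>c x. f (c *s x) = c * f x"
  shows "fnl f"
  using assms vector_space_axioms vector_space_mult by (simp add: Vector_Spaces.linear_iff)

lemma lin_add: "lin f \<Longrightarrow> f (x + y) = f x + f y"
  and lin_scale: "lin f \<Longrightarrow> f (c *s x) = c *s f x"
  and fnl_add: "fnl \<phi> \<Longrightarrow> \<phi> (x + y) = \<phi> x + \<phi> y"
  and fnl_scale: "fnl \<phi> \<Longrightarrow> \<phi> (c *s x) = c * \<phi> x"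
  by (simp_all add: Vector_Spaces.linear_iff)

lemma lin_0: "lin f \<Longrightarrow> f 0 = 0"
  using lin_scale[of f 0 0] by simp

lemma fnl_0: "fnl \<phi> \<Longrightarrow> \<phi> 0 = 0"
  using fnl_scale[of \<phi> 0 0] by simp

lemma lin_neg: "lin f \<Longrightarrow> f (- x) = - f x"
  using lin_scale[of f "-1" x] by simp

lemma lin_diff: "lin f \<Longrightarrow> f (x - y) = f x - f y"
  using lin_add[of f x "- y"] lin_neg[of f y] by simp

lemma lin_sum: "lin f \<Longrightarrow> f (\<Sum>i\<in>A. g i) = (\<Sum>i\<in>A. f (g i))"
  by (induction A rule: infinite_finite_induct) (auto simp: lin_0 lin_add)

lemma fnl_sum: "fnl \<phi> \<Longrightarrow> \<phi> (\<Sum>i\<in>A. g i) = (\<Sum>i\<in>A. \<phi> (g i))"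
  by (induction A rule: infinite_finite_induct) (auto simp: fnl_0 fnl_add)

lemma lin_comp: "lin f \<Longrightarrow> lin g \<Longrightarrow> lin (f \<circ> g)"
  by (rule linI) (auto simp: lin_add lin_scale)

lemma lin_id: "lin id"
  by (rule linI) auto

lemma fnl_comp: "fnl \<phi> \<Longrightarrow> lin g \<Longrightarrow> fnl (\<lambda>v. \<phi> (g v))"
  by (rule fnlI) (auto simp: lin_add lin_scale fnl_add fnl_scale)

text \<open>
  The matrix of \<open>g\<close> with respect to two bases; allowing source and target bases to differ makes
  the change of basis the special case \<open>g = id\<close> of composition.
\<close>

definition matrix_wrt2 :: "'b list \<Rightarrow> 'b list \<Rightarrow> ('b \<Rightarrow> 'b) \<Rightarrow> 'a mat"
  where "matrix_wrt2 bs cs g =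
    mat (length cs) (length bs) (\<lambda>(i, j). representation (set cs) (g (bs ! j)) (cs ! i))"

lemma matrix_wrt2_carrier: "matrix_wrt2 bs cs g \<in> carrier_mat (length cs) (length bs)"
  by (simp add: matrix_wrt2_def)

lemma ordered_basis_expand:
  assumes "ordered_basis bs"
  shows "(\<Sum>i<length bs. representation (set bs) v (bs ! i) *s bs ! i) = v"
proof -
  have "(\<Sum>b\<in>set bs. representation (set bs) v b *s b) = v"
    using assms by (intro sum_representation_eq) (auto simp: ordered_basis_def)
  moreover have "(\<Sum>b\<in>set bs. representation (set bs) v b *s b)
      = (\<Sum>i<length bs. representation (set bs) v (bs ! i) *s bs ! i)"
    using assms bij_betw_nth[of bs "{..<length bs}" "set bs"]
    by (intro sum.reindex_bij_betw[symmetric]) (auto simp: ordered_basis_def)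
  ultimately show ?thesis by simp
qed

lemma matrix_wrt2_comp:
  assumes "ordered_basis bs" "ordered_basis cs" "ordered_basis ds" "lin f"
  shows "matrix_wrt2 bs ds (f \<circ> g) = matrix_wrt2 cs ds f * matrix_wrt2 bs cs g"
proof (rule eq_matI)
  fix i j assume "i < dim_row (matrix_wrt2 cs ds f * matrix_wrt2 bs cs g)"
    and "j < dim_col (matrix_wrt2 cs ds f * matrix_wrt2 bs cs g)"
  then have i: "i < length ds" and j: "j < length bs" by (auto simp: matrix_wrt2_def)
  let ?r = "\<lambda>k. representation (set cs) (g (bs ! j)) (cs ! k)"
  have ds: "independent (set ds)" "\<And>v. v \<in> span (set ds)"
    using assms(3) by (auto simp: ordered_basis_def)
  have "representation (set ds) (f (g (bs ! j))) (ds ! i)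
      = representation (set ds) (f (\<Sum>k<length cs. ?r k *s cs ! k)) (ds ! i)"
    by (simp add: ordered_basis_expand[OF assms(2)])
  also have "\<dots> = (\<Sum>k<length cs. ?r k * representation (set ds) (f (cs ! k)) (ds ! i))"
    by (simp add: lin_sum[OF assms(4)] lin_scale[OF assms(4)]
        representation_sum[OF ds(1) ds(2)] representation_scale[OF ds(1) ds(2)])
  finally show "matrix_wrt2 bs ds (f \<circ> g) $$ (i, j) =
      (matrix_wrt2 cs ds f * matrix_wrt2 bs cs g) $$ (i, j)"
    using i j by (simp add: matrix_wrt2_def scalar_prod_def lessThan_atLeast0 mult.commute)
qed (auto simp: matrix_wrt2_def)

lemma matrix_wrt2_id:
  assumes "ordered_basis bs"
  shows "matrix_wrt2 bs bs id = 1\<^sub>m (length bs)"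
proof (rule eq_matI)
  fix i j assume "i < dim_row (1\<^sub>m (length bs))" "j < dim_col (1\<^sub>m (length bs))"
  then have ij: "i < length bs" "j < length bs" by auto
  have "representation (set bs) (bs ! j) = (\<lambda>v. if v = bs ! j then 1 else 0)"
    using assms ij by (intro representation_basis) (auto simp: ordered_basis_def)
  then show "matrix_wrt2 bs bs id $$ (i, j) = 1\<^sub>m (length bs) $$ (i, j)"
    using ij assms by (auto simp: matrix_wrt2_def ordered_basis_def nth_eq_iff_index_eq)
qed (auto simp: matrix_wrt2_def)

lemma ordered_basis_length:
  assumes "ordered_basis bs"
  shows "length bs = dim UNIV"
  using assms dim_eq_card[of "set bs" UNIV] by (simp add: ordered_basis_def distinct_card)

lemma det_matrix_wrt_unique:
  assumes "ordered_basis bs" "ordered_basis cs" "lin g"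
  shows "Determinant.det (matrix_wrt bs g) = Determinant.det (matrix_wrt cs g)"
proof -
  define m where "m = length bs"
  have m: "length bs = m" "length cs = m"
    using assms(1,2) ordered_basis_length by (simp_all add: m_def)
  let ?P = "matrix_wrt2 cs bs id" and ?Q = "matrix_wrt2 bs cs id"
  note c = matrix_wrt2_carrier[of bs bs g, unfolded m] matrix_wrt2_carrier[of cs bs id, unfolded m]
    matrix_wrt2_carrier[of bs cs id, unfolded m] matrix_wrt2_carrier[of cs bs g, unfolded m]
  have "?P * ?Q = 1\<^sub>m m"
    using matrix_wrt2_comp[OF assms(1,2,1) lin_id, of id] matrix_wrt2_id[OF assms(1)] m by simp
  then have PQ: "Determinant.det ?P * Determinant.det ?Q = 1"
    using det_mult[OF c(2,3)] by simp
  have "matrix_wrt2 cs cs g = ?Q * (matrix_wrt2 bs bs g * ?P)"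
    using matrix_wrt2_comp[OF assms(2,1,2) lin_id, of g]
      matrix_wrt2_comp[OF assms(2,1,1) assms(3), of id] by simp
  then have "Determinant.det (matrix_wrt2 cs cs g)
      = Determinant.det (matrix_wrt2 bs bs g) * (Determinant.det ?P * Determinant.det ?Q)"
    using det_mult[OF c(3), of "matrix_wrt2 bs bs g * ?P"] det_mult[OF c(1,2)] c
    by (simp add: algebra_simps)
  then show ?thesis
    by (simp add: PQ) (simp add: matrix_wrt2_def matrix_wrt_def)
qed

lemma lin_det_eq:
  assumes "ordered_basis bs" "lin g"
  shows "lin_det g = Determinant.det (matrix_wrt bs g)"
  unfolding lin_det_def using assms by (intro det_matrix_wrt_unique) (auto intro: someI)

end

text \<open>
  Determinants and flags are computed in an enumerated basis. Different bases of the same space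
  give different instances of the locale, but the same group \<open>SL\<close>.
\<close>

locale based_space = linear_group +
  fixes e :: "nat \<Rightarrow> 'b" and n :: nat
  assumes inj_e: "inj_on e {..<n}"
    and indep_e: "independent (e ` {..<n})"
    and span_e: "span (e ` {..<n}) = UNIV"
begin

sublocale finite_dimensional_vector_space scale "e ` {..<n}"
  by unfold_locales (auto simp: indep_e span_e)

lemma dim_eq_n: "dim UNIV = n"
  using dim_UNIV card_image[OF inj_e] by simp

definition crd :: "nat \<Rightarrow> 'b \<Rightarrow> 'a"
  where "crd i v = representation (e ` {..<n}) v (e i)"

lemma in_span_e: "v \<in> span (e ` {..<n})"
  by (simp add: span_e)

lemma crd_add [simp]: "crd i (v + w) = crd i v + crd i w"
  and crd_scale [simp]: "crd i (c *s v) = c * crd i v"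
  and crd_0 [simp]: "crd i 0 = 0"
  and crd_diff [simp]: "crd i (v - w) = crd i v - crd i w"
  by (simp_all add: crd_def representation_add[OF indep_e in_span_e in_span_e] representation_zero
      representation_scale[OF indep_e in_span_e] representation_diff[OF indep_e in_span_e in_span_e])

lemma fnl_crd: "fnl (crd i)"
  by (rule fnlI) auto

lemma crd_sum [simp]: "crd i (\<Sum>j\<in>A. f j) = (\<Sum>j\<in>A. crd i (f j))"
  by (rule fnl_sum[OF fnl_crd])

lemma crd_e: "i < n \<Longrightarrow> j < n \<Longrightarrow> crd i (e j) = (if i = j then 1 else 0)"
  using representation_basis[OF indep_e, of "e j"] inj_e by (auto simp: crd_def inj_on_def)

lemma ordered_basis_e: "ordered_basis (map e [0..<n])"
proof -
  have "distinct (map e [0..<n])" and "set (map e [0..<n]) = e ` {..<n}"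
    using inj_e by (simp_all add: distinct_map atLeast0LessThan)
  then show ?thesis by (simp only: ordered_basis_def indep_e span_e not_False_eq_True simp_thms)
qed

lemma expand: "(\<Sum>i<n. crd i v *s e i) = v"
  using ordered_basis_expand[OF ordered_basis_e, of v]
  by (simp add: crd_def lessThan_atLeast0)

lemma crd_eqI: "(\<And>i. i < n \<Longrightarrow> crd i v = crd i w) \<Longrightarrow> v = w"
  using expand[of v] expand[of w] by (metis (no_types, lifting) lessThan_iff sum.cong)

lemma crd_combination: "i < n \<Longrightarrow> crd i (\<Sum>j<n. c j *s e j) = c i"
  by (simp add: crd_e if_distrib[of "\<lambda>x. _ * x"] cong: if_cong)

definition ext :: "(nat \<Rightarrow> 'b) \<Rightarrow> 'b \<Rightarrow> 'b"
  where "ext w v = (\<Sum>j<n. crd j v *s w j)"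

lemma lin_ext: "lin (ext w)"
  by (rule linI) (auto simp: ext_def scale_left_distrib sum.distrib scale_sum_right)

lemma ext_e [simp]: "j < n \<Longrightarrow> ext w (e j) = w j"
  by (simp add: ext_def crd_e if_distrib[of "\<lambda>x. x *s _"] cong: if_cong)

lemma lin_expand:
  assumes "lin f"
  shows "f v = (\<Sum>j<n. crd j v *s f (e j))"
proof -
  have "f v = f (\<Sum>j<n. crd j v *s e j)" by (simp add: expand)
  then show ?thesis by (simp add: lin_sum[OF assms] lin_scale[OF assms])
qed

lemma fnl_expand:
  assumes "fnl \<phi>"
  shows "\<phi> v = (\<Sum>j<n. crd j v * \<phi> (e j))"
proof -
  have "\<phi> v = \<phi> (\<Sum>j<n. crd j v *s e j)" by (simp add: expand)
  then show ?thesis by (simp add: fnl_sum[OF assms] fnl_scale[OF assms])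
qed

lemma lin_eqI:
  assumes "lin f" "lin g" "\<And>j. j < n \<Longrightarrow> f (e j) = g (e j)"
  shows "f = g"
proof
  fix v
  show "f v = g v" using lin_expand[OF assms(1), of v] lin_expand[OF assms(2), of v] assms(3) by simp
qed

definition mtx :: "('b \<Rightarrow> 'b) \<Rightarrow> 'a mat"
  where "mtx g = mat n n (\<lambda>(i, j). crd i (g (e j)))"

lemma mtx_carrier [simp]: "mtx g \<in> carrier_mat n n"
  and dim_mtx [simp]: "dim_row (mtx g) = n" "dim_col (mtx g) = n"
  by (simp_all add: mtx_def)

lemma mtx_index [simp]: "i < n \<Longrightarrow> j < n \<Longrightarrow> mtx g $$ (i, j) = crd i (g (e j))"
  by (simp add: mtx_def)

lemma matrix_wrt_e: "matrix_wrt (map e [0..<n]) g = mtx g"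
  by (rule eq_matI) (simp_all add: matrix_wrt_def crd_def lessThan_atLeast0)

lemma lin_det_mtx: "lin g \<Longrightarrow> lin_det g = Determinant.det (mtx g)"
  using lin_det_eq[OF ordered_basis_e] matrix_wrt_e by simp

lemma mtx_comp:
  assumes "lin f"
  shows "mtx (f \<circ> g) = mtx f * mtx g"
proof -
  have "mtx h = matrix_wrt2 (map e [0..<n]) (map e [0..<n]) h" for h
    using matrix_wrt_e[of h] by (simp add: matrix_wrt_def matrix_wrt2_def)
  then show ?thesis
    using matrix_wrt2_comp[OF ordered_basis_e ordered_basis_e ordered_basis_e assms] by metis
qed

lemma mtx_id: "mtx id = 1\<^sub>m n"
  by (rule eq_matI) (auto simp: crd_e)

lemma mtx_inj:
  assumes "lin f" "lin g" "mtx f = mtx g"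
  shows "f = g"
proof (rule lin_eqI[OF assms(1,2)], rule crd_eqI)
  fix i j assume "i < n" "j < n"
  then show "crd i (f (e j)) = crd i (g (e j))"
    using arg_cong[OF assms(3), of "\<lambda>A. A $$ (i, j)"] by simp
qed

definition endo :: "'a mat \<Rightarrow> 'b \<Rightarrow> 'b"
  where "endo A = ext (\<lambda>j. \<Sum>i<n. A $$ (i, j) *s e i)"

lemma lin_endo: "lin (endo A)"
  by (simp add: endo_def lin_ext)

lemma mtx_endo: "A \<in> carrier_mat n n \<Longrightarrow> mtx (endo A) = A"
  by (rule eq_matI) (auto simp: endo_def crd_combination simp del: crd_sum crd_scale)

lemma SL_iff: "g \<in> carrier SL \<longleftrightarrow> lin g \<and> Determinant.det (mtx g) = 1"
  using lin_det_mtx by (auto simp: SL_def)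

lemma SL_lin: "g \<in> carrier SL \<Longrightarrow> lin g"
  by (simp add: SL_iff)

lemma SL_mult [simp]: "g \<otimes>\<^bsub>SL\<^esub> h = g \<circ> h"
  and SL_one [simp]: "\<one>\<^bsub>SL\<^esub> = id"
  by (simp_all add: SL_def)

text \<open>
  Cramer's rule: inverses in \<open>SL(V)\<close> are given by adjugates, so their entries are polynomials in the
  entries of the original matrix.
\<close>

lemma SL_adj:
  assumes "g \<in> carrier SL"
  shows "endo (adj_mat (mtx g)) \<in> carrier SL"
    and "endo (adj_mat (mtx g)) \<circ> g = id"
    and "g \<circ> endo (adj_mat (mtx g)) = id"
proof -
  let ?A = "adj_mat (mtx g)"
  have g: "lin g" "Determinant.det (mtx g) = 1" using assms by (auto simp: SL_iff)
  have A: "?A \<in> carrier_mat n n" "mtx g * ?A = 1\<^sub>m n" "?A * mtx g = 1\<^sub>m n"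
    using adj_mat[OF mtx_carrier[of g]] g by auto
  show "endo ?A \<circ> g = id" "g \<circ> endo ?A = id"
    by (auto intro!: mtx_inj lin_comp lin_endo g lin_id
        simp: mtx_comp lin_endo g mtx_endo A mtx_id)
  have "Determinant.det (mtx g) * Determinant.det ?A = 1"
    using det_mult[OF mtx_carrier[of g] A(1)] A(2) by simp
  then show "endo ?A \<in> carrier SL"
    by (simp add: SL_iff lin_endo mtx_endo A g)
qed

lemma SL_comp: "g \<in> carrier SL \<Longrightarrow> h \<in> carrier SL \<Longrightarrow> g \<circ> h \<in> carrier SL"
  using det_mult[OF mtx_carrier mtx_carrier] by (auto simp: SL_iff lin_comp mtx_comp)

lemma id_SL: "id \<in> carrier SL"
  by (simp add: SL_iff lin_id mtx_id)

lemma group_SL: "group SL"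
proof (rule groupI)
  fix x assume "x \<in> carrier SL"
  then show "\<exists>y\<in>carrier SL. y \<otimes>\<^bsub>SL\<^esub> x = \<one>\<^bsub>SL\<^esub>"
    using SL_adj by auto
qed (auto simp: SL_comp id_SL o_assoc)

sublocale SLg: group SL
  by (rule group_SL)

lemma SL_inv_adj: "g \<in> carrier SL \<Longrightarrow> inv\<^bsub>SL\<^esub> g = endo (adj_mat (mtx g))"
  using SL_adj SLg.inv_equality by simp

lemma SL_inv_left: "g \<in> carrier SL \<Longrightarrow> (inv\<^bsub>SL\<^esub> g) (g v) = v"
  and SL_inv_right: "g \<in> carrier SL \<Longrightarrow> g ((inv\<^bsub>SL\<^esub> g) v) = v"
  using SL_adj(2,3) SL_inv_adj by (metis comp_apply id_apply)+

lemma SL_inj: "g \<in> carrier SL \<Longrightarrow> inj g"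
  by (metis SL_inv_left injI)

end

section \<open>Regular functions and the Zariski topology\<close>

context based_space
begin

lemma end_coords_gen: "fnl \<phi> \<Longrightarrow> (\<lambda>g. \<phi> (g v)) \<in> end_coords"
  unfolding end_coords_def by (intro fun_algebra.gen) auto

lemma end_coords_const: "(\<lambda>_. c) \<in> end_coords"
  unfolding end_coords_def by (rule fun_algebra.const)

lemma end_coords_add: "f \<in> end_coords \<Longrightarrow> h \<in> end_coords \<Longrightarrow> (\<lambda>g. f g + h g) \<in> end_coords"
  unfolding end_coords_def by (rule fun_algebra.add)

lemma end_coords_mult: "f \<in> end_coords \<Longrightarrow> h \<in> end_coords \<Longrightarrow> (\<lambda>g. f g * h g) \<in> end_coords"
  unfolding end_coords_def by (rule fun_algebra.mult)

lemma end_coords_crd: "(\<lambda>g. crd i (g v)) \<in> end_coords"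
  by (rule end_coords_gen[OF fnl_crd])

lemma end_coords_diff:
  assumes "f \<in> end_coords" "h \<in> end_coords"
  shows "(\<lambda>g. f g - h g) \<in> end_coords"
  using end_coords_add[OF assms(1) end_coords_mult[OF end_coords_const[of "-1"] assms(2)]] by simp

lemma end_coords_sum: "(\<And>i. i \<in> A \<Longrightarrow> f i \<in> end_coords) \<Longrightarrow> (\<lambda>g. \<Sum>i\<in>A. f i g) \<in> end_coords"
  by (induction A rule: infinite_finite_induct) (auto intro: end_coords_const end_coords_add)

lemma end_coords_prod: "(\<And>i. i \<in> A \<Longrightarrow> f i \<in> end_coords) \<Longrightarrow> (\<lambda>g. \<Prod>i\<in>A. f i g) \<in> end_coords"
  by (induction A rule: infinite_finite_induct) (auto intro: end_coords_const end_coords_mult)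

lemma end_coords_det:
  assumes "\<And>g. A g \<in> carrier_mat m m"
    and "\<And>i j. i < m \<Longrightarrow> j < m \<Longrightarrow> (\<lambda>g. A g $$ (i, j)) \<in> end_coords"
  shows "(\<lambda>g. Determinant.det (A g)) \<in> end_coords"
proof -
  have "(\<lambda>g. Determinant.det (A g)) = (\<lambda>g. \<Sum>p | p permutes {0..<m}.
      signof p * (\<Prod>i = 0..<m. A g $$ (i, p i)))"
    using det_def'[OF assms(1)] by auto
  also have "\<dots> \<in> end_coords"
  proof (intro end_coords_sum end_coords_mult end_coords_const end_coords_prod assms(2))
    fix p i assume "p \<in> {p. p permutes {0..<m}}" "i \<in> {0..<m}"
    then show "i < m" "p i < m" using permutes_in_image[of p "{0..<m}" i] by auto
  qed
  finally show ?thesis .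
qed

text \<open>
  A regular function is a polynomial in the matrix entries, so it pulls back along \<open>\<gamma>\<close> into any
  class \<open>Q\<close> of functions that contains the entries of \<open>\<gamma>\<close> and is closed under the ring operations.
\<close>

lemma end_coords_pullback:
  assumes f: "f \<in> end_coords"
    and lin: "\<And>x. x \<in> X \<Longrightarrow> lin (\<gamma> x)"
    and const: "\<And>c. Q (\<lambda>_. c)"
    and add: "\<And>f h. Q f \<Longrightarrow> Q h \<Longrightarrow> Q (\<lambda>x. f x + h x)"
    and mult: "\<And>f h. Q f \<Longrightarrow> Q h \<Longrightarrow> Q (\<lambda>x. f x * h x)"
    and cong: "\<And>f h. Q f \<Longrightarrow> (\<And>x. x \<in> X \<Longrightarrow> f x = h x) \<Longrightarrow> Q h"
    and entries: "\<And>i j. i < n \<Longrightarrow> j < n \<Longrightarrow> Q (\<lambda>x. crd i (\<gamma> x (e j)))"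
  shows "Q (\<lambda>x. f (\<gamma> x))"
  using f unfolding end_coords_def
proof induction
  case (gen f)
  then obtain \<phi> v where f: "f = (\<lambda>g. \<phi> (g v))" and \<phi>: "fnl \<phi>" by auto
  have sum: "Q (\<lambda>x. \<Sum>i\<in>A. F i x)" if "finite A" "\<And>i. i \<in> A \<Longrightarrow> Q (F i)" for A :: "nat set" and F
    using that by (induction A rule: finite_induct) (auto intro: const add)
  have "Q (\<lambda>x. \<Sum>j<n. crd j v * (\<Sum>i<n. crd i (\<gamma> x (e j)) * \<phi> (e i)))"
    by (intro sum mult const entries) auto
  then show ?case
  proof (rule cong)
    fix x assume "x \<in> X"
    have "\<phi> (\<gamma> x v) = (\<Sum>j<n. crd j v * \<phi> (\<gamma> x (e j)))"
      by (rule fnl_expand[OF fnl_comp[OF \<phi> lin[OF \<open>x \<in> X\<close>]]])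
    also have "\<dots> = (\<Sum>j<n. crd j v * (\<Sum>i<n. crd i (\<gamma> x (e j)) * \<phi> (e i)))"
      by (intro sum.cong refl arg_cong2[of _ _ _ _ "(*)"] fnl_expand[OF \<phi>])
    finally show "(\<Sum>j<n. crd j v * (\<Sum>i<n. crd i (\<gamma> x (e j)) * \<phi> (e i))) = f (\<gamma> x)"
      by (simp add: f)
  qed
next
  case (const c)
  show ?case by (rule assms(3))
next
  case (add f g)
  then show ?case by (intro assms(4))
next
  case (mult f g)
  then show ?case by (intro assms(5))
qed

subsection \<open>Morphisms from \<open>SL(V)\<close> to itself\<close>

definition SL_morphism :: "(('b \<Rightarrow> 'b) \<Rightarrow> ('b \<Rightarrow> 'b)) \<Rightarrow> bool"
  where "SL_morphism m \<longleftrightarrow> regular_map (carrier SL) end_coords (carrier SL) end_coords m"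

lemma SL_morphismI:
  assumes "\<And>g. g \<in> carrier SL \<Longrightarrow> m g \<in> carrier SL"
    and "\<And>i j. i < n \<Longrightarrow> j < n \<Longrightarrow> \<exists>a\<in>end_coords. \<forall>g\<in>carrier SL. crd i (m g (e j)) = a g"
  shows "SL_morphism m"
  unfolding SL_morphism_def regular_map_def
proof (intro conjI ballI)
  fix f assume "f \<in> end_coords"
  then show "\<exists>a\<in>end_coords. \<forall>g\<in>carrier SL. f (m g) = a g"
  proof (rule end_coords_pullback[where X = "carrier SL"
        and Q = "\<lambda>f. \<exists>a\<in>end_coords. \<forall>g\<in>carrier SL. f g = a g"])
    show "\<exists>a\<in>end_coords. \<forall>g\<in>carrier SL. f g * h g = a g"
      if "\<exists>a\<in>end_coords. \<forall>g\<in>carrier SL. f g = a g" "\<exists>a\<in>end_coords. \<forall>g\<in>carrier SL. h g = a g" for f h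
      using that end_coords_mult by fastforce
    show "\<exists>a\<in>end_coords. \<forall>g\<in>carrier SL. f g + h g = a g"
      if "\<exists>a\<in>end_coords. \<forall>g\<in>carrier SL. f g = a g" "\<exists>a\<in>end_coords. \<forall>g\<in>carrier SL. h g = a g" for f h
      using that end_coords_add by fastforce
    show "\<exists>a\<in>end_coords. \<forall>g\<in>carrier SL. c = a g" for c
      using end_coords_const by (intro bexI[of _ "\<lambda>_. c"]) auto
  qed (use assms SL_lin in auto)
qed (use assms in auto)

lemma SL_morphism_pullback:
  assumes "SL_morphism m" "f \<in> end_coords"
  shows "\<exists>a\<in>end_coords. \<forall>g\<in>carrier SL. f (m g) = a g"
  using assms unfolding SL_morphism_def regular_map_def by blast

lemma SL_morphism_closed: "SL_morphism m \<Longrightarrow> g \<in> carrier SL \<Longrightarrow> m g \<in> carrier SL"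
  by (auto simp: SL_morphism_def regular_map_def)

lemma SL_morphism_ident: "SL_morphism (\<lambda>g. g)"
  by (rule SL_morphismI) (auto intro!: bexI[OF _ end_coords_crd])

lemma SL_morphism_const: "x \<in> carrier SL \<Longrightarrow> SL_morphism (\<lambda>_. x)"
  by (rule SL_morphismI) (auto intro!: bexI[OF _ end_coords_const])

lemma SL_morphism_mult:
  assumes "SL_morphism m1" "SL_morphism m2"
  shows "SL_morphism (\<lambda>g. m1 g \<otimes>\<^bsub>SL\<^esub> m2 g)"
proof (rule SL_morphismI)
  fix i j assume ij: "i < n" "j < n"
  have "\<exists>a. \<forall>k. a k \<in> end_coords \<and> (\<forall>g\<in>carrier SL. crd i (m1 g (e k)) = a k g)"
    by (intro choice allI) (use SL_morphism_pullback[OF assms(1) end_coords_crd] in blast)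
  then obtain a where a: "\<And>k. a k \<in> end_coords" "\<And>k g. g \<in> carrier SL \<Longrightarrow> crd i (m1 g (e k)) = a k g"
    by blast
  have "\<exists>b. \<forall>k. b k \<in> end_coords \<and> (\<forall>g\<in>carrier SL. crd k (m2 g (e j)) = b k g)"
    by (intro choice allI) (use SL_morphism_pullback[OF assms(2) end_coords_crd] in blast)
  then obtain b where b: "\<And>k. b k \<in> end_coords" "\<And>k g. g \<in> carrier SL \<Longrightarrow> crd k (m2 g (e j)) = b k g"
    by blast
  show "\<exists>f\<in>end_coords. \<forall>g\<in>carrier SL. crd i ((m1 g \<otimes>\<^bsub>SL\<^esub> m2 g) (e j)) = f g"
  proof (intro bexI ballI)
    show "(\<lambda>g. \<Sum>k<n. b k g * a k g) \<in> end_coords"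
      by (intro end_coords_sum end_coords_mult a b)
    fix g assume g: "g \<in> carrier SL"
    then have "lin (m1 g)" using SL_morphism_closed[OF assms(1)] SL_lin by blast
    from lin_expand[OF this, of "m2 g (e j)"]
    show "crd i ((m1 g \<otimes>\<^bsub>SL\<^esub> m2 g) (e j)) = (\<Sum>k<n. b k g * a k g)"
      by (simp add: a(2)[OF g] b(2)[OF g])
  qed
qed (use assms SL_morphism_closed SL_comp in auto)

lemma SL_morphism_inv:
  assumes "SL_morphism m"
  shows "SL_morphism (\<lambda>g. inv\<^bsub>SL\<^esub> (m g))"
proof -
  have inv: "\<exists>a\<in>end_coords. \<forall>g\<in>carrier SL. crd i ((inv\<^bsub>SL\<^esub> g) (e j)) = a g" if ij: "i < n" "j < n" for i j
  proof (intro bexI ballI)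
    have lt: "insert_index k l < n" if "k < n" "l < n - 1" for k l
      using that by (auto simp: insert_index_def)
    show "(\<lambda>g. (-1) ^ (j + i) * Determinant.det (mat_delete (mtx g) j i)) \<in> end_coords"
    proof (intro end_coords_mult end_coords_const end_coords_det)
      fix k l assume "k < n - 1" "l < n - 1"
      then have "mat_delete (mtx g) j i $$ (k, l) = crd (insert_index j k) (g (e (insert_index i l)))" for g
        using ij lt by (simp add: mat_delete_def insert_index_def)
      then show "(\<lambda>g. mat_delete (mtx g) j i $$ (k, l)) \<in> end_coords"
        by (simp add: end_coords_crd)
    qed (auto intro: mat_delete_carrier)
    fix g assume "g \<in> carrier SL"
    then show "crd i ((inv\<^bsub>SL\<^esub> g) (e j)) = (-1) ^ (j + i) * Determinant.det (mat_delete (mtx g) j i)"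
      using ij adj_mat(1)[OF mtx_carrier[of g]] mtx_index[OF ij, of "endo (adj_mat (mtx g))"]
      by (simp add: SL_inv_adj mtx_endo adj_mat_def cofactor_def)
  qed
  show ?thesis
  proof (rule SL_morphismI)
    fix i j assume ij: "i < n" "j < n"
    obtain a where a: "a \<in> end_coords" "\<And>g. g \<in> carrier SL \<Longrightarrow> crd i ((inv\<^bsub>SL\<^esub> g) (e j)) = a g"
      using inv[OF ij] by blast
    from SL_morphism_pullback[OF assms a(1)] a(2) SL_morphism_closed[OF assms]
    show "\<exists>a\<in>end_coords. \<forall>g\<in>carrier SL. crd i ((inv\<^bsub>SL\<^esub> (m g)) (e j)) = a g"
      by metis
  qed (use SL_morphism_closed[OF assms] in auto)
qed

subsection \<open>Closed and connected sets\<close>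

lemma openin_basic: "f \<in> end_coords \<Longrightarrow> openin zariski {g \<in> carrier SL. f g \<noteq> 0}"
  unfolding zariski_def openin_topology_generated_by_iff
  by (rule generate_topology_on.Basis) auto

lemma topspace_zariski: "topspace zariski = carrier SL"
proof -
  have "openin zariski (carrier SL)" using openin_basic[OF end_coords_const[of 1]] by simp
  moreover have "topspace zariski \<subseteq> carrier SL"
    unfolding zariski_def topology_generated_by_topspace by auto
  ultimately show ?thesis using openin_subset by blast
qed

lemma closedin_zeros:
  assumes "f \<in> end_coords"
  shows "closedin zariski {g \<in> carrier SL. f g = 0}"
proof -
  have "carrier SL - {g \<in> carrier SL. f g = 0} = {g \<in> carrier SL. f g \<noteq> 0}" by auto
  then show ?thesis using openin_basic[OF assms] by (simp add: closedin_def topspace_zariski)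
qed

lemma closedin_common_zeros:
  assumes "F \<subseteq> end_coords"
  shows "closedin zariski {g \<in> carrier SL. \<forall>f\<in>F. f g = 0}"
proof -
  have "{g \<in> carrier SL. \<forall>f\<in>F. f g = 0} = \<Inter> (insert (carrier SL) ((\<lambda>f. {g \<in> carrier SL. f g = 0}) ` F))"
    by auto
  also have "closedin zariski \<dots>"
    using assms closedin_zeros closedin_topspace[of zariski]
    by (intro closedin_Inter) (auto simp: topspace_zariski)
  finally show ?thesis .
qed

text \<open>
  A regular function with finitely many values on \<open>H\<close> splits \<open>H\<close> into one of its level sets and the
  union of the others, and both are closed.
\<close>

lemma regular_finite_image_constant:
  assumes H: "connectedin zariski H" and f: "f \<in> end_coords" and fin: "finite (f ` H)"
    and h: "h \<in> H" "h' \<in> H"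
  shows "f h = f h'"
proof (rule ccontr)
  assume ne: "f h \<noteq> f h'"
  let ?p = "\<lambda>g. \<Prod>c\<in>f ` H - {f h}. f g - c"
  have HSL: "H \<subseteq> carrier SL" using connectedin_subset_topspace[OF H] topspace_zariski by simp
  have "closedin zariski {g \<in> carrier SL. f g - f h = 0}"
    by (intro closedin_zeros end_coords_diff f end_coords_const)
  moreover have "closedin zariski {g \<in> carrier SL. ?p g = 0}"
    by (intro closedin_zeros end_coords_prod end_coords_diff f end_coords_const)
  moreover have p: "?p g = 0 \<longleftrightarrow> f g \<noteq> f h" if "g \<in> H" for g
    using that fin by auto
  have "H \<subseteq> {g \<in> carrier SL. f g - f h = 0} \<union> {g \<in> carrier SL. ?p g = 0}"
    using p HSL by auto
  moreover have "{g \<in> carrier SL. f g - f h = 0} \<inter> {g \<in> carrier SL. ?p g = 0} \<inter> H = {}"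
    using p by auto
  moreover have "{g \<in> carrier SL. f g - f h = 0} \<inter> H \<noteq> {}"
    using h HSL by auto
  moreover have "{g \<in> carrier SL. ?p g = 0} \<inter> H \<noteq> {}"
    using p[OF h(2)] h HSL ne by auto
  ultimately show False
    using H unfolding connectedin_closedin by blast
qed

text \<open>
  A curve with rational coordinates, defined on infinitely many parameters, has connected image:
  a regular function that does not vanish identically on it has finitely many zeros, so any two
  non-empty relatively open subsets meet.
\<close>

lemma connectedin_rational_curve:
  assumes S: "infinite S" and \<gamma>: "\<And>s. s \<in> S \<Longrightarrow> \<gamma> s \<in> carrier SL"
    and entries: "\<And>i j. i < n \<Longrightarrow> j < n \<Longrightarrow>
      \<exists>p q. \<forall>s\<in>S. poly q s \<noteq> 0 \<and> poly q s * crd i (\<gamma> s (e j)) = poly p s"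
  shows "connectedin zariski (\<gamma> ` S)"
proof -
  let ?Q = "\<lambda>f. \<exists>p q. \<forall>s\<in>S. poly q s \<noteq> 0 \<and> poly q s * f s = poly p s"
  have rational: "?Q (\<lambda>s. f (\<gamma> s))" if "f \<in> end_coords" for f
    using that
  proof (rule end_coords_pullback[where X = S])
    show "?Q (\<lambda>_. c)" for c
      by (intro exI[of _ "[:c:]"] exI[of _ 1]) auto
    show "?Q (\<lambda>s. f s * h s)" if f: "?Q f" and h: "?Q h" for f h
    proof -
      obtain p q p' q' where
        *: "\<forall>s\<in>S. poly q s \<noteq> 0 \<and> poly q s * f s = poly p s"
        "\<forall>s\<in>S. poly q' s \<noteq> 0 \<and> poly q' s * h s = poly p' s" using f h by blast
      have "poly (q * q') s \<noteq> 0 \<and> poly (q * q') s * (f s * h s) = poly (p * p') s"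
        if "s \<in> S" for s
      proof -
        have "poly p s = poly q s * f s" "poly p' s = poly q' s * h s"
          using *[rule_format, OF that] by auto
        then show ?thesis using *[rule_format, OF that] by (simp add: mult_ac)
      qed
      then show ?thesis by blast
    qed
    show "?Q (\<lambda>s. f s + h s)" if f: "?Q f" and h: "?Q h" for f h
    proof -
      obtain p q p' q' where
        *: "\<forall>s\<in>S. poly q s \<noteq> 0 \<and> poly q s * f s = poly p s"
        "\<forall>s\<in>S. poly q' s \<noteq> 0 \<and> poly q' s * h s = poly p' s" using f h by blast
      have "poly (q * q') s \<noteq> 0 \<and> poly (q * q') s * (f s + h s) = poly (p * q' + p' * q) s"
        if "s \<in> S" for s
        using *[rule_format, OF that] by (auto simp: algebra_simps)
      then show ?thesis by blast
    qed
    show "?Q h" if "?Q f" "\<And>s. s \<in> S \<Longrightarrow> f s = h s" for f h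
      using that by metis
  qed (use \<gamma> SL_lin entries in auto)
  have cofinite: "finite {s \<in> S. \<gamma> s \<notin> U}" if "openin zariski U" "s0 \<in> S" "\<gamma> s0 \<in> U" for U s0
    using that unfolding zariski_def openin_topology_generated_by_iff
  proof (induction arbitrary: s0 rule: generate_topology_on.induct)
    case (Int A B)
    have "{s \<in> S. \<gamma> s \<notin> A \<inter> B} = {s \<in> S. \<gamma> s \<notin> A} \<union> {s \<in> S. \<gamma> s \<notin> B}" by auto
    then show ?case using Int by auto
  next
    case (UN K)
    then obtain A where "A \<in> K" "\<gamma> s0 \<in> A" by auto
    then have "finite {s \<in> S. \<gamma> s \<notin> A}" using UN by blast
    then show ?case by (rule rev_finite_subset) (use \<open>A \<in> K\<close> in auto)
  next
    case (Basis U)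
    then obtain f where f: "f \<in> end_coords" and U: "U = {g \<in> carrier SL. f g \<noteq> 0}" by auto
    obtain p q where pq: "\<And>s. s \<in> S \<Longrightarrow> poly q s \<noteq> 0 \<and> poly q s * f (\<gamma> s) = poly p s"
      using rational[OF f] by blast
    have "poly p s0 \<noteq> 0" using pq[of s0] Basis U by force
    then have "finite {s. poly p s = 0}" by (intro poly_roots_finite) auto
    then show ?case
      by (rule rev_finite_subset) (use pq U \<gamma> in force)
  qed auto
  show ?thesis
  proof (rule ccontr)
    assume "\<not> connectedin zariski (\<gamma> ` S)"
    then obtain U1 U2 where U: "openin zariski U1" "openin zariski U2"
      "\<gamma> ` S \<subseteq> U1 \<union> U2" "U1 \<inter> U2 \<inter> \<gamma> ` S = {}" "U1 \<inter> \<gamma> ` S \<noteq> {}" "U2 \<inter> \<gamma> ` S \<noteq> {}"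
      using \<gamma> unfolding connectedin by (auto simp: topspace_zariski)
    have "S \<subseteq> {s \<in> S. \<gamma> s \<notin> U1} \<union> {s \<in> S. \<gamma> s \<notin> U2}" using U(4) by auto
    moreover have "finite {s \<in> S. \<gamma> s \<notin> U1}" "finite {s \<in> S. \<gamma> s \<notin> U2}"
      using U(5,6) cofinite[OF U(1)] cofinite[OF U(2)] by auto
    ultimately show False using S finite_subset by blast
  qed
qed

subsection \<open>Stabilisers of subspaces\<close>

definition stab :: "'b set \<Rightarrow> ('b \<Rightarrow> 'b) set"
  where "stab U = {g \<in> carrier SL. g ` U \<subseteq> U}"

lemma stabD: "g \<in> stab U \<Longrightarrow> v \<in> U \<Longrightarrow> g v \<in> U"
  by (auto simp: stab_def)

lemma separating_functional:
  assumes "subspace U" "w \<notin> U"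
  obtains \<phi> where "fnl \<phi>" "\<And>u. u \<in> U \<Longrightarrow> \<phi> u = 0" "\<phi> w = 1"
proof -
  interpret vp: vector_space_pair scale "(*)"
    using vector_space_axioms vector_space_mult by (simp add: vector_space_pair_def)
  obtain B where B: "B \<subseteq> U" "independent B" "U \<subseteq> span B" by (rule basis_exists[of U])
  have "span B \<subseteq> U" using span_minimal[OF B(1) assms(1)] .
  then have w: "w \<notin> span B" using assms(2) by auto
  then have "independent (insert w B)" using B(2) by (rule independent_insertI)
  then have "\<exists>\<phi>. fnl \<phi> \<and> (\<forall>x\<in>insert w B. \<phi> x = (if x = w then 1 else 0))"
    by (rule vp.linear_independent_extend)
  then obtain \<phi> where \<phi>: "fnl \<phi>" "\<forall>x\<in>insert w B. \<phi> x = (if x = w then 1 else 0)" by blast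
  have "w \<notin> B" using w span_base by blast
  then have "\<And>b. b \<in> B \<Longrightarrow> \<phi> b = 0" using \<phi>(2) by auto
  then have "\<phi> u = 0" if "u \<in> U" for u
    using vp.linear_eq_0_on_span[OF \<phi>(1)] B(3) that by blast
  with \<phi> show ?thesis using that by auto
qed

lemma lin_inj_image_eq:
  assumes "lin g" "inj g" "subspace U" "g ` U \<subseteq> U"
  shows "g ` U = U"
proof -
  interpret fp: finite_dimensional_vector_space_pair_1 scale "e ` {..<n}" scale
    by unfold_locales
  have "dim (g ` U) = dim U"
    using assms(2) by (intro fp.dim_image_eq assms(1)) (auto simp: inj_on_def)
  moreover have "subspace (g ` U)"
    using fp.linear_subspace_image[OF assms(1,3)] .
  ultimately show ?thesis using subspace_dim_equal[of "g ` U" U] assms by simp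
qed

lemma stab_subgroup:
  assumes "subspace U"
  shows "subgroup (stab U) SL"
proof (rule SLg.subgroupI)
  show "stab U \<noteq> {}" using id_SL by (auto simp: stab_def)
  fix g assume g: "g \<in> stab U"
  then have SL: "g \<in> carrier SL" "g ` U \<subseteq> U" by (auto simp: stab_def)
  then have img: "g ` U = U" using lin_inj_image_eq[OF SL_lin SL_inj assms] by blast
  have "(inv\<^bsub>SL\<^esub> g) v \<in> U" if "v \<in> U" for v
  proof -
    have "v \<in> g ` U" using that by (simp only: img)
    then obtain w where "v = g w" "w \<in> U" by (rule imageE)
    then show ?thesis using SL_inv_left[OF SL(1)] by simp
  qed
  then show "inv\<^bsub>SL\<^esub> g \<in> stab U" using SL by (auto simp: stab_def)
next
  fix g h assume "g \<in> stab U" "h \<in> stab U"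
  then show "g \<otimes>\<^bsub>SL\<^esub> h \<in> stab U"
    by (simp add: stab_def SL_comp image_subset_iff)
next
  show "stab U \<subseteq> carrier SL" by (auto simp: stab_def)
qed

text \<open>
  The stabiliser of \<open>U\<close> is cut out by the equations \<open>\<phi> (g v) = 0\<close> for \<open>v \<in> U\<close> and functionals \<open>\<phi>\<close>
  vanishing on \<open>U\<close>.
\<close>

lemma stab_closed_subgroup:
  assumes "subspace U"
  shows "closed_subgroup (stab U)"
proof -
  let ?F = "{\<lambda>g. \<phi> (g v) | \<phi> v. fnl \<phi> \<and> v \<in> U \<and> (\<forall>u\<in>U. \<phi> u = 0)}"
  have "stab U = {g \<in> carrier SL. \<forall>f\<in>?F. f g = 0}"
  proof (intro equalityI subsetI)
    fix g assume g: "g \<in> {g \<in> carrier SL. \<forall>f\<in>?F. f g = 0}"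
    have "g v \<in> U" if "v \<in> U" for v
    proof (rule ccontr)
      assume "g v \<notin> U"
      then obtain \<phi> where \<phi>: "fnl \<phi>" "\<And>u. u \<in> U \<Longrightarrow> \<phi> u = 0" "\<phi> (g v) = 1"
        using separating_functional[OF assms, of "g v"] by metis
      have "(\<lambda>g. \<phi> (g v)) \<in> ?F"
        by (rule CollectI, intro exI[of _ \<phi>] exI[of _ v]) (use \<phi>(1,2) that in simp)
      moreover have "\<forall>f\<in>?F. f g = 0" using g unfolding mem_Collect_eq by (rule conjunct2)
      ultimately have "\<phi> (g v) = 0" by (rule bspec[rotated])
      then show False using \<phi>(3) by simp
    qed
    then show "g \<in> stab U" using g by (auto simp: stab_def)
  qed (auto simp: stab_def)
  moreover have "?F \<subseteq> end_coords" using end_coords_gen by auto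
  ultimately have "closedin zariski (stab U)" using closedin_common_zeros by (simp only:)
  then show ?thesis using stab_subgroup[OF assms] by (simp only: closed_subgroup_def simp_thms)
qed

lemma closed_subgroup_Inter:
  assumes "\<And>i. i \<in> I \<Longrightarrow> closed_subgroup (G i)" "I \<noteq> {}"
  shows "closed_subgroup (\<Inter>i\<in>I. G i)"
proof -
  have "subgroup (\<Inter>(G ` I)) SL"
    using assms by (intro SLg.subgroups_Inter) (auto simp: closed_subgroup_def)
  then show ?thesis using assms by (auto simp: closed_subgroup_def)
qed

end

section \<open>The stabiliser of a complete flag\<close>

context based_space
begin

definition flag :: "nat \<Rightarrow> 'b set"
  where "flag i = {v. \<forall>j<n. i \<le> j \<longrightarrow> crd j v = 0}"

lemma subspace_flag: "subspace (flag i)"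
  by (rule subspaceI) (auto simp: flag_def)

lemma span_flag: "span (flag i) = flag i"
  by (simp add: subspace_flag)

lemma span_insert_flag: "x \<in> span (insert w (flag i)) \<longleftrightarrow> (\<exists>k. x - k *s w \<in> flag i)"
  by (simp only: span_breakdown_eq span_flag)

lemma flag_0: "flag 0 = {0}"
  using crd_eqI[of _ 0] by (auto simp: flag_def)

lemma flag_full: "n \<le> i \<Longrightarrow> flag i = UNIV"
  by (auto simp: flag_def)

lemma flag_mono: "i \<le> j \<Longrightarrow> flag i \<subseteq> flag j"
  by (auto simp: flag_def)

lemma e_in_flag: "j < n \<Longrightarrow> e j \<in> flag i \<longleftrightarrow> j < i"
  by (auto simp: flag_def crd_e)

lemma flag_span: "flag i = span (e ` {..<min i n})"
proof
  show "span (e ` {..<min i n}) \<subseteq> flag i"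
    by (rule span_minimal[OF _ subspace_flag]) (auto simp: e_in_flag)
  show "flag i \<subseteq> span (e ` {..<min i n})"
  proof
    fix v assume v: "v \<in> flag i"
    have "v = (\<Sum>j<n. crd j v *s e j)" by (simp add: expand)
    also have "\<dots> = (\<Sum>j<min i n. crd j v *s e j)"
      using v by (intro sum.mono_neutral_right) (auto simp: flag_def)
    also have "\<dots> \<in> span (e ` {..<min i n})"
      by (intro span_sum span_scale span_base) auto
    finally show "v \<in> span (e ` {..<min i n})" .
  qed
qed

lemma dim_flag: "i \<le> n \<Longrightarrow> dim (flag i) = i"
proof -
  assume i: "i \<le> n"
  then have "{..<i} \<subseteq> {..<n}" by auto
  then have "independent (e ` {..<i})" "inj_on e {..<i}"
    by (rule independent_mono[OF indep_e image_mono], rule inj_on_subset[OF inj_e])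
  then show ?thesis
    using i by (simp add: flag_span dim_eq_card_independent card_image min_absorb1)
qed

definition upper :: "('b \<Rightarrow> 'b) set"
  where "upper = (\<Inter>i. stab (flag i))"

lemma upper_flag: "g \<in> upper \<Longrightarrow> v \<in> flag i \<Longrightarrow> g v \<in> flag i"
  by (auto simp: upper_def stab_def)

lemma closed_subgroup_upper: "closed_subgroup upper"
  unfolding upper_def
  by (rule closed_subgroup_Inter[of UNIV]) (auto intro: stab_closed_subgroup subspace_flag)

lemma subgroup_upper: "subgroup upper SL"
  using closed_subgroup_upper by (simp add: closed_subgroup_def)

lemma upper_SL: "g \<in> upper \<Longrightarrow> g \<in> carrier SL"
  using subgroup.subset[OF subgroup_upper] by blast

lemma upperI:
  assumes "g \<in> carrier SL" "\<And>i j. i < n \<Longrightarrow> j < i \<Longrightarrow> crd i (g (e j)) = 0"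
  shows "g \<in> upper"
proof -
  have "g v \<in> flag i" if "v \<in> flag i" for v i
  proof -
    have "g v = (\<Sum>j<n. crd j v *s g (e j))" by (rule lin_expand[OF SL_lin[OF assms(1)]])
    moreover have "crd k (crd j v *s g (e j)) = 0" if "k < n" "i \<le> k" "j < n" for j k
      using that assms(2)[of k j] \<open>v \<in> flag i\<close> by (cases "j < i") (auto simp: flag_def)
    ultimately have "crd k (g v) = 0" if "k < n" "i \<le> k" for k
      using that by (simp only: crd_sum) (auto intro!: sum.neutral)
    then show ?thesis by (simp add: flag_def)
  qed
  then show ?thesis using assms(1) by (auto simp: upper_def stab_def)
qed

lemma upper_lower_entry: "g \<in> upper \<Longrightarrow> i < n \<Longrightarrow> j < i \<Longrightarrow> crd i (g (e j)) = 0"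
  using upper_flag[of g "e j" "Suc j"] e_in_flag[of j "Suc j"] by (auto simp: flag_def)

lemma det_mtx_triangular:
  assumes "\<And>i j. i < n \<Longrightarrow> j < i \<Longrightarrow> crd i (g (e j)) = 0"
  shows "Determinant.det (mtx g) = (\<Prod>i<n. crd i (g (e i)))"
proof -
  have "upper_triangular (mtx g)" using assms by (auto simp: upper_triangular_def)
  then show ?thesis
    using det_upper_triangular[OF _ mtx_carrier[of g]] by (simp add: prod_list_diag_prod atLeast0LessThan)
qed

text \<open>For \<open>j = 0\<close> these are all the transvections with centre \<open>e 0\<close>.\<close>

lemma transvection_upper:
  assumes j: "j < n" and \<phi>: "fnl \<phi>" and 0: "\<And>i. i \<le> j \<Longrightarrow> \<phi> (e i) = 0"
  shows "(\<lambda>v. v + \<phi> v *s e j) \<in> upper"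
proof -
  let ?t = "\<lambda>v. v + \<phi> v *s e j"
  have lower: "crd i (?t (e k)) = 0" if "i < n" "k < i" for i k
    using that j 0 by (auto simp: crd_e)
  have "lin ?t"
    by (rule linI) (auto simp: fnl_add[OF \<phi>] fnl_scale[OF \<phi>] scale_left_distrib scale_right_distrib)
  moreover have "(\<Prod>i<n. crd i (?t (e i))) = 1"
    using j 0 by (intro prod.neutral) (auto simp: crd_e)
  ultimately have "?t \<in> carrier SL"
    using det_mtx_triangular[of ?t, OF lower] by (simp add: SL_iff)
  then show ?thesis using lower by (rule upperI)
qed

subsection \<open>The flag consists of all stable subspaces\<close>

text \<open>
  If \<open>m\<close> is the largest index of a coordinate that is not identically zero on \<open>Y\<close>, then the
  transvections \<open>v \<mapsto> v + crd m v *s e j\<close> with \<open>j < m\<close> force \<open>e j \<in> Y\<close>.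
\<close>

lemma upper_stable_subspace:
  assumes Y: "subspace Y" and stable: "\<And>g. g \<in> upper \<Longrightarrow> g ` Y \<subseteq> Y"
  shows "\<exists>i\<le>n. Y = flag i"
proof (cases "Y = {0}")
  case True
  then show ?thesis using flag_0 by blast
next
  case False
  let ?K = "{k. k < n \<and> (\<exists>v\<in>Y. crd k v \<noteq> 0)}"
  obtain v where "v \<in> Y" "v \<noteq> 0" using False subspace_0[OF Y] by blast
  then have K: "?K \<noteq> {}" "finite ?K" using crd_eqI[of v 0] by auto
  define m where "m = Max ?K"
  have "m \<in> ?K" unfolding m_def using K by (intro Max_in)
  then obtain v where m: "m < n" and v: "v \<in> Y" "crd m v \<noteq> 0" by auto
  have max: "k \<le> m" if "k \<in> ?K" for k unfolding m_def using K(2) that by (rule Max_ge)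
  have sub: "Y \<subseteq> flag (Suc m)" using max by (fastforce simp: flag_def)
  have low: "e j \<in> Y" if "j < m" for j
  proof -
    have "(\<lambda>v. v + crd m v *s e j) \<in> upper"
      using that m by (intro transvection_upper fnl_crd) (auto simp: crd_e)
    then have "v + crd m v *s e j \<in> Y" using stable v(1) by blast
    then have "crd m v *s e j \<in> Y" using subspace_diff[OF Y _ v(1)] by fastforce
    then have "inverse (crd m v) *s (crd m v *s e j) \<in> Y" by (rule subspace_scale[OF Y])
    then show ?thesis using v(2) by simp
  qed
  have "v = (\<Sum>j<n. crd j v *s e j)" by (simp add: expand)
  also have "\<dots> = (\<Sum>j<Suc m. crd j v *s e j)"
    using v(1) sub m by (intro sum.mono_neutral_right) (auto simp: flag_def)
  finally have "crd m v *s e m = v - (\<Sum>j<m. crd j v *s e j)" by (simp add: algebra_simps)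
  also have "\<dots> \<in> Y" using low by (intro subspace_diff[OF Y] v subspace_sum[OF Y] subspace_scale[OF Y]) auto
  finally have "inverse (crd m v) *s (crd m v *s e m) \<in> Y" by (rule subspace_scale[OF Y])
  then have "e m \<in> Y" using v(2) by simp
  then have "e ` {..<min (Suc m) n} \<subseteq> Y" using low by (auto simp: less_Suc_eq)
  then have "flag (Suc m) \<subseteq> Y" unfolding flag_span by (rule span_minimal[OF _ Y])
  then show ?thesis using sub m by (intro exI[of _ "Suc m"]) auto
qed

subsection \<open>Connectedness\<close>

text \<open>
  An upper triangular \<open>b\<close> of determinant one with diagonal \<open>t\<^sub>0, \<dots>, t\<^sub>n\<^sub>-\<^sub>1\<close> is joined to the
  identity by a rational curve: scale the entries above the diagonal by \<open>s\<close>, move the first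
  \<open>n - 1\<close> diagonal entries along \<open>1 + s (t\<^sub>i - 1)\<close>, and let the last one correct the determinant.
\<close>

lemma connectedin_upper:
  assumes inf: "infinite (UNIV :: 'a set)" and n: "0 < n"
  shows "connectedin zariski upper"
proof -
  have curve: "\<exists>C. connectedin zariski C \<and> id \<in> C \<and> b \<in> C \<and> C \<subseteq> upper" if b: "b \<in> upper" for b
  proof -
    \<comment> \<open>\<open>\<gamma>\<close> is the curve, defined where \<open>q\<close>, the product of the first \<open>n - 1\<close> diagonal entries, is non-zero\<close>
    define t where "t k = crd k (b (e k))" for k
    define dpoly where "dpoly k = [:1, t k - 1:]" for k
    define q where "q = (\<Prod>k<n - 1. dpoly k)"
    define S where "S = {s. poly q s \<noteq> 0}"
    define \<gamma> where "\<gamma> s = endo (mat n n (\<lambda>(i, j). if i = j then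
        (if i < n - 1 then poly (dpoly i) s else inverse (poly q s)) else s * crd i (b (e j))))" for s
    have q0: "poly q 0 = 1" by (simp add: q_def dpoly_def poly_prod)
    then have "q \<noteq> 0" by auto
    then have "finite {s. poly q s = 0}" by (rule poly_roots_finite)
    moreover have "S = UNIV - {s. poly q s = 0}" by (auto simp: S_def)
    ultimately have S: "infinite S" using inf by simp
    have split: "(\<Prod>i<n. f i) = (\<Prod>i<n - 1. f i) * f (n - 1)" for f :: "nat \<Rightarrow> 'a"
      using n by (metis Suc_pred' prod.lessThan_Suc)
    have "Determinant.det (mtx b) = 1" using upper_SL[OF b] by (simp add: SL_iff)
    then have tn: "(\<Prod>i<n - 1. t i) * t (n - 1) = 1"
      using det_mtx_triangular[of b] upper_lower_entry[OF b] split[of t] by (simp add: t_def)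
    have q1: "poly q 1 = (\<Prod>i<n - 1. t i)" by (simp add: q_def dpoly_def poly_prod)
    then have q1': "inverse (poly q 1) = t (n - 1)" "poly q 1 \<noteq> 0"
      using tn by (metis inverse_unique, metis mult_zero_left zero_neq_one)
    have entry: "crd i (\<gamma> s (e j)) = (if i = j then (if i < n - 1 then poly (dpoly i) s
        else inverse (poly q s)) else s * crd i (b (e j)))" if "i < n" "j < n" for i j s
      using that mtx_index[OF that, of "\<gamma> s"] by (simp add: \<gamma>_def mtx_endo)
    have lin: "lin (\<gamma> s)" for s by (simp add: \<gamma>_def lin_endo)
    have upper: "\<gamma> s \<in> upper" if s: "s \<in> S" for s
    proof -
      have lower: "crd i (\<gamma> s (e j)) = 0" if "i < n" "j < i" for i j
        using that upper_lower_entry[OF b] by (simp add: entry)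
      have "(\<Prod>i<n. crd i (\<gamma> s (e i))) = (\<Prod>i<n - 1. poly (dpoly i) s) * inverse (poly q s)"
        unfolding split using n by (intro arg_cong2[of _ _ _ _ "(*)"] prod.cong) (auto simp: entry)
      also have "\<dots> = 1" using s by (simp add: q_def poly_prod S_def)
      finally have "\<gamma> s \<in> carrier SL"
        using det_mtx_triangular[of "\<gamma> s"] lower lin by (simp add: SL_iff)
      then show ?thesis using lower by (rule upperI)
    qed
    have "connectedin zariski (\<gamma> ` S)"
    proof (rule connectedin_rational_curve[OF S])
      show "\<gamma> s \<in> carrier SL" if "s \<in> S" for s using upper[OF that] by (rule upper_SL)
      fix i j assume ij: "i < n" "j < n"
      show "\<exists>p q. \<forall>s\<in>S. poly q s \<noteq> 0 \<and> poly q s * crd i (\<gamma> s (e j)) = poly p s"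
      proof -
        let ?p = "if i = j then if i < n - 1 then q * dpoly i else 1 else q * [:0, crd i (b (e j)):]"
        have "poly q s \<noteq> 0 \<and> poly q s * crd i (\<gamma> s (e j)) = poly ?p s" if "s \<in> S" for s
          using that ij by (auto simp: S_def entry)
        then show ?thesis by blast
      qed
    qed
    moreover have "\<gamma> 0 = id"
      by (rule lin_eqI[OF lin lin_id], rule crd_eqI) (auto simp: entry crd_e q0 dpoly_def)
    moreover have "\<gamma> 1 = b"
    proof (rule lin_eqI[OF lin SL_lin[OF upper_SL[OF b]]], rule crd_eqI)
      fix i j assume ij: "i < n" "j < n"
      then have "\<not> i < n - 1 \<Longrightarrow> i = n - 1" by auto
      with ij show "crd i (\<gamma> 1 (e j)) = crd i (b (e j))"
        by (auto simp: entry dpoly_def q1'(1) t_def)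
    qed
    moreover have "0 \<in> S" "1 \<in> S" using q0 q1' by (auto simp: S_def)
    ultimately show ?thesis
      using upper by (intro exI[of _ "\<gamma> ` S"]) (metis image_eqI image_subsetI)
  qed
  have "\<Union>{C. connectedin zariski C \<and> id \<in> C \<and> C \<subseteq> upper} = upper"
    using curve by blast
  then show ?thesis
    using connectedin_Union[of "{C. connectedin zariski C \<and> id \<in> C \<and> C \<subseteq> upper}" zariski] by force
qed

subsection \<open>Solvability\<close>

lemma derived_SL_subset:
  assumes "subgroup H SL"
  shows "(derived SL ^^ k) H \<subseteq> H"
proof (induction k)
  case (Suc k)
  then show ?case using SLg.derived_incl[OF Suc assms] by simp
qed simp

lemma derived_subgrp:
  assumes "subgroup H SL"
  shows "(derived (subgrp H) ^^ k) H = (derived SL ^^ k) H"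
proof (induction k)
  case (Suc k)
  then show ?case
    using SLg.derived_consistent[OF derived_SL_subset[OF assms] assms] by simp
qed simp

lemma solvable_subgrp_iff:
  assumes "subgroup H SL"
  shows "solvable (subgrp H) \<longleftrightarrow> (\<exists>k. (derived SL ^^ k) H = {id})"
  using group.solvable_iff_trivial_derived_seq[OF SLg.subgroup_imp_group[OF assms]]
    derived_subgrp[OF assms] by simp

text \<open>
  A descending filtration of the upper triangular group whose terms contain those of the derived
  series: \<open>shift 0\<close> is the whole group, \<open>shift 1\<close> its unipotent part and \<open>shift n\<close> is trivial.
\<close>

definition shift :: "nat \<Rightarrow> ('b \<Rightarrow> 'b) set"
  where "shift k = {g \<in> upper. \<forall>i. \<forall>v\<in>flag (i + k). g v - v \<in> flag i}"

lemma shift_subgroup: "subgroup (shift k) SL"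
proof (rule SLg.subgroupI)
  show "shift k \<subseteq> carrier SL" using upper_SL by (auto simp: shift_def)
  show "shift k \<noteq> {}"
    using subgroup.one_closed[OF subgroup_upper] subspace_0[OF subspace_flag] by (auto simp: shift_def)
next
  fix g assume g: "g \<in> shift k"
  then have gu: "g \<in> upper" and gSL: "g \<in> carrier SL" using upper_SL by (auto simp: shift_def)
  let ?i = "inv\<^bsub>SL\<^esub> g"
  have iu: "?i \<in> upper" using subgroup.m_inv_closed[OF subgroup_upper gu] .
  have "?i v - v \<in> flag i" if "v \<in> flag (i + k)" for v i
  proof -
    have "?i (g v - v) \<in> flag i" using g that upper_flag[OF iu] by (auto simp: shift_def)
    then have "- ?i (g v - v) \<in> flag i" by (rule subspace_neg[OF subspace_flag])
    then show ?thesis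
      using lin_diff[OF SL_lin[OF upper_SL[OF iu]]] SL_inv_left[OF gSL] by simp
  qed
  then show "?i \<in> shift k" using iu by (simp add: shift_def)
next
  fix g h assume g: "g \<in> shift k" and h: "h \<in> shift k"
  then have gu: "g \<in> upper" and hu: "h \<in> upper" by (auto simp: shift_def)
  have "g (h v) - v \<in> flag i" if v: "v \<in> flag (i + k)" for v i
  proof -
    have "h v \<in> flag (i + k)" using upper_flag[OF hu v] .
    then have "g (h v) - h v \<in> flag i" "h v - v \<in> flag i" using g h v by (auto simp: shift_def)
    from subspace_add[OF subspace_flag this] show ?thesis by simp
  qed
  then show "g \<otimes>\<^bsub>SL\<^esub> h \<in> shift k"
    using subgroup.m_closed[OF subgroup_upper gu hu] by (simp add: shift_def)
qed

text \<open>
  The bracket \<open>gh - hg\<close> moves every \<open>flag (i + k + 1)\<close> into \<open>flag i\<close>: for \<open>k = 0\<close> because \<open>g\<close> and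
  \<open>h\<close> act by scalars on the lines \<open>flag (i + 1) / flag i\<close>, for \<open>k \<ge> 1\<close> because it equals the
  bracket of \<open>g - 1\<close> and \<open>h - 1\<close>, which lowers the flag by \<open>2k\<close>.
\<close>

lemma shift_bracket:
  assumes g: "g \<in> shift k" and h: "h \<in> shift k" and w: "w \<in> flag (i + Suc k)"
  shows "g (h w) - h (g w) \<in> flag i"
proof (cases "k = 0")
  case False
  have gu: "g \<in> upper" and hu: "h \<in> upper" using g h by (auto simp: shift_def)
  have nil: "a (b w - w) - (b w - w) \<in> flag i" if "a \<in> shift k" "b \<in> shift k" for a b
  proof -
    have "b w - w \<in> flag (i + 1)" using that(2) w by (auto simp: shift_def)
    moreover have "i + 1 \<le> (i + 1 - k) + k" by arith
    ultimately have "b w - w \<in> flag ((i + 1 - k) + k)" using flag_mono by blast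
    then have "a (b w - w) - (b w - w) \<in> flag (i + 1 - k)" using that(1) by (auto simp: shift_def)
    moreover have "i + 1 - k \<le> i" using False by arith
    ultimately show ?thesis using flag_mono by blast
  qed
  have "g (h w) - h (g w) = (g (h w - w) - (h w - w)) - (h (g w - w) - (g w - w))"
    using lin_diff[OF SL_lin[OF upper_SL[OF gu]]] lin_diff[OF SL_lin[OF upper_SL[OF hu]]]
    by (simp add: algebra_simps)
  then show ?thesis using subspace_diff[OF subspace_flag nil[OF g h] nil[OF h g]] by simp
next
  case True
  have gu: "g \<in> upper" and hu: "h \<in> upper" using g h by (auto simp: shift_def)
  note lg = SL_lin[OF upper_SL[OF gu]] and lh = SL_lin[OF upper_SL[OF hu]]
  show ?thesis
  proof (cases "i < n")
    case i: True
    have scalar: "a w - (crd i (a (e i))) *s w \<in> flag i" if a: "a \<in> upper" and w: "w \<in> flag (Suc i)" for a w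
    proof -
      have "w - crd i w *s e i \<in> flag i"
        using w i by (auto simp: flag_def crd_e le_less_Suc_eq Suc_le_eq le_less)
      then have "a (w - crd i w *s e i) \<in> flag i" by (rule upper_flag[OF a])
      moreover have "crd j (a w) = 0" if "j < n" "i < j" for j
        using upper_flag[OF a w] that by (auto simp: flag_def)
      ultimately show ?thesis
        using w i lin_diff[OF SL_lin[OF upper_SL[OF a]]] lin_scale[OF SL_lin[OF upper_SL[OF a]]]
        by (auto simp: flag_def le_less)
    qed
    let ?a = "crd i (g (e i))" and ?b = "crd i (h (e i))"
    have w': "w \<in> flag (Suc i)" using w True by simp
    have "g (h w - ?b *s w) \<in> flag i" "h (g w - ?a *s w) \<in> flag i"
      using scalar[OF hu w'] scalar[OF gu w'] upper_flag[OF gu] upper_flag[OF hu] by auto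
    moreover have "?b *s (g w - ?a *s w) \<in> flag i" "?a *s (h w - ?b *s w) \<in> flag i"
      using scalar[OF hu w'] scalar[OF gu w'] by (auto intro: subspace_scale[OF subspace_flag])
    ultimately have "(g (h w - ?b *s w) + ?b *s (g w - ?a *s w))
        - (h (g w - ?a *s w) + ?a *s (h w - ?b *s w)) \<in> flag i"
      by (intro subspace_diff[OF subspace_flag] subspace_add[OF subspace_flag])
    then show ?thesis
      by (simp add: lin_diff[OF lg] lin_diff[OF lh] lin_scale[OF lg] lin_scale[OF lh]
          scale_right_diff_distrib mult.commute)
  qed (simp add: flag_full)
qed

lemma solvable_upper: "solvable (subgrp upper)"
proof -
  have step: "derived SL (shift k) \<subseteq> shift (Suc k)" for k
    unfolding derived_def
  proof (rule SLg.generate_subgroup_incl[OF _ shift_subgroup], clarsimp)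
    fix g h assume g: "g \<in> shift k" and h: "h \<in> shift k"
    then have gu: "g \<in> upper" and hu: "h \<in> upper" by (auto simp: shift_def)
    let ?gi = "inv\<^bsub>SL\<^esub> g" and ?hi = "inv\<^bsub>SL\<^esub> h"
    have iu: "?gi \<in> upper" "?hi \<in> upper"
      using subgroup.m_inv_closed[OF subgroup_upper] gu hu by auto
    have "g (h (?gi (?hi v))) - v \<in> flag i" if "v \<in> flag (i + Suc k)" for v i
    proof -
      have "?gi (?hi v) \<in> flag (i + Suc k)" using that upper_flag iu by blast
      from shift_bracket[OF g h this] show ?thesis
        by (simp only: SL_inv_right[OF upper_SL[OF gu]] SL_inv_right[OF upper_SL[OF hu]])
    qed
    moreover have "g \<circ> h \<circ> ?gi \<circ> ?hi \<in> upper"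
      using subgroup.m_closed[OF subgroup_upper] gu hu iu by simp
    ultimately show "g \<circ> h \<circ> ?gi \<circ> ?hi \<in> shift (Suc k)"
      by (simp add: shift_def)
  qed
  have "(derived SL ^^ k) upper \<subseteq> shift k" for k
  proof (induction k)
    case 0
    show ?case using upper_flag by (auto simp: shift_def intro!: subspace_diff[OF subspace_flag])
  next
    case (Suc k)
    show ?case using SLg.mono_derived[OF Suc] step by fastforce
  qed
  moreover have "g = id" if g: "g \<in> shift n" for g
  proof
    fix v
    have "g v - v \<in> flag 0" using g flag_full[of n] by (auto simp: shift_def)
    then show "g v = id v" by (simp add: flag_0)
  qed
  ultimately have "(derived SL ^^ n) upper \<subseteq> {id}" by blast
  moreover have "id \<in> (derived SL ^^ n) upper"
    using subgroup.one_closed[OF SLg.exp_of_derived_is_subgroup[OF subgroup_upper]] by simp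
  ultimately show ?thesis using solvable_subgrp_iff[OF subgroup_upper] by blast
qed

subsection \<open>Irreducible overgroups\<close>

text \<open>
  If a subgroup \<open>G\<close> contains the flag stabiliser, then it contains all transvections with centre
  \<open>e 0\<close>. The centres \<open>w\<close> such that all transvections along \<open>w\<close> lie in \<open>G\<close> form a \<open>G\<close>-stable set
  that is closed under addition, because a transvection along \<open>w1\<close> moves \<open>w2\<close> to \<open>w2 + w1\<close>
  as soon as \<open>w1\<close> and \<open>w2\<close> are independent.
\<close>

lemma irreducible_overgroup_transvections:
  assumes G: "subgroup G SL" and up: "upper \<subseteq> G" and n: "0 < n"
    and irr: "\<And>Y. subspace Y \<Longrightarrow> (\<And>g. g \<in> G \<Longrightarrow> g ` Y \<subseteq> Y) \<Longrightarrow> Y = {0} \<or> Y = UNIV"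
    and \<phi>: "fnl \<phi>" "\<phi> w = 0"
  shows "(\<lambda>v. v + \<phi> v *s w) \<in> G"
proof -
  let ?C = "{w. \<forall>\<phi>. fnl \<phi> \<longrightarrow> \<phi> w = 0 \<longrightarrow> (\<lambda>v. v + \<phi> v *s w) \<in> G}"
  have GSL: "g \<in> carrier SL" if "g \<in> G" for g using subgroup.subset[OF G] that by blast
  have id: "id \<in> G" using subgroup.one_closed[OF G] by simp
  have stable: "g w \<in> ?C" if g: "g \<in> G" and w: "w \<in> ?C" for g w
  proof (intro CollectI allI impI)
    fix \<phi> assume \<phi>: "fnl \<phi>" "\<phi> (g w) = 0"
    let ?gi = "inv\<^bsub>SL\<^esub> g" and ?t = "\<lambda>v. v + \<phi> (g v) *s w"
    have "?t \<in> G" using w fnl_comp[OF \<phi>(1) SL_lin[OF GSL[OF g]]] \<phi>(2) by auto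
    then have "g \<circ> ?t \<circ> ?gi \<in> G"
      using subgroup.m_closed[OF G subgroup.m_closed[OF G g] subgroup.m_inv_closed[OF G g]] by simp
    moreover have "g \<circ> ?t \<circ> ?gi = (\<lambda>v. v + \<phi> v *s g w)"
      using SL_lin[OF GSL[OF g]] SL_inv_right[OF GSL[OF g]]
      by (auto simp: fun_eq_iff lin_add lin_scale)
    ultimately show "(\<lambda>v. v + \<phi> v *s g w) \<in> G" by simp
  qed
  have scale: "c *s w \<in> ?C" if w: "w \<in> ?C" for c w
  proof (intro CollectI allI impI)
    fix \<phi> assume \<phi>: "fnl \<phi>" "\<phi> (c *s w) = 0"
    show "(\<lambda>v. v + \<phi> v *s c *s w) \<in> G"
    proof (cases "c = 0")
      case True
      then show ?thesis using id by (simp add: id_def)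
    next
      case False
      have "fnl (\<lambda>v. \<phi> v * c)" using \<phi>(1) by (intro fnlI) (auto simp: fnl_add fnl_scale algebra_simps)
      moreover have "\<phi> w * c = 0" using \<phi> False by (simp add: fnl_scale[OF \<phi>(1)])
      ultimately show ?thesis using w by fastforce
    qed
  qed
  have add: "w1 + w2 \<in> ?C" if w1: "w1 \<in> ?C" and w2: "w2 \<in> ?C" for w1 w2
  proof (cases "w2 \<in> span {w1}")
    case True
    then obtain c where "w2 = c *s w1" by (auto simp: span_singleton)
    then have "w1 + w2 = (1 + c) *s w1" by (simp add: scale_left_distrib)
    then show ?thesis using scale[OF w1, of "1 + c"] by (simp only:)
  next
    case False
    obtain \<phi> where \<phi>: "fnl \<phi>" "\<And>u. u \<in> span {w1} \<Longrightarrow> \<phi> u = 0" "\<phi> w2 = 1"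
      using separating_functional[OF subspace_span False] by metis
    have "\<phi> w1 = 0" by (rule \<phi>(2)) (simp add: span_base)
    then have "(\<lambda>v. v + \<phi> v *s w1) \<in> G" using w1 \<phi>(1) by auto
    from stable[OF this w2] \<phi>(3) show ?thesis by (simp only: scale_one add.commute)
  qed
  have "e 0 \<in> ?C"
    using transvection_upper[OF n] up by auto
  moreover have "e 0 \<noteq> 0" using crd_e[OF n n] by force
  moreover have "subspace ?C"
  proof (rule subspaceI)
    show "0 \<in> ?C" using id by (simp add: id_def)
  qed (rule add, assumption+, rule scale, assumption)
  moreover have "g ` ?C \<subseteq> ?C" if "g \<in> G" for g using stable[OF that] by blast
  ultimately have "?C = UNIV" using irr[of ?C] by blast
  then have "w \<in> ?C" by simp
  then show ?thesis using \<phi> by blast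
qed

text \<open>
  Given \<open>g \<in> SL(V)\<close>, transvections in \<open>G\<close> move the images of \<open>e 0, \<dots>, e (n - 2)\<close> under \<open>g\<close> back to these
  vectors, one after the other. The resulting map fixes \<open>e 0, \<dots>, e (n - 2)\<close>, so it is upper
  triangular and lies in \<open>G\<close>. A transvection fixing \<open>F\<close> takes \<open>w\<close> to \<open>w'\<close> if these are independent
  modulo \<open>F\<close>; otherwise the next basis vector serves as an intermediate stop.
\<close>

lemma irreducible_overgroup_eq_SL:
  assumes G: "subgroup G SL" and up: "upper \<subseteq> G" and n: "0 < n"
    and irr: "\<And>Y. subspace Y \<Longrightarrow> (\<And>g. g \<in> G \<Longrightarrow> g ` Y \<subseteq> Y) \<Longrightarrow> Y = {0} \<or> Y = UNIV"
  shows "G = carrier SL"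
proof
  show "G \<subseteq> carrier SL" by (rule subgroup.subset[OF G])
  \<comment> \<open>the transvection \<open>v \<mapsto> v + \<phi> v *s (w' - w)\<close> works if \<open>\<phi> w = 1\<close> and \<open>\<phi>\<close> vanishes on \<open>F\<close> and \<open>w' - w\<close>\<close>
  have move: "\<exists>\<tau>\<in>G. (\<forall>x\<in>F. \<tau> x = x) \<and> \<tau> w = w'"
    if F: "subspace F" and w: "w \<notin> F" and w': "w' \<notin> span (insert w F)" for F w w'
  proof -
    have "w \<notin> span (insert (w' - w) F)"
    proof
      assume "w \<in> span (insert (w' - w) F)"
      then obtain k where "w - k *s (w' - w) \<in> span F" by (auto simp: span_breakdown_eq)
      then have k: "w - k *s (w' - w) \<in> F" using F span_eq_iff by blast
      show False
      proof (cases "k = 0")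
        case True
        then show False using k w by simp
      next
        case False
        have "(- inverse k) *s (w - k *s (w' - w)) \<in> F" by (rule subspace_scale[OF F k])
        moreover have "(- inverse k) *s (w - k *s (w' - w)) = w' - (1 + inverse k) *s w"
          using False by (simp add: scale_right_diff_distrib scale_left_distrib algebra_simps)
        ultimately have "w' - (1 + inverse k) *s w \<in> span F" using span_base by metis
        then show False using w' by (auto simp: span_breakdown_eq)
      qed
    qed
    then obtain \<phi> where \<phi>: "fnl \<phi>" "\<And>u. u \<in> span (insert (w' - w) F) \<Longrightarrow> \<phi> u = 0" "\<phi> w = 1"
      using separating_functional[OF subspace_span] by metis
    have "\<phi> (w' - w) = 0" "\<And>x. x \<in> F \<Longrightarrow> \<phi> x = 0"
      by (auto intro!: \<phi>(2) span_base)
    moreover have "(\<lambda>v. v + \<phi> v *s (w' - w)) \<in> G"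
      by (rule irreducible_overgroup_transvections[OF G up n irr \<phi>(1)]) (use calculation in auto)
    ultimately show ?thesis using \<phi>(3) by (intro bexI[of _ "\<lambda>v. v + \<phi> v *s (w' - w)"]) auto
  qed
  show "carrier SL \<subseteq> G"
  proof
    fix g assume g: "g \<in> carrier SL"
    have "\<exists>h\<in>G. \<forall>j<i. h (g (e j)) = e j" if "i \<le> n - 1" for i
      using that
    proof (induction i)
      case 0
      then show ?case using subgroup.one_closed[OF G] by auto
    next
      case (Suc i)
      then obtain h where h: "h \<in> G" "\<And>j. j < i \<Longrightarrow> h (g (e j)) = e j" by auto
      have hSL: "h \<circ> g \<in> carrier SL" using h(1) g SL_comp subgroup.subset[OF G] by blast
      let ?w = "h (g (e i))"
      have i: "i < n" "Suc i < n" using Suc(2) by auto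
      have fix_flag: "h (g v) = v" if "v \<in> flag i" for v
      proof -
        have "(h \<circ> g) v = (\<Sum>j<n. crd j v *s (h \<circ> g) (e j))" by (rule lin_expand[OF SL_lin[OF hSL]])
        also have "\<dots> = (\<Sum>j<n. crd j v *s e j)"
          using that h(2) by (intro sum.cong refl) (auto simp: flag_def not_less intro: ccontr)
        finally show ?thesis by (simp add: expand)
      qed
      have w: "?w \<notin> flag i"
      proof
        assume "?w \<in> flag i"
        then have "(h \<circ> g) ?w = (h \<circ> g) (e i)" using fix_flag[of ?w] by simp
        then have "?w = e i" by (rule injD[OF SL_inj[OF hSL]])
        then show False using \<open>?w \<in> flag i\<close> e_in_flag[OF i(1)] by simp
      qed
      have "\<exists>\<tau>\<in>G. (\<forall>x\<in>flag i. \<tau> x = x) \<and> \<tau> ?w = e i"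
      proof (cases "e i \<in> span (insert ?w (flag i))")
        case False
        then show ?thesis using move[OF subspace_flag w] by blast
      next
        case True
        then obtain k where k: "e i - k *s ?w \<in> flag i"
          unfolding span_insert_flag by blast
        have k0: "k \<noteq> 0"
        proof
          assume "k = 0"
          then have "e i \<in> flag i" using k by simp
          then show False using e_in_flag[OF i(1)] by simp
        qed
        have "e (Suc i) \<notin> span (insert ?w (flag i))"
        proof
          assume "e (Suc i) \<in> span (insert ?w (flag i))"
          then obtain c where c: "e (Suc i) - c *s ?w \<in> flag i"
            unfolding span_insert_flag by blast
          have "crd (Suc i) (e i - k *s ?w) = 0" "crd (Suc i) (e (Suc i) - c *s ?w) = 0"
            using k c i by (auto simp: flag_def)
          then show False using i k0 by (auto simp: crd_e)
        qed
        from move[OF subspace_flag w this] obtain \<tau> where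
          \<tau>: "\<tau> \<in> G" "\<forall>x\<in>flag i. \<tau> x = x" "\<tau> ?w = e (Suc i)" by blast
        have "e (Suc i) \<notin> flag i" using e_in_flag[OF i(2)] by simp
        moreover have "e i \<notin> span (insert (e (Suc i)) (flag i))"
        proof
          assume "e i \<in> span (insert (e (Suc i)) (flag i))"
          then obtain c where c: "e i - c *s e (Suc i) \<in> flag i"
            unfolding span_insert_flag by blast
          have "crd i (e i - c *s e (Suc i)) = 0" using c i by (auto simp: flag_def)
          then show False using i by (auto simp: crd_e)
        qed
        ultimately obtain \<sigma> where \<sigma>: "\<sigma> \<in> G" "\<forall>x\<in>flag i. \<sigma> x = x" "\<sigma> (e (Suc i)) = e i"
          using move[OF subspace_flag] by blast
        have "\<sigma> \<circ> \<tau> \<in> G" using subgroup.m_closed[OF G \<sigma>(1) \<tau>(1)] by simp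
        then show ?thesis using \<sigma> \<tau> by (intro bexI[of _ "\<sigma> \<circ> \<tau>"]) auto
      qed
      then obtain \<tau> where \<tau>: "\<tau> \<in> G" "\<forall>x\<in>flag i. \<tau> x = x" "\<tau> ?w = e i" by blast
      have "\<tau> \<circ> h \<in> G" using subgroup.m_closed[OF G \<tau>(1) h(1)] by simp
      moreover have "(\<tau> \<circ> h) (g (e j)) = e j" if "j < Suc i" for j
        using that \<tau> h(2)[of j] e_in_flag[of j i] i by (cases "j = i") auto
      ultimately show ?case by blast
    qed
    then obtain h where h: "h \<in> G" "\<And>j. j < n - 1 \<Longrightarrow> h (g (e j)) = e j" by blast
    have hSL: "h \<in> carrier SL" using h(1) subgroup.subset[OF G] by blast
    have "h \<circ> g \<in> upper"
    proof (rule upperI)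
      fix i j assume "i < n" "j < i"
      then show "crd i ((h \<circ> g) (e j)) = 0" using h(2)[of j] by (simp add: crd_e)
    qed (use SL_comp[OF hSL g] in simp)
    then have "inv\<^bsub>SL\<^esub> h \<otimes>\<^bsub>SL\<^esub> (h \<circ> g) \<in> G"
      using up subgroup.m_closed[OF G subgroup.m_inv_closed[OF G h(1)]] by blast
    moreover have "inv\<^bsub>SL\<^esub> h \<otimes>\<^bsub>SL\<^esub> (h \<circ> g) = g"
      using SL_inv_left[OF hSL] by (simp add: fun_eq_iff)
    ultimately show "g \<in> G" by (simp only:)
  qed
qed

end

section \<open>Eigenvectors\<close>

context based_space
begin

text \<open>The value of the polynomial \<open>p\<close> at the operator \<open>A\<close>, in Horner form.\<close>

definition poly_op :: "('b \<Rightarrow> 'b) \<Rightarrow> 'a poly \<Rightarrow> 'b \<Rightarrow> 'b"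
  where "poly_op A p v = fold_coeffs (\<lambda>a w. a *s v + A w) p 0"

lemma poly_op_0 [simp]: "poly_op A 0 v = 0"
  by (simp add: poly_op_def)

context
  fixes A assumes A: "lin A"
begin

lemma poly_op_pCons [simp]: "poly_op A (pCons a p) v = a *s v + A (poly_op A p v)"
  by (cases "p = 0"; cases "a = 0") (simp_all add: poly_op_def lin_0[OF A])

lemma poly_op_1 [simp]: "poly_op A 1 v = v"
  using poly_op_pCons[of 1 0 v] by (simp add: lin_0[OF A] flip: one_pCons)

lemma poly_op_add: "poly_op A (p + q) v = poly_op A p v + poly_op A q v"
  by (induction p q rule: poly_induct2) (auto simp: lin_add[OF A] scale_left_distrib algebra_simps)

lemma poly_op_smult: "poly_op A (Polynomial.smult c p) v = c *s poly_op A p v"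
  by (induction p) (auto simp: lin_scale[OF A] scale_right_distrib)

lemma poly_op_mult: "poly_op A (p * q) v = poly_op A p (poly_op A q v)"
  by (induction p) (auto simp: poly_op_add poly_op_smult lin_0[OF A])

lemma poly_op_power: "poly_op A (p ^ m) v = (poly_op A p ^^ m) v"
  by (induction m) (auto simp: poly_op_mult)

lemma lin_poly_op: "lin (poly_op A p)"
proof (rule linI)
  show "poly_op A p (x + y) = poly_op A p x + poly_op A p y" for x y
    by (induction p) (auto simp: lin_add[OF A] scale_right_distrib algebra_simps)
  show "poly_op A p (c *s x) = c *s poly_op A p x" for c x
    by (induction p) (auto simp: lin_scale[OF A] scale_right_distrib mult.commute)
qed

lemma poly_op_sum: "poly_op A (\<Sum>i\<in>I. p i) v = (\<Sum>i\<in>I. poly_op A (p i) v)"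
  by (induction I rule: infinite_finite_induct) (auto simp: poly_op_add)

lemma poly_op_monom: "poly_op A (monom c i) v = c *s (A ^^ i) v"
  by (induction i) (auto simp: monom_0 monom_Suc lin_0[OF A] lin_scale[OF A])

lemma poly_op_in_subspace:
  assumes "subspace C" "\<And>w. w \<in> C \<Longrightarrow> A w \<in> C" "v \<in> C"
  shows "poly_op A p v \<in> C"
  by (induction p) (auto intro: subspace_0 subspace_add subspace_scale assms)

lemma poly_op_eigenvector: "A w = c *s w \<Longrightarrow> poly_op A p w = poly p c *s w"
  by (induction p) (auto simp: lin_scale[OF A] scale_left_distrib mult.commute)

text \<open>The \<open>n + 1\<close> vectors \<open>v, A v, \<dots>, A\<^sup>n v\<close> are linearly dependent.\<close>

lemma annihilating_poly: "\<exists>p. p \<noteq> 0 \<and> poly_op A p v = 0"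
proof (cases "inj_on (\<lambda>i. (A ^^ i) v) {..n}")
  case False
  then obtain i j where ij: "i \<noteq> j" "(A ^^ i) v = (A ^^ j) v" by (auto simp: inj_on_def)
  let ?p = "monom 1 i + monom (-1) j :: 'a poly"
  have "coeff ?p i = 1" using ij by simp
  then have "?p \<noteq> 0" by (metis coeff_0 zero_neq_one)
  moreover have "poly_op A ?p v = 0" using ij by (simp add: poly_op_add poly_op_monom)
  ultimately show ?thesis by blast
next
  case inj: True
  let ?S = "(\<lambda>i. (A ^^ i) v) ` {..n}"
  have "card ?S = Suc n" using card_image[OF inj] by simp
  then have "dim UNIV < card ?S" unfolding dim_eq_n by simp
  then have "dependent ?S" using independent_card_le_dim[of ?S UNIV] by (auto simp: not_less)
  then obtain u where u: "\<exists>w\<in>?S. u w \<noteq> 0" "(\<Sum>w\<in>?S. u w *s w) = 0"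
    using dependent_finite[of ?S] by auto
  let ?p = "\<Sum>i\<le>n. monom (u ((A ^^ i) v)) i"
  have "poly_op A ?p v = (\<Sum>w\<in>?S. u w *s w)"
    by (simp add: poly_op_sum poly_op_monom sum.reindex[OF inj])
  moreover obtain i where "i \<le> n" "u ((A ^^ i) v) \<noteq> 0" using u(1) by auto
  then have "coeff ?p i \<noteq> 0" by (simp add: coeff_sum)
  then have "?p \<noteq> 0" by (metis coeff_0)
  ultimately show ?thesis using u(2) by metis
qed

text \<open>
  The product of polynomials annihilating the basis vectors annihilates the whole space, so every
  eigenvalue is one of its roots.
\<close>

lemma finite_eigenvalues: "finite {c. \<exists>w. w \<noteq> 0 \<and> A w = c *s w}"
proof -
  have "\<forall>i. \<exists>p. p \<noteq> 0 \<and> poly_op A p (e i) = 0" using annihilating_poly by blast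
  from choice[OF this] obtain p where p: "\<And>i. p i \<noteq> 0" "\<And>i. poly_op A (p i) (e i) = 0" by blast
  let ?q = "\<Prod>i<n. p i"
  have 0: "poly_op A ?q (e i) = 0" if "i < n" for i
  proof -
    have "?q = (\<Prod>j\<in>{..<n} - {i}. p j) * p i"
      using that by (subst prod.remove[of _ i]) (auto simp: mult.commute)
    then show ?thesis using p(2)[of i] lin_0[OF lin_poly_op] by (simp only: poly_op_mult)
  qed
  have "poly_op A ?q v = 0" for v
    using lin_expand[OF lin_poly_op, of ?q v] 0 by simp
  then have "poly ?q c = 0" if "w \<noteq> 0" "A w = c *s w" for c w
    using poly_op_eigenvector[OF that(2), of ?q] that(1) by simp
  then have "{c. \<exists>w. w \<noteq> 0 \<and> A w = c *s w} \<subseteq> {c. poly ?q c = 0}" by blast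
  moreover have "?q \<noteq> 0" using p(1) by simp
  ultimately show ?thesis using poly_roots_finite finite_subset by blast
qed

end

end

locale closed_field_space = based_space scale e n
  for scale :: "'k::alg_closed_field \<Rightarrow> 'v::ab_group_add \<Rightarrow> 'v" (infixr "*s" 75)
    and e :: "nat \<Rightarrow> 'v" and n :: nat
begin

text \<open>Over a finite field, \<open>1 + \<Prod>(X - a)\<close> would have no root.\<close>

lemma infinite_field: "infinite (UNIV :: 'k set)"
proof
  assume fin: "finite (UNIV :: 'k set)"
  let ?p = "(\<Prod>a\<in>(UNIV :: 'k set). [:- a, 1:]) + 1"
  have "degree (\<Prod>a\<in>(UNIV :: 'k set). [:- a, 1:]) = card (UNIV :: 'k set)"
    by (subst degree_prod_eq_sum_degree) auto
  moreover have "card (UNIV :: 'k set) > 0" using fin by (simp add: card_gt_0_iff)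
  ultimately have "degree ?p > 0" by (subst degree_add_eq_left) auto
  then obtain x where "poly ?p x = 0" using alg_closed_imp_poly_has_root by blast
  moreover have "poly (\<Prod>a\<in>(UNIV :: 'k set). [:- a, 1:]) x = 0"
    using fin by (auto simp: poly_prod)
  ultimately show False by simp
qed

text \<open>
  Split linear factors \<open>X - c\<close> off a polynomial \<open>p\<close> with \<open>p(A) v = 0\<close> until the cofactor \<open>q\<close> satisfies
  \<open>q(A) v \<noteq> 0\<close>; this vector is an eigenvector for \<open>c\<close>.
\<close>

lemma eigenvector_exists:
  assumes A: "lin A" and C: "subspace C" "\<And>w. w \<in> C \<Longrightarrow> A w \<in> C" and v: "v \<in> C" "v \<noteq> 0"
  shows "\<exists>w c. w \<in> C \<and> w \<noteq> 0 \<and> A w = c *s w"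
proof -
  have "\<exists>w c. w \<in> C \<and> w \<noteq> 0 \<and> A w = c *s w"
    if "p \<noteq> 0" "v \<in> C" "v \<noteq> 0" "poly_op A p v = 0" for p v
    using that
  proof (induction "degree p" arbitrary: p v)
    case 0
    then obtain c where "p = [:c:]" "c \<noteq> 0" by (metis degree_eq_zeroE pCons_0_0)
    then show ?case using 0 by (simp add: poly_op_pCons[OF A] lin_0[OF A])
  next
    case (Suc m)
    then obtain c where "poly p c = 0" using alg_closed_imp_poly_has_root[of p] by auto
    then obtain q where q: "p = [:- c, 1:] * q" by (auto simp: poly_eq_0_iff_dvd dvd_def)
    then have "q \<noteq> 0" using Suc by auto
    then have dq: "m = degree q" using Suc(2) unfolding q by (subst (asm) degree_mult_eq) auto
    let ?w = "poly_op A q v"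
    have "(- c) *s ?w + A ?w = 0"
      using Suc(6) unfolding q poly_op_mult[OF A] by (simp add: poly_op_pCons[OF A] lin_0[OF A])
    then have eig: "A ?w = c *s ?w" by simp
    show ?case
    proof (cases "?w = 0")
      case True
      then show ?thesis using Suc.hyps(1)[OF dq \<open>q \<noteq> 0\<close>] Suc.prems by blast
    next
      case False
      then show ?thesis
        using eig poly_op_in_subspace[OF A C(1,2) Suc.prems(2), of q] by blast
    qed
  qed
  then show ?thesis using annihilating_poly[OF A] v by blast
qed

section \<open>The Lie--Kolchin theorem\<close>

text \<open>
  Let \<open>H\<close> be a connected subgroup of \<open>SL(V)\<close> and \<open>W\<close> an \<open>H\<close>-stable subspace. The quotient
  \<open>V/W\<close> is represented by the image of a projection \<open>\<pi>\<close> with kernel \<open>W\<close>, on which \<open>h \<in> H\<close> acts as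
  \<open>\<pi> \<circ> h\<close>, and \<open>Y\<close> is an irreducible subrepresentation.
\<close>

context
  fixes H :: "('v \<Rightarrow> 'v) set" and \<pi> :: "'v \<Rightarrow> 'v" and Y :: "'v set"
  assumes H: "subgroup H SL" and conn: "connectedin zariski H"
    and \<pi>: "lin \<pi>" and act: "\<And>g v. g \<in> H \<Longrightarrow> \<pi> (g (\<pi> v)) = \<pi> (g v)"
    and Y: "subspace Y" "Y \<noteq> {0}" and Y_id: "\<And>v. v \<in> Y \<Longrightarrow> \<pi> v = v"
    and Y_stable: "\<And>g v. g \<in> H \<Longrightarrow> v \<in> Y \<Longrightarrow> \<pi> (g v) \<in> Y"
    and Y_irr: "\<And>Z. subspace Z \<Longrightarrow> Z \<subseteq> Y \<Longrightarrow> (\<And>g v. g \<in> H \<Longrightarrow> v \<in> Z \<Longrightarrow> \<pi> (g v) \<in> Z)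
      \<Longrightarrow> Z = {0} \<or> Z = Y"
begin

definition cj :: "('v \<Rightarrow> 'v) \<Rightarrow> ('v \<Rightarrow> 'v) \<Rightarrow> 'v \<Rightarrow> 'v"
  where "cj h g = h \<otimes>\<^bsub>SL\<^esub> g \<otimes>\<^bsub>SL\<^esub> inv\<^bsub>SL\<^esub> h"

definition comm :: "('v \<Rightarrow> 'v) \<Rightarrow> ('v \<Rightarrow> 'v) \<Rightarrow> 'v \<Rightarrow> 'v"
  where "comm x y = x \<otimes>\<^bsub>SL\<^esub> y \<otimes>\<^bsub>SL\<^esub> inv\<^bsub>SL\<^esub> x \<otimes>\<^bsub>SL\<^esub> inv\<^bsub>SL\<^esub> y"

lemma HSL: "g \<in> H \<Longrightarrow> g \<in> carrier SL"
  using subgroup.subset[OF H] by blast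

lemma H_comp: "g \<in> H \<Longrightarrow> h \<in> H \<Longrightarrow> g \<circ> h \<in> H"
  using subgroup.m_closed[OF H] by simp

lemma H_inv: "g \<in> H \<Longrightarrow> inv\<^bsub>SL\<^esub> g \<in> H"
  using subgroup.m_inv_closed[OF H] .

lemma H_id: "id \<in> H"
  using subgroup.one_closed[OF H] by simp

lemma cj_H: "g \<in> H \<Longrightarrow> h \<in> H \<Longrightarrow> cj h g \<in> H"
  unfolding cj_def by (simp add: H_comp H_inv)

lemma cj_apply: "cj h g v = h (g ((inv\<^bsub>SL\<^esub> h) v))"
  by (simp add: cj_def)

lemma lin_\<pi>H: "g \<in> H \<Longrightarrow> lin (\<lambda>v. \<pi> (g v))"
  using lin_comp[OF \<pi> SL_lin[OF HSL]] by (simp add: comp_def)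

lemma inv_left: "h \<in> H \<Longrightarrow> \<pi> ((inv\<^bsub>SL\<^esub> h) (\<pi> (h v))) = \<pi> v"
  using act[OF H_inv] SL_inv_left[OF HSL] by simp

lemma inv_right: "h \<in> H \<Longrightarrow> \<pi> (h (\<pi> ((inv\<^bsub>SL\<^esub> h) v))) = \<pi> v"
  using act[of h "(inv\<^bsub>SL\<^esub> h) v"] SL_inv_right[OF HSL[of h], of v] by simp

lemma act_nonzero: "h \<in> H \<Longrightarrow> v \<in> Y \<Longrightarrow> v \<noteq> 0 \<Longrightarrow> \<pi> (h v) \<noteq> 0"
  using inv_left[of h v] Y_id[of v] lin_0[OF lin_\<pi>H[OF H_inv]] by metis

definition spec :: "('v \<Rightarrow> 'v) \<Rightarrow> 'k set"
  where "spec g = {c. \<exists>v\<in>Y. v \<noteq> 0 \<and> \<pi> (g v) = c *s v}"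

lemma finite_spec: "g \<in> H \<Longrightarrow> finite (spec g)"
  by (rule finite_subset[OF _ finite_eigenvalues[OF lin_\<pi>H]]) (auto simp: spec_def)

lemma spec_nonempty: "g \<in> H \<Longrightarrow> spec g \<noteq> {}"
proof -
  assume g: "g \<in> H"
  obtain v where "v \<in> Y" "v \<noteq> 0" using Y subspace_0 by blast
  from eigenvector_exists[OF lin_\<pi>H[OF g] Y(1) Y_stable[OF g] this]
  show ?thesis by (auto simp: spec_def)
qed

lemma spec_cj_subset:
  assumes "g \<in> H" "h \<in> H"
  shows "spec g \<subseteq> spec (cj h g)"
proof
  fix c assume "c \<in> spec g"
  then obtain v where v: "v \<in> Y" "v \<noteq> 0" "\<pi> (g v) = c *s v" by (auto simp: spec_def)
  have "\<pi> (cj h g (\<pi> (h v))) = \<pi> (h (\<pi> (g v)))"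
    using act[OF cj_H[OF assms], of "h v"] act[OF assms(2), of "g v"] SL_inv_left[OF HSL[OF assms(2)]]
    by (simp add: cj_apply)
  then have "\<pi> (cj h g (\<pi> (h v))) = c *s \<pi> (h v)"
    using v(3) lin_scale[OF lin_\<pi>H[OF assms(2)]] by simp
  then show "c \<in> spec (cj h g)"
    using Y_stable[OF assms(2) v(1)] act_nonzero[OF assms(2) v(1,2)] by (auto simp: spec_def)
qed

lemma cj_inv_cancel: "g \<in> H \<Longrightarrow> h \<in> H \<Longrightarrow> cj (inv\<^bsub>SL\<^esub> h) (cj h g) = g"
  using SL_inv_left[OF HSL] SLg.inv_inv[OF HSL] by (simp add: cj_apply fun_eq_iff)

lemma spec_cj: "g \<in> H \<Longrightarrow> h \<in> H \<Longrightarrow> spec (cj h g) = spec g"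
  using spec_cj_subset spec_cj_subset[OF cj_H H_inv] cj_inv_cancel by (metis subset_antisym)

text \<open>
  The form in which connectedness is used: the coordinates of \<open>\<pi> (m h v)\<close> are regular functions of \<open>h\<close>
  with finitely many values.
\<close>

lemma finitely_many_multiples_constant:
  assumes m: "SL_morphism m" and E: "finite E"
    and mult: "\<And>h. h \<in> H \<Longrightarrow> \<exists>c\<in>E. \<pi> (m h v) = c *s v"
    and h: "h \<in> H" "h' \<in> H"
  shows "\<pi> (m h v) = \<pi> (m h' v)"
proof (rule crd_eqI)
  fix i assume "i < n"
  have "(\<lambda>g. crd i (\<pi> (g v))) \<in> end_coords"
    by (rule end_coords_gen[OF fnl_comp[OF fnl_crd \<pi>]])
  from SL_morphism_pullback[OF m this] obtain a where
    a: "a \<in> end_coords" "\<And>h. h \<in> H \<Longrightarrow> crd i (\<pi> (m h v)) = a h" using HSL by blast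
  have "a ` H \<subseteq> (\<lambda>c. c * crd i v) ` E"
  proof
    fix x assume "x \<in> a ` H"
    then obtain h where h: "h \<in> H" "x = crd i (\<pi> (m h v))" using a(2) by auto
    from mult[OF h(1)] h(2) show "x \<in> (\<lambda>c. c * crd i v) ` E" by auto
  qed
  then have "finite (a ` H)" using E finite_subset by blast
  from regular_finite_image_constant[OF conn a(1) this h] show "crd i (\<pi> (m h v)) = crd i (\<pi> (m h' v))"
    using a(2) h by simp
qed

lemma SL_morphism_cj: "g \<in> H \<Longrightarrow> SL_morphism (\<lambda>h. cj h g)"
  unfolding cj_def
  by (intro SL_morphism_mult SL_morphism_inv SL_morphism_const SL_morphism_ident HSL)

lemma SL_morphism_comm_cj: "g \<in> H \<Longrightarrow> x \<in> H \<Longrightarrow> SL_morphism (\<lambda>h. comm x (cj h g))"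
  unfolding comm_def
  by (intro SL_morphism_mult SL_morphism_inv SL_morphism_const SL_morphism_cj HSL)

definition scalar_on :: "('v \<Rightarrow> 'v) \<Rightarrow> bool"
  where "scalar_on g \<longleftrightarrow> (\<exists>c. \<forall>v\<in>Y. \<pi> (g v) = c *s v)"

text \<open>
  If \<open>y\<close> is an eigenvector of all conjugates of \<open>g\<close>, then the eigenvalue, being in the finite
  spectrum of \<open>g\<close>, does not depend on the conjugate; so the whole orbit of \<open>y\<close>, which spans \<open>Y\<close>,
  lies in one eigenspace.
\<close>

lemma common_eigenvector_imp_scalar:
  assumes g: "g \<in> H" and y: "y \<in> Y" "y \<noteq> 0" and eig: "\<And>h. h \<in> H \<Longrightarrow> \<exists>c. \<pi> (cj h g y) = c *s y"
  shows "scalar_on g"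
proof -
  have spec: "\<exists>c\<in>spec g. \<pi> (cj h g y) = c *s y" if "h \<in> H" for h
  proof -
    obtain c where "\<pi> (cj h g y) = c *s y" using eig \<open>h \<in> H\<close> by blast
    then have "c \<in> spec (cj h g)" using y by (auto simp: spec_def)
    then show ?thesis using \<open>\<pi> (cj h g y) = c *s y\<close> spec_cj[OF g that] by blast
  qed
  obtain c where c: "\<pi> (cj id g y) = c *s y" using eig[OF H_id] by blast
  have const: "\<pi> (cj h g y) = c *s y" if "h \<in> H" for h
    using finitely_many_multiples_constant[OF SL_morphism_cj[OF g] finite_spec[OF g] spec that H_id] c
    by (rule trans)
  let ?Z = "{z \<in> Y. \<forall>h\<in>H. \<pi> (cj h g z) = c *s z}"
  have "subspace ?Z"
  proof (rule subspaceI)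
    show "0 \<in> ?Z" using subspace_0[OF Y(1)] lin_0[OF lin_\<pi>H[OF cj_H[OF g]]] by simp
    show "x + y \<in> ?Z" if "x \<in> ?Z" "y \<in> ?Z" for x y
      using that subspace_add[OF Y(1)] lin_add[OF lin_\<pi>H[OF cj_H[OF g]]] by (simp add: scale_right_distrib)
    show "a *s x \<in> ?Z" if "x \<in> ?Z" for a x
      using that subspace_scale[OF Y(1)] lin_scale[OF lin_\<pi>H[OF cj_H[OF g]]] by (simp add: mult.commute)
  qed
  moreover have "\<pi> (h' z) \<in> ?Z" if h': "h' \<in> H" and z: "z \<in> ?Z" for h' z
  proof -
    have "\<pi> (cj h g (\<pi> (h' z))) = c *s \<pi> (h' z)" if h: "h \<in> H" for h
    proof -
      let ?k = "inv\<^bsub>SL\<^esub> h' \<circ> h"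
      have k: "?k \<in> H" using H_comp[OF H_inv[OF h'] h] .
      have "inv\<^bsub>SL\<^esub> ?k = inv\<^bsub>SL\<^esub> h \<circ> h'"
        using SLg.inv_mult_group[of "inv\<^bsub>SL\<^esub> h'" h] HSL h h' H_inv by simp
      then have *: "cj h g (h' z) = h' (cj ?k g z)"
        using SL_inv_right[OF HSL[OF h']] by (simp add: cj_apply)
      have "\<pi> (cj h g (\<pi> (h' z))) = \<pi> (h' (cj ?k g z))"
        using act[OF cj_H[OF g h], of "h' z"] * by simp
      also have "\<dots> = \<pi> (h' (\<pi> (cj ?k g z)))" using act[OF h'] by simp
      also have "\<dots> = c *s \<pi> (h' z)" using z k lin_scale[OF lin_\<pi>H[OF h']] by simp
      finally show ?thesis .
    qed
    then show ?thesis using Y_stable[OF h'] z by simp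
  qed
  ultimately have "?Z = {0} \<or> ?Z = Y" by (intro Y_irr) auto
  moreover have "y \<in> ?Z" using y const by simp
  ultimately have "?Z = Y" using y(2) by blast
  then have "\<pi> (g v) = c *s v" if "v \<in> Y" for v
  proof -
    have "v \<in> ?Z" using that \<open>?Z = Y\<close> by (simp only:)
    then have "\<pi> (cj id g v) = c *s v" using H_id by blast
    then show ?thesis using SLg.inv_one by (simp add: cj_apply)
  qed
  then show ?thesis by (auto simp: scalar_on_def)
qed

text \<open>
  On a minimal \<open>A\<close>-stable subspace each element of \<open>A\<close> is a scalar, since its eigenspaces are
  \<open>A\<close>-stable.
\<close>

lemma commuting_common_eigenvector:
  assumes A: "A \<subseteq> H" and comm: "\<And>a b v. a \<in> A \<Longrightarrow> b \<in> A \<Longrightarrow> v \<in> Y \<Longrightarrow> \<pi> (a (\<pi> (b v))) = \<pi> (b (\<pi> (a v)))"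
  shows "\<exists>y\<in>Y. y \<noteq> 0 \<and> (\<forall>a\<in>A. \<exists>c. \<pi> (a y) = c *s y)"
proof -
  define P where "P Z \<longleftrightarrow> subspace Z \<and> Z \<subseteq> Y \<and> Z \<noteq> {0} \<and> (\<forall>a\<in>A. \<forall>v\<in>Z. \<pi> (a v) \<in> Z)" for Z
  have "P Y" using Y Y_stable A by (auto simp: P_def)
  then obtain Z where Z: "P Z" and min: "\<And>Z'. P Z' \<Longrightarrow> dim Z \<le> dim Z'"
    using ex_has_least_nat[of P Y dim] by blast
  have ZD: "subspace Z" "Z \<subseteq> Y" "Z \<noteq> {0}" "\<And>a v. a \<in> A \<Longrightarrow> v \<in> Z \<Longrightarrow> \<pi> (a v) \<in> Z"
    using Z by (auto simp: P_def)
  obtain z where z: "z \<in> Z" "z \<noteq> 0" using ZD subspace_0 by blast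
  have "\<exists>c. \<pi> (a z) = c *s z" if a: "a \<in> A" for a
  proof -
    have la: "lin (\<lambda>v. \<pi> (a v))" using a A lin_\<pi>H by blast
    obtain w c where w: "w \<in> Z" "w \<noteq> 0" "\<pi> (a w) = c *s w"
      using eigenvector_exists[OF la ZD(1) ZD(4)[OF a] z] by blast
    let ?Z = "{v \<in> Z. \<pi> (a v) = c *s v}"
    have "subspace ?Z"
      using subspace_0[OF ZD(1)] subspace_add[OF ZD(1)] subspace_scale[OF ZD(1)]
      by (intro subspaceI) (auto simp: lin_0[OF la] lin_add[OF la] lin_scale[OF la] scale_right_distrib mult.commute)
    moreover have "\<pi> (b v) \<in> ?Z" if b: "b \<in> A" and v: "v \<in> ?Z" for b v
    proof -
      have "\<pi> (a (\<pi> (b v))) = \<pi> (b (\<pi> (a v)))" using comm[OF a b] v ZD(2) by auto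
      also have "\<dots> = c *s \<pi> (b v)" using v lin_scale[OF lin_\<pi>H] A b by auto
      finally show ?thesis using v ZD(4)[OF b] by simp
    qed
    ultimately have "P ?Z" using w ZD(2) by (auto simp: P_def)
    then have "?Z = Z" using min \<open>subspace ?Z\<close> ZD(1) by (intro subspace_dim_equal) auto
    then have "z \<in> ?Z" using z(1) by (simp only:)
    then show ?thesis by blast
  qed
  then show ?thesis using z ZD(2) by blast
qed

lemma commuting_normal_imp_scalar:
  assumes A: "A \<subseteq> H" and normal: "\<And>h a. h \<in> H \<Longrightarrow> a \<in> A \<Longrightarrow> cj h a \<in> A"
    and comm: "\<And>a b v. a \<in> A \<Longrightarrow> b \<in> A \<Longrightarrow> v \<in> Y \<Longrightarrow> \<pi> (a (\<pi> (b v))) = \<pi> (b (\<pi> (a v)))"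
    and a: "a \<in> A"
  shows "scalar_on a"
proof -
  obtain y where "y \<in> Y" "y \<noteq> 0" "\<forall>a\<in>A. \<exists>c. \<pi> (a y) = c *s y"
    using commuting_common_eigenvector[of A, OF A] comm by blast
  then show ?thesis using normal a A by (intro common_eigenvector_imp_scalar) auto
qed

text \<open>
  The commutators of \<open>x\<close> with the conjugates of \<open>g\<close> are scalars \<open>c\<close> with \<open>c \<mu> = \<lambda>\<close> for
  eigenvalues \<open>\<lambda>, \<mu>\<close> of \<open>g\<close>; these are finitely many, hence all are equal by connectedness.
\<close>

lemma scalar_commutator_constant:
  assumes g: "g \<in> H" and x: "x \<in> H" and h: "h \<in> H"
    and sc: "\<And>h. h \<in> H \<Longrightarrow> scalar_on (comm x (cj h g))" and v: "v \<in> Y"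
  shows "\<pi> (comm x (cj h g) v) = \<pi> (comm x g v)"
proof -
  obtain l where l: "l \<in> spec g" using spec_nonempty[OF g] by blast
  have "\<exists>c\<in>(\<lambda>m. l / m) ` spec g. \<pi> (comm x (cj h g) v) = c *s v" if h: "h \<in> H" for h
  proof -
    obtain c where c: "\<And>v. v \<in> Y \<Longrightarrow> \<pi> (comm x (cj h g) v) = c *s v"
      using sc[OF h] by (auto simp: scalar_on_def)
    let ?y = "cj h g"
    have yH: "?y \<in> H" using cj_H[OF g h] .
    have "l \<in> spec (cj x ?y)" using l spec_cj[OF g h] spec_cj[OF yH x] by simp
    then obtain w where w: "w \<in> Y" "w \<noteq> 0" "\<pi> (cj x ?y w) = l *s w" by (auto simp: spec_def)
    have l0: "l \<noteq> 0" using act_nonzero[OF cj_H[OF yH x] w(1,2)] w(3) by auto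
    have cH: "comm x ?y \<in> H" unfolding comm_def using H_comp H_inv x yH by simp
    have "comm x ?y (?y w) = cj x ?y w"
      using SL_inv_left[OF HSL[OF yH]] by (simp add: comm_def cj_apply)
    then have "\<pi> (comm x ?y (\<pi> (?y w))) = l *s w" using act[OF cH] w(3) by simp
    then have *: "c *s \<pi> (?y w) = l *s w" using c[OF Y_stable[OF yH w(1)]] by simp
    then have c0: "c \<noteq> 0" using l0 w(2) by auto
    have "inverse c *s (c *s \<pi> (?y w)) = inverse c *s (l *s w)" using * by simp
    then have "\<pi> (?y w) = (l / c) *s w" using c0 by (simp add: divide_inverse mult.commute)
    then have "l / c \<in> spec g" using w spec_cj[OF g h] by (auto simp: spec_def)
    moreover have "c = l / (l / c)" using l0 c0 by simp
    ultimately show ?thesis using c[OF v] by blast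
  qed
  from finitely_many_multiples_constant[OF SL_morphism_comm_cj[OF g x] _ this h H_id]
  have "\<pi> (comm x (cj h g) v) = \<pi> (comm x (cj id g) v)" using finite_spec[OF g] by blast
  moreover have "cj id g = g" using SLg.inv_one by (simp add: cj_def)
  ultimately show ?thesis by simp
qed

text \<open>
  By the preceding lemma \<open>h g h\<inverse>\<close> and \<open>g\<close> have the same commutators with every \<open>x \<in> N\<close>, so
  \<open>h g h\<inverse> g\<inverse>\<close> is central in \<open>N\<close> as far as the action on \<open>Y\<close> is concerned. The centre is a commuting
  normal subset, hence acts by scalars. So every eigenvector of \<open>g\<close> is an eigenvector of all
  conjugates of \<open>g\<close>.
\<close>

lemma scalar_commutators_imp_scalar:
  assumes N: "subgroup N SL" "N \<subseteq> H" and normal: "\<And>h a. h \<in> H \<Longrightarrow> a \<in> N \<Longrightarrow> cj h a \<in> N"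
    and sc: "\<And>x y. x \<in> N \<Longrightarrow> y \<in> N \<Longrightarrow> scalar_on (comm x y)"
    and g: "g \<in> N"
  shows "scalar_on g"
proof -
  let ?Z = "{z \<in> N. \<forall>x\<in>N. \<forall>v\<in>Y. \<pi> (x (\<pi> (z v))) = \<pi> (z (\<pi> (x v)))}"
  have NH: "a \<in> N \<Longrightarrow> a \<in> H" for a using N(2) by blast
  have Zsc: "scalar_on z" if "z \<in> ?Z" for z
  proof (rule commuting_normal_imp_scalar[OF _ _ _ that])
    show "?Z \<subseteq> H" using N(2) by blast
    show "\<pi> (a (\<pi> (b v))) = \<pi> (b (\<pi> (a v)))" if "a \<in> ?Z" "b \<in> ?Z" "v \<in> Y" for a b v
      using that by blast
    show "cj h a \<in> ?Z" if h: "h \<in> H" and a: "a \<in> ?Z" for h a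
    proof -
      have aN: "a \<in> N" using a by blast
      have "\<pi> (x (\<pi> (cj h a v))) = \<pi> (cj h a (\<pi> (x v)))" if x: "x \<in> N" and v: "v \<in> Y" for x v
      proof -
        let ?i = "inv\<^bsub>SL\<^esub> h"
        let ?x = "cj ?i x" and ?v = "\<pi> (?i v)"
        have xN: "?x \<in> N" using normal[OF H_inv[OF h] x] .
        have hh: "inv\<^bsub>SL\<^esub> ?i = h" using SLg.inv_inv[OF HSL[OF h]] .
        have 1: "x (cj h a v) = h (?x (a (?i v)))"
          using SL_inv_right[OF HSL[OF h]] SL_inv_left[OF HSL[OF h]] by (simp add: cj_apply hh)
        have 2: "cj h a (x v) = h (a (?x (?i v)))"
          using SL_inv_right[OF HSL[OF h]] SL_inv_left[OF HSL[OF h]] by (simp add: cj_apply hh)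
        have "\<pi> (x (\<pi> (cj h a v))) = \<pi> (h (\<pi> (?x (\<pi> (a ?v)))))"
          using act[OF NH[OF x]] act[OF h] act[OF NH[OF xN]] act[OF NH[OF aN]] 1 by simp
        also have "\<pi> (?x (\<pi> (a ?v))) = \<pi> (a (\<pi> (?x ?v)))"
          using a xN Y_stable[OF H_inv[OF h] v] by blast
        also have "\<pi> (h (\<pi> (a (\<pi> (?x ?v))))) = \<pi> (cj h a (\<pi> (x v)))"
          using act[OF cj_H[OF NH[OF aN] h]] act[OF h] act[OF NH[OF xN]] act[OF NH[OF aN]] 2 by simp
        finally show ?thesis .
      qed
      then show ?thesis using normal[OF h aN] by simp
    qed
  qed
  have gH: "g \<in> H" using NH[OF g] .
  let ?gi = "inv\<^bsub>SL\<^esub> g"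
  have giN: "?gi \<in> N" using subgroup.m_inv_closed[OF N(1) g] .
  have eig_cj: "\<exists>c. \<pi> (cj h g v) = c *s v" if h: "h \<in> H" and v: "v \<in> Y" and eig: "\<pi> (g v) = m *s v" for h v m
  proof -
    let ?y = "cj h g" and ?z = "cj h g \<circ> ?gi"
    have yN: "?y \<in> N" using normal[OF h g] .
    have zN: "?z \<in> N" using subgroup.m_closed[OF N(1) yN giN] by simp
    have "\<pi> (x (\<pi> (?z v))) = \<pi> (?z (\<pi> (x v)))" if x: "x \<in> N" and v: "v \<in> Y" for x v
    proof -
      have xH: "x \<in> H" using NH[OF x] .
      obtain c where c: "\<And>v. v \<in> Y \<Longrightarrow> \<pi> (comm x g v) = c *s v"
        using sc[OF x g] by (auto simp: scalar_on_def)
      have cy: "\<pi> (comm x ?y v) = c *s v" if "v \<in> Y" for v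
        using scalar_commutator_constant[OF gH xH h _ that] c[OF that] sc[OF x normal[OF _ g]] by simp
      have cH: "comm x a \<in> H" if "a \<in> H" for a unfolding comm_def using H_comp H_inv xH that by simp
      have swap: "x (a w) = comm x a (a (x w))" if "a \<in> H" for a w
        using SL_inv_left[OF HSL[OF that]] SL_inv_left[OF HSL[OF xH]] by (simp add: comm_def)
      have sw: "\<pi> (x (\<pi> (a w))) = c *s \<pi> (a (\<pi> (x w)))"
        if a: "a \<in> H" and w: "w \<in> Y" and c: "\<And>v. v \<in> Y \<Longrightarrow> \<pi> (comm x a v) = c *s v" for a w
      proof -
        have "\<pi> (x (\<pi> (a w))) = \<pi> (comm x a (\<pi> (a (\<pi> (x w)))))"
          using act[OF xH] act[OF a] act[OF cH[OF a]] swap[OF a] by simp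
        then show ?thesis using c[OF Y_stable[OF a Y_stable[OF xH w]]] by simp
      qed
      let ?w = "\<pi> (?gi v)"
      have w: "?w \<in> Y" using Y_stable[OF H_inv[OF gH] v] .
      have "\<pi> (x v) = \<pi> (x (\<pi> (g ?w)))" using inv_right[OF gH] Y_id[OF v] by simp
      also have "\<dots> = c *s \<pi> (g (\<pi> (x ?w)))" using sw[OF gH w c] .
      finally have "\<pi> (?gi (\<pi> (x v))) = c *s \<pi> (x ?w)"
        using lin_scale[OF lin_\<pi>H[OF H_inv[OF gH]]] inv_left[OF gH] Y_id[OF Y_stable[OF xH w]] by simp
      then have "\<pi> (?y (\<pi> (?gi (\<pi> (x v))))) = c *s \<pi> (?y (\<pi> (x ?w)))"
        using lin_scale[OF lin_\<pi>H[OF NH[OF yN]]] by simp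
      also have "\<dots> = \<pi> (x (\<pi> (?y ?w)))" using sw[OF NH[OF yN] w cy] by simp
      finally show ?thesis using act[OF NH[OF yN]] act[OF NH[OF zN]] by simp
    qed
    then have "?z \<in> ?Z" using zN by blast
    then have "scalar_on ?z" by (rule Zsc)
    then obtain s where s: "\<And>v. v \<in> Y \<Longrightarrow> \<pi> (?z v) = s *s v" unfolding scalar_on_def by blast
    have "\<pi> (?y v) = \<pi> (?z (\<pi> (g v)))"
      using act[OF NH[OF zN], of "g v"] SL_inv_left[OF HSL[OF gH]] by simp
    also have "\<dots> = s *s \<pi> (g v)" by (rule s[OF Y_stable[OF gH v]])
    finally show ?thesis using eig by auto
  qed
  obtain m where "m \<in> spec g" using spec_nonempty[OF gH] by blast
  then obtain y where "y \<in> Y" "y \<noteq> 0" "\<pi> (g y) = m *s y" by (auto simp: spec_def)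
  then show ?thesis using common_eigenvector_imp_scalar[OF gH] eig_cj by blast
qed

lemma derived_series_normal: "(derived SL ^^ i) H \<lhd> subgrp H"
proof (induction i)
  case 0
  show ?case using group.normal_self[OF SLg.subgroup_imp_group[OF H]] by simp
next
  case (Suc i)
  from group.derived_is_normal[OF SLg.subgroup_imp_group[OF H] Suc]
  show ?case using SLg.derived_consistent[OF derived_SL_subset[OF H] H] by simp
qed

text \<open>Descend the derived series from its trivial last term up to \<open>H\<close> itself.\<close>

lemma irreducible_solvable_scalar:
  assumes "(derived SL ^^ k) H = {id}" "g \<in> H"
  shows "\<exists>c. \<forall>v\<in>Y. \<pi> (g v) = c *s v"
proof -
  have "\<forall>g\<in>(derived SL ^^ (k - i)) H. scalar_on g" if "i \<le> k" for i
    using that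
  proof (induction i)
    case 0
    show ?case using assms(1) Y_id by (auto simp: scalar_on_def intro!: exI[of _ 1])
  next
    case (Suc i)
    define N where "N = (derived SL ^^ (k - Suc i)) H"
    have N: "subgroup N SL" "N \<subseteq> H"
      using SLg.exp_of_derived_is_subgroup[OF H] derived_SL_subset[OF H] by (auto simp: N_def)
    have eq: "(derived SL ^^ (k - i)) H = derived SL N"
    proof -
      have "k - i = Suc (k - Suc i)" using Suc.prems by simp
      then show ?thesis by (simp add: N_def)
    qed
    have "comm x y \<in> derived SL N" if "x \<in> N" "y \<in> N" for x y
      unfolding derived_def comm_def using that by (intro generate.incl) blast
    then have sc: "scalar_on (comm x y)" if "x \<in> N" "y \<in> N" for x y
      using that Suc eq by auto
    have normal: "cj h a \<in> N" if "h \<in> H" "a \<in> N" for h a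
    proof -
      have "h \<otimes>\<^bsub>subgrp H\<^esub> a \<otimes>\<^bsub>subgrp H\<^esub> inv\<^bsub>subgrp H\<^esub> h \<in> N"
        using normal.inv_op_closed2[OF derived_series_normal[of "k - Suc i"], of h a] that
        by (simp add: N_def)
      then show ?thesis using SLg.m_inv_consistent[OF H that(1)] by (simp add: cj_def)
    qed
    have "scalar_on g" if "g \<in> N" for g
      by (rule scalar_commutators_imp_scalar[OF N normal sc that])
    then show ?case by (simp add: N_def)
  qed
  from this[of k] show ?thesis using assms(2) by (simp add: scalar_on_def)
qed

end

lemma quotient_projection:
  assumes W: "subspace W"
  shows "\<exists>\<pi>. lin \<pi> \<and> (\<forall>v\<in>W. \<pi> v = 0) \<and> (\<forall>v. \<pi> v - v \<in> W)"
proof -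
  interpret vp: vector_space_pair scale scale by unfold_locales
  obtain B where B: "B \<subseteq> W" "independent B" "W \<subseteq> span B" by (rule basis_exists[of W])
  obtain C where C: "B \<subseteq> C" "independent C" "UNIV \<subseteq> span C"
    by (rule maximal_independent_subset_extend[of B UNIV]) (use B in auto)
  have "\<exists>\<pi>. lin \<pi> \<and> (\<forall>b\<in>C. \<pi> b = (if b \<in> B then 0 else b))"
    by (rule vp.linear_independent_extend[OF C(2)])
  then obtain \<pi> where \<pi>: "lin \<pi>" "\<And>b. b \<in> C \<Longrightarrow> \<pi> b = (if b \<in> B then 0 else b)" by blast
  have "subspace {v. \<pi> v = 0}"
    by (rule subspaceI) (auto simp: lin_0[OF \<pi>(1)] lin_add[OF \<pi>(1)] lin_scale[OF \<pi>(1)])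
  moreover have "B \<subseteq> {v. \<pi> v = 0}" using \<pi>(2) C(1) by auto
  ultimately have 1: "span B \<subseteq> {v. \<pi> v = 0}" by (intro span_minimal)
  have eq: "\<pi> (x + y) - (x + y) = (\<pi> x - x) + (\<pi> y - y)" "\<pi> (c *s x) - c *s x = c *s (\<pi> x - x)" for x y c
    by (simp_all add: lin_add[OF \<pi>(1)] lin_scale[OF \<pi>(1)] scale_right_diff_distrib)
  have "subspace {v. \<pi> v - v \<in> W}"
    by (rule subspaceI)
      (auto simp: eq lin_0[OF \<pi>(1)] intro: subspace_0[OF W] subspace_add[OF W] subspace_scale[OF W])
  moreover have "C \<subseteq> {v. \<pi> v - v \<in> W}"
  proof
    fix b assume "b \<in> C"
    then have "\<pi> b - b = (if b \<in> B then - b else 0)" using \<pi>(2) by simp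
    also have "\<dots> \<in> W" using B(1) subspace_0[OF W] subspace_neg[OF W] by (simp add: subset_iff)
    finally show "b \<in> {v. \<pi> v - v \<in> W}" by simp
  qed
  ultimately have 2: "span C \<subseteq> {v. \<pi> v - v \<in> W}" by (intro span_minimal)
  show ?thesis
  proof (intro exI[of _ \<pi>] conjI ballI allI \<pi>(1))
    show "\<pi> v = 0" if "v \<in> W" for v using that B(3) 1 by blast
    show "\<pi> v - v \<in> W" for v using C(3) 2 by blast
  qed
qed

text \<open>
  In a minimal stable subspace of the complement representing \<open>V/W\<close> all of \<open>H\<close> acts by scalars, so
  each non-zero vector there is a common eigenvector modulo \<open>W\<close>.
\<close>

lemma Lie_Kolchin_step:
  assumes H: "subgroup H SL" "connectedin zariski H" "solvable (subgrp H)"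
    and W: "subspace W" "W \<noteq> UNIV" and stable: "\<And>h v. h \<in> H \<Longrightarrow> v \<in> W \<Longrightarrow> h v \<in> W"
  shows "\<exists>v. v \<notin> W \<and> (\<forall>h\<in>H. \<exists>c. h v - c *s v \<in> W)"
proof -
  obtain \<pi> where \<pi>: "lin \<pi>" "\<And>v. v \<in> W \<Longrightarrow> \<pi> v = 0" "\<And>v. \<pi> v - v \<in> W"
    using quotient_projection[OF W(1)] by blast
  have HSL: "h \<in> H \<Longrightarrow> h \<in> carrier SL" for h using subgroup.subset[OF H(1)] by blast
  have act: "\<pi> (h (\<pi> v)) = \<pi> (h v)" if "h \<in> H" for h v
  proof -
    have "\<pi> (h (\<pi> v - v)) = 0" using \<pi>(2) stable[OF that \<pi>(3)] .
    then show ?thesis by (simp add: lin_diff[OF SL_lin[OF HSL[OF that]]] lin_diff[OF \<pi>(1)])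
  qed
  define P where "P Z \<longleftrightarrow> subspace Z \<and> Z \<subseteq> {v. \<pi> v = v} \<and> Z \<noteq> {0} \<and> (\<forall>h\<in>H. \<forall>v\<in>Z. \<pi> (h v) \<in> Z)" for Z
  have \<pi>\<pi>: "\<pi> (\<pi> v) = \<pi> v" for v
    using \<pi>(2)[OF \<pi>(3)[of v]] by (simp add: lin_diff[OF \<pi>(1)])
  have "P {v. \<pi> v = v}"
  proof -
    have "subspace {v. \<pi> v = v}"
      by (rule subspaceI) (auto simp: lin_0[OF \<pi>(1)] lin_add[OF \<pi>(1)] lin_scale[OF \<pi>(1)])
    moreover obtain w where "w \<notin> W" using W(2) by blast
    then have "\<pi> w \<noteq> 0" using \<pi>(3)[of w] subspace_neg[OF W(1), of "- w"] by auto
    then have "{v. \<pi> v = v} \<noteq> {0}" using \<pi>\<pi> by blast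
    ultimately show ?thesis by (auto simp: P_def \<pi>\<pi>)
  qed
  then obtain Y where Y: "P Y" and min: "\<And>Z'. P Z' \<Longrightarrow> dim Y \<le> dim Z'"
    using ex_has_least_nat[of P "{v. \<pi> v = v}" dim] by blast
  have YD: "subspace Y" "Y \<noteq> {0}" "\<And>v. v \<in> Y \<Longrightarrow> \<pi> v = v" "\<And>h v. h \<in> H \<Longrightarrow> v \<in> Y \<Longrightarrow> \<pi> (h v) \<in> Y"
    using Y by (auto simp: P_def)
  have irr: "Z = {0} \<or> Z = Y"
    if "subspace Z" "Z \<subseteq> Y" "\<And>h v. h \<in> H \<Longrightarrow> v \<in> Z \<Longrightarrow> \<pi> (h v) \<in> Z" for Z
  proof (rule disjCI)
    assume "Z \<noteq> Y"
    show "Z = {0}"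
    proof (rule ccontr)
      assume "Z \<noteq> {0}"
      then have "P Z" using that YD(3) by (auto simp: P_def)
      then have "Z = Y" using min that(1,2) YD(1) by (intro subspace_dim_equal) auto
      with \<open>Z \<noteq> Y\<close> show False by blast
    qed
  qed
  obtain k where k: "(derived SL ^^ k) H = {id}" using H(1,3) solvable_subgrp_iff by blast
  obtain y where y: "y \<in> Y" "y \<noteq> 0" using YD(1,2) subspace_0 by blast
  have "\<exists>c. h y - c *s y \<in> W" if h: "h \<in> H" for h
  proof -
    have "\<exists>c. \<forall>v\<in>Y. \<pi> (h v) = c *s v"
      by (rule irreducible_solvable_scalar[where k = k]) (fact H \<pi>(1) act YD irr k h)+
    then obtain c where "\<pi> (h y) = c *s y" using y by blast
    then have "c *s y - h y \<in> W" using \<pi>(3)[of "h y"] by simp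
    from subspace_neg[OF W(1) this] show ?thesis by (auto intro: exI[of _ c])
  qed
  moreover have "y \<notin> W" using \<pi>(2)[of y] YD(3)[OF y(1)] y(2) by auto
  ultimately show ?thesis by blast
qed

end

section \<open>Borel and parabolic subgroups\<close>

context based_space
begin

lemma triangular_independent:
  fixes f :: "nat \<Rightarrow> 'b"
  assumes "\<And>j. j < m \<Longrightarrow> f j \<notin> span (f ` {..<j})"
  shows "independent (f ` {..<m}) \<and> inj_on f {..<m}"
  using assms
proof (induction m)
  case (Suc m)
  then have IH: "independent (f ` {..<m})" "inj_on f {..<m}" and m: "f m \<notin> span (f ` {..<m})"
    by auto
  have "f m \<notin> f ` {..<m}" by (rule contra_subsetD[OF span_superset m])
  moreover have "{..<Suc m} = insert m {..<m}" by auto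
  ultimately show ?case using IH independent_insertI[OF m IH(1)] by simp
qed (simp add: independent_empty)

lemma based_spaceI_independent:
  assumes "independent (f ` {..<n})" "inj_on f {..<n}"
  shows "based_space scale f n"
proof
  have "card (f ` {..<n}) = n" using card_image[OF assms(2)] by simp
  then have "UNIV \<subseteq> span (f ` {..<n})"
    using assms(1) dim_eq_n by (intro card_ge_dim_independent) auto
  then show "span (f ` {..<n}) = UNIV" by blast
qed (use assms in auto)

end

context closed_field_space
begin

text \<open>The flag is built from below, by adding a common eigenvector modulo the part already built.\<close>

lemma solvable_stable_flag:
  assumes H: "subgroup H SL" "connectedin zariski H" "solvable (subgrp H)" and i: "i \<le> n"
  shows "\<exists>f. (\<forall>j<i. f j \<notin> span (f ` {..<j})) \<and>
    (\<forall>j\<le>i. \<forall>h\<in>H. \<forall>v\<in>span (f ` {..<j}). h v \<in> span (f ` {..<j}))"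
  using i
proof (induction i)
  case 0
  have "h 0 = 0" if "h \<in> H" for h
    using that subgroup.subset[OF H(1)] SL_lin lin_0 by blast
  then show ?case by simp
next
  case (Suc i)
  then obtain f where f: "\<forall>j<i. f j \<notin> span (f ` {..<j})"
    and st: "\<forall>j\<le>i. \<forall>h\<in>H. \<forall>v\<in>span (f ` {..<j}). h v \<in> span (f ` {..<j})" by auto
  let ?W = "span (f ` {..<i})"
  have "dim ?W \<le> card (f ` {..<i})" by (intro dim_le_card) (auto intro: span_base)
  also have "\<dots> \<le> i" using card_image_le[of "{..<i}" f] by simp
  finally have "dim ?W < n" using Suc.prems by simp
  then have "?W \<noteq> UNIV" using dim_eq_n by (metis less_irrefl)
  from Lie_Kolchin_step[OF H subspace_span this] st
  obtain v where v: "v \<notin> ?W" "\<And>h. h \<in> H \<Longrightarrow> \<exists>c. h v - c *s v \<in> ?W" by blast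
  let ?f = "f(i := v)"
  have img: "?f ` {..<j} = f ` {..<j}" if "j \<le> i" for j using that by auto
  have "?f j \<notin> span (?f ` {..<j})" if "j < Suc i" for j
    using that f v(1) img[of j] by (cases "j = i") auto
  moreover have "h x \<in> span (?f ` {..<j})"
    if j: "j \<le> Suc i" and h: "h \<in> H" and x: "x \<in> span (?f ` {..<j})" for j h x
  proof (cases "j \<le> i")
    case True
    then show ?thesis using st h x by (simp only: img[OF True])
  next
    case False
    then have "j = Suc i" using j by simp
    then have ins: "?f ` {..<j} = insert v (f ` {..<i})" by (auto simp: lessThan_Suc)
    have hl: "lin h" using h subgroup.subset[OF H(1)] SL_lin by blast
    obtain k where k: "x - k *s v \<in> ?W" using x unfolding ins span_breakdown_eq by blast
    obtain c where c: "h v - c *s v \<in> ?W" using v(2)[OF h] by blast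
    have "h (x - k *s v) \<in> ?W" using st h k by blast
    then have "h (x - k *s v) + k *s (h v - c *s v) \<in> ?W" using c by (intro span_add span_scale)
    then have "h x - (k * c) *s v \<in> ?W"
      by (simp add: lin_diff[OF hl] lin_scale[OF hl] scale_right_diff_distrib)
    then show ?thesis unfolding ins span_breakdown_eq by blast
  qed
  ultimately show ?case by (intro exI[of _ ?f]) blast
qed

theorem Lie_Kolchin:
  assumes H: "subgroup H SL" "connectedin zariski H" "solvable (subgrp H)"
  shows "\<exists>f. closed_field_space scale f n \<and> H \<subseteq> based_space.upper scale f n"
proof -
  obtain f where f: "\<And>j. j < n \<Longrightarrow> f j \<notin> span (f ` {..<j})"
    and st: "\<And>j h v. j \<le> n \<Longrightarrow> h \<in> H \<Longrightarrow> v \<in> span (f ` {..<j}) \<Longrightarrow> h v \<in> span (f ` {..<j})"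
    using solvable_stable_flag[OF H, of n] by blast
  have "based_space scale f n"
    using triangular_independent[of n f] f by (intro based_spaceI_independent) auto
  then interpret F: closed_field_space scale f n by (simp add: closed_field_space_def)
  have "h ` F.flag i \<subseteq> F.flag i" if "h \<in> H" for h i
    unfolding F.flag_span using st[OF _ that, of "min i n"] by auto
  then have "H \<subseteq> F.upper"
    using subgroup.subset[OF H(1)] by (auto simp: F.upper_def F.stab_def)
  then show ?thesis using F.closed_field_space_axioms by blast
qed

lemma conn_solvable_upper: "0 < n \<Longrightarrow> conn_solvable_subgroup upper"
  using closed_subgroup_upper connectedin_upper[OF infinite_field] solvable_upper
  by (simp add: conn_solvable_subgroup_def)

text \<open>A Borel subgroup lies in a flag stabiliser, and by maximality it cannot be smaller.\<close>

lemma borel_subgroup_flag: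
  assumes B: "borel_subgroup B" and n: "0 < n"
  shows "\<exists>f. closed_field_space scale f n \<and> B = based_space.upper scale f n"
proof -
  have "conn_solvable_subgroup B" using B by (simp add: borel_subgroup_def)
  then obtain f where f: "closed_field_space scale f n" "B \<subseteq> based_space.upper scale f n"
    using Lie_Kolchin by (auto simp: conn_solvable_subgroup_def closed_subgroup_def)
  interpret F: closed_field_space scale f n by (rule f(1))
  have "F.upper = B"
    using B F.conn_solvable_upper[OF n] f(2) by (auto simp: borel_subgroup_def)
  then show ?thesis using f(1) by blast
qed

text \<open>
  Any larger connected solvable subgroup fixes a complete flag, which is then also stable under
  \<open>upper\<close> and hence equal to the given one.
\<close>

lemma borel_subgroup_upper:
  assumes n: "0 < n"
  shows "borel_subgroup upper"
  unfolding borel_subgroup_def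
proof (intro conjI allI impI conn_solvable_upper[OF n])
  fix H assume H: "conn_solvable_subgroup H" and sub: "upper \<subseteq> H"
  obtain f where f: "closed_field_space scale f n" "H \<subseteq> based_space.upper scale f n"
    using Lie_Kolchin H by (auto simp: conn_solvable_subgroup_def closed_subgroup_def)
  interpret F: closed_field_space scale f n by (rule f(1))
  have "F.flag i = flag i" for i
  proof (cases "i \<le> n")
    case True
    have "\<exists>j\<le>n. F.flag i = flag j"
    proof (rule upper_stable_subspace[OF F.subspace_flag])
      fix g assume "g \<in> upper"
      then have "g \<in> F.upper" using sub f(2) by blast
      then show "g ` F.flag i \<subseteq> F.flag i" using F.upper_flag by blast
    qed
    then obtain j where j: "j \<le> n" "F.flag i = flag j" by blast
    then have "i = j" using F.dim_flag[OF True] dim_flag[OF j(1)] by simp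
    then show ?thesis using j by simp
  qed (simp add: flag_full F.flag_full)
  then have "F.upper = upper" by (simp add: upper_def F.upper_def stab_def F.stab_def)
  then show "H = upper" using sub f(2) by blast
qed

lemma parabolic_reducible:
  assumes P: "parabolic_subgroup P" "P \<noteq> carrier SL" and n: "0 < n"
  shows "\<exists>Y. subspace Y \<and> Y \<noteq> {0} \<and> Y \<noteq> UNIV \<and> (\<forall>g\<in>P. g ` Y \<subseteq> Y)"
proof -
  obtain B where B: "borel_subgroup B" "B \<subseteq> P" and PG: "subgroup P SL"
    using P(1) by (auto simp: parabolic_subgroup_def closed_subgroup_def)
  obtain f where f: "closed_field_space scale f n" "B = based_space.upper scale f n"
    using borel_subgroup_flag[OF B(1) n] by blast
  interpret F: closed_field_space scale f n by (rule f(1))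
  show ?thesis
  proof (rule ccontr)
    assume irr: "\<not> ?thesis"
    have "P = carrier SL"
    proof (rule F.irreducible_overgroup_eq_SL[OF PG _ n])
      show "F.upper \<subseteq> P" using B(2) f(2) by simp
      show "Y = {0} \<or> Y = UNIV" if "subspace Y" "\<And>g. g \<in> P \<Longrightarrow> g ` Y \<subseteq> Y" for Y
      proof (rule ccontr)
        assume "\<not> (Y = {0} \<or> Y = UNIV)"
        then have "subspace Y \<and> Y \<noteq> {0} \<and> Y \<noteq> UNIV \<and> (\<forall>g\<in>P. g ` Y \<subseteq> Y)"
          using that by simp
        then show False by (rule notE[OF irr exI])
      qed
    qed
    with P(2) show False by contradiction
  qed
qed

lemma stab_flag_parabolic:
  assumes "0 < n"
  shows "parabolic_subgroup (stab (flag i))"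
  using stab_closed_subgroup[OF subspace_flag] borel_subgroup_upper[OF assms]
  by (auto simp: parabolic_subgroup_def upper_def)

text \<open>A transvection that moves \<open>e 0\<close> out of \<open>flag i\<close>.\<close>

lemma stab_flag_proper:
  assumes i: "0 < i" "i < n"
  shows "stab (flag i) \<noteq> carrier SL"
proof
  assume eq: "stab (flag i) = carrier SL"
  define f where "f j = e (n - 1 - j)" for j
  have inj: "inj_on f {..<n}"
  proof (rule inj_onI)
    fix x y assume xy: "x \<in> {..<n}" "y \<in> {..<n}" "f x = f y"
    then have "n - 1 - x = n - 1 - y" unfolding f_def by (intro inj_onD[OF inj_e]) auto
    then show "x = y" using xy by auto
  qed
  have "f ` {..<n} = e ` {..<n}"
  proof
    show "e ` {..<n} \<subseteq> f ` {..<n}"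
    proof
      fix x assume "x \<in> e ` {..<n}"
      then obtain j where "j < n" "x = e j" by auto
      then show "x \<in> f ` {..<n}" by (intro image_eqI[of _ _ "n - 1 - j"]) (auto simp: f_def)
    qed
  qed (auto simp: f_def)
  then interpret F: based_space scale f n
    using inj indep_e by (intro based_spaceI_independent) auto
  \<comment> \<open>lower triangular for \<open>e\<close>, upper triangular for the reversed basis \<open>f\<close>\<close>
  let ?t = "\<lambda>v. v + crd 0 v *s f (n - 1 - i)"
  have "?t \<in> F.upper"
    using i by (intro F.transvection_upper fnl_crd) (auto simp: f_def crd_e)
  then have "?t \<in> stab (flag i)" using F.upper_SL eq by blast
  moreover have "e 0 \<in> flag i" using i e_in_flag[of 0 i] by simp
  ultimately have "?t (e 0) \<in> flag i" by (rule stabD)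
  then have "crd i (?t (e 0)) = 0" using i by (simp add: flag_def)
  then show False using i by (simp add: crd_e f_def)
qed

end

section \<open>The torus and its weight spaces\<close>

text \<open>
  The basis vectors are grouped by the residue of their index modulo \<open>q\<close>; the torus acts on the
  \<open>i\<close>-th group by \<open>t i\<close>, with \<open>t 0 * \<dots> * t (q - 1) = 1\<close>.
\<close>

locale torus_space = closed_field_space scale e n
  for scale :: "'k::alg_closed_field \<Rightarrow> 'v::ab_group_add \<Rightarrow> 'v" (infixr "*s" 75)
    and e :: "nat \<Rightarrow> 'v" and n :: nat +
  fixes q d :: nat
  assumes n_eq: "n = q * d" and q2: "2 \<le> q" and d1: "1 \<le> d"
begin

lemma n_pos: "0 < n"
  using n_eq q2 d1 by simp

lemma q_le_n: "q \<le> n"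
  using n_eq d1 by simp

lemma mod_lt_q [simp]: "m mod q < q"
  using q2 by simp

lemma mod_lt_n [simp]: "m mod q < n"
  using q_le_n mod_lt_q less_le_trans by blast

definition diag :: "(nat \<Rightarrow> 'k) \<Rightarrow> 'v \<Rightarrow> 'v"
  where "diag t = ext (\<lambda>m. t (m mod q) *s e m)"

lemma lin_diag: "lin (diag t)"
  by (simp add: diag_def lin_ext)

lemma diag_e: "m < n \<Longrightarrow> diag t (e m) = t (m mod q) *s e m"
  by (simp add: diag_def)

lemma crd_diag: "i < n \<Longrightarrow> crd i (diag t v) = t (i mod q) * crd i v"
proof -
  assume i: "i < n"
  have "diag t v = (\<Sum>j<n. (crd j v * t (j mod q)) *s e j)"
    using lin_expand[OF lin_diag, of t v] by (simp add: diag_e)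
  then show ?thesis using crd_combination[OF i] by (simp del: crd_sum crd_scale)
qed

lemma diag_cong: "(\<And>i. i < q \<Longrightarrow> s i = t i) \<Longrightarrow> diag s = diag t"
  by (rule lin_eqI) (auto simp: lin_diag diag_e)

lemma diag_comp: "diag s \<circ> diag t = diag (\<lambda>i. s i * t i)"
  by (rule lin_eqI) (auto simp: lin_comp lin_diag diag_e lin_scale[OF lin_diag] mult.commute)

lemma diag_one: "diag (\<lambda>_. 1) = id"
  by (rule lin_eqI) (auto simp: lin_diag lin_id diag_e)

lemma prod_mod: "(\<Prod>m<q * k. f (m mod q)) = (\<Prod>i<q. f i :: 'k) ^ k"
proof (induction k)
  case (Suc k)
  have "{..<q * Suc k} = {..<q * k} \<union> (\<lambda>i. q * k + i) ` {..<q}"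
  proof (intro equalityI subsetI)
    fix x assume "x \<in> {..<q * Suc k}"
    then show "x \<in> {..<q * k} \<union> (\<lambda>i. q * k + i) ` {..<q}"
      by (cases "x < q * k") (auto intro!: image_eqI[of _ _ "x - q * k"])
  qed auto
  then have "(\<Prod>m<q * Suc k. f (m mod q)) = (\<Prod>m<q * k. f (m mod q)) * (\<Prod>m\<in>(\<lambda>i. q * k + i) ` {..<q}. f (m mod q))"
    by (simp only:) (rule prod.union_disjoint, auto)
  also have "(\<Prod>m\<in>(\<lambda>i. q * k + i) ` {..<q}. f (m mod q)) = (\<Prod>i<q. f i)"
    by (subst prod.reindex) (auto intro!: prod.cong)
  finally show ?case using Suc by simp
qed simp

lemma prod_inverse: "(\<Prod>i\<in>A. inverse (f i)) = inverse (\<Prod>i\<in>A. f i :: 'k)"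
  using prod_inversef[of f A] by (simp add: comp_def)

definition T :: "('v \<Rightarrow> 'v) set"
  where "T = {diag t | t. (\<Prod>i<q. t i) = 1}"

lemma diag_upper: "(\<Prod>i<q. t i) = 1 \<Longrightarrow> diag t \<in> upper"
proof -
  assume t: "(\<Prod>i<q. t i) = 1"
  have lower: "crd i (diag t (e j)) = 0" if "i < n" "j < i" for i j
    using that by (simp add: diag_e crd_e)
  have "Determinant.det (mtx (diag t)) = (\<Prod>i<n. crd i (diag t (e i)))"
    by (rule det_mtx_triangular) (rule lower)
  also have "\<dots> = (\<Prod>i<q * d. t (i mod q))"
    unfolding n_eq[symmetric] by (intro prod.cong) (auto simp: diag_e crd_e)
  finally have "diag t \<in> carrier SL" using t by (simp add: prod_mod SL_iff lin_diag)
  then show ?thesis using lower by (rule upperI)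
qed

lemma T_upper: "T \<subseteq> upper"
  using diag_upper by (auto simp: T_def)

lemma T_SL: "t \<in> T \<Longrightarrow> t \<in> carrier SL"
  using T_upper upper_SL by blast

definition wt :: "('v \<Rightarrow> 'v) \<Rightarrow> nat \<Rightarrow> 'k"
  where "wt g i = crd i (g (e i))"

lemma wt_diag: "i < q \<Longrightarrow> wt (diag t) i = t i"
  using q_le_n by (simp add: wt_def crd_diag crd_e)

lemma T_wt:
  assumes "g \<in> T"
  shows "diag (wt g) = g" "(\<Prod>i<q. wt g i) = 1"
proof -
  obtain t where t: "g = diag t" "(\<Prod>i<q. t i) = 1" using assms by (auto simp: T_def)
  show "diag (wt g) = g" unfolding t by (rule diag_cong) (rule wt_diag)
  show "(\<Prod>i<q. wt g i) = 1" using t wt_diag by simp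
qed

lemma wt_nonzero: "g \<in> T \<Longrightarrow> i < q \<Longrightarrow> wt g i \<noteq> 0"
  using T_wt(2)[of g] prod_zero[of "{..<q}" "wt g"] by fastforce

lemma wt_comp:
  assumes "g \<in> T" "h \<in> T" "i < q"
  shows "wt (g \<circ> h) i = wt g i * wt h i"
proof -
  have "g \<circ> h = diag (\<lambda>i. wt g i * wt h i)"
    using diag_comp[of "wt g" "wt h"] by (simp only: T_wt(1)[OF assms(1)] T_wt(1)[OF assms(2)])
  then show ?thesis using wt_diag[OF assms(3)] by simp
qed

lemma subgroup_T: "subgroup T SL"
proof (rule SLg.subgroupI)
  have "id \<in> T" unfolding T_def diag_one[symmetric] by fastforce
  then show "T \<noteq> {}" by blast
next
  fix g assume g: "g \<in> T"
  let ?h = "diag (\<lambda>i. inverse (wt g i))"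
  have "?h \<circ> diag (wt g) = diag (\<lambda>_. 1)"
    unfolding diag_comp using wt_nonzero[OF g] by (intro diag_cong) auto
  then have "?h \<circ> g = id" using T_wt(1)[OF g] diag_one by simp
  moreover have h: "?h \<in> T" using T_wt(2)[OF g] by (auto simp: T_def prod_inverse intro!: exI[of _ "\<lambda>i. inverse (wt g i)"])
  ultimately have "inv\<^bsub>SL\<^esub> g = ?h" using T_SL[OF g] T_SL[OF h] by (intro SLg.inv_equality) auto
  then show "inv\<^bsub>SL\<^esub> g \<in> T" using h by simp
next
  fix g h assume "g \<in> T" "h \<in> T"
  then obtain s t where st: "g = diag s" "h = diag t" "(\<Prod>i<q. s i) = 1" "(\<Prod>i<q. t i) = 1"
    by (auto simp: T_def)
  have "g \<otimes>\<^bsub>SL\<^esub> h = diag (\<lambda>i. s i * t i)" using st diag_comp by simp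
  moreover have "(\<Prod>i<q. s i * t i) = 1" using st by (simp add: prod.distrib)
  ultimately show "g \<otimes>\<^bsub>SL\<^esub> h \<in> T" unfolding T_def by blast
qed (use T_SL in auto)

lemma T_equations: "T = {g \<in> carrier SL. \<forall>f\<in>
    {\<lambda>g. crd i (g (e j)) | i j. i < n \<and> j < n \<and> i \<noteq> j} \<union>
    {\<lambda>g. wt g m - wt g (m mod q) | m. m < n} \<union> {\<lambda>g. (\<Prod>i<q. wt g i) - 1}. f g = 0}"
  (is "T = {g \<in> carrier SL. \<forall>f\<in>?F. f g = 0}")
proof (intro equalityI subsetI)
  fix g assume "g \<in> T"
  then obtain t where t: "g = diag t" "(\<Prod>i<q. t i) = 1" "g \<in> carrier SL" using T_SL by (auto simp: T_def)
  have "wt g m = t (m mod q)" if "m < n" for m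
    using that by (simp add: t wt_def crd_diag crd_e)
  moreover have "wt g i = t i" if "i < q" for i using that wt_diag t by simp
  moreover have "crd i (g (e j)) = 0" if "i < n" "j < n" "i \<noteq> j" for i j
    using that by (simp add: t crd_diag crd_e)
  ultimately show "g \<in> {g \<in> carrier SL. \<forall>f\<in>?F. f g = 0}" using t(2,3) by auto
next
  fix g assume *: "g \<in> {g \<in> carrier SL. \<forall>f\<in>?F. f g = 0}"
  have g: "g \<in> carrier SL" using * unfolding mem_Collect_eq by (rule conjunct1)
  have F: "\<forall>f\<in>?F. f g = 0" using * unfolding mem_Collect_eq by (rule conjunct2)
  have off: "crd i (g (e j)) = 0" if "i < n" "j < n" "i \<noteq> j" for i j
    using that by (intro F[THEN bspec, of "\<lambda>g. crd i (g (e j))"]) blast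
  have on: "wt g m = wt g (m mod q)" if "m < n" for m
  proof -
    have "wt g m - wt g (m mod q) = 0"
      using that by (intro F[THEN bspec, of "\<lambda>g. wt g m - wt g (m mod q)"]) blast
    then show ?thesis by simp
  qed
  have "(\<Prod>i<q. wt g i) - 1 = 0"
    by (intro F[THEN bspec, of "\<lambda>g. (\<Prod>i<q. wt g i) - 1"]) blast
  then have "diag (wt g) \<in> T" by (auto simp: T_def)
  moreover have "diag (wt g) = g"
  proof (rule lin_eqI[OF lin_diag SL_lin[OF g]], rule crd_eqI)
    fix i j assume ij: "i < n" "j < n"
    show "crd i (diag (wt g) (e j)) = crd i (g (e j))"
    proof (cases "i = j")
      case True
      then have "crd i (diag (wt g) (e j)) = wt g (j mod q)" using ij by (simp add: diag_e crd_e)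
      also have "\<dots> = wt g j" by (rule on[OF ij(2), symmetric])
      finally show ?thesis using True by (simp add: wt_def)
    next
      case False
      then show ?thesis using ij off[OF ij False] by (simp add: diag_e crd_e)
    qed
  qed
  ultimately show "g \<in> T" by simp
qed

lemma end_coords_wt: "(\<lambda>g. wt g i) \<in> end_coords"
  unfolding wt_def by (rule end_coords_crd)

lemma closed_subgroup_T: "closed_subgroup T"
proof -
  have "closedin zariski T"
    by (subst T_equations, rule closedin_common_zeros)
      (auto intro!: end_coords_crd end_coords_diff end_coords_prod end_coords_wt end_coords_const)
  then show ?thesis using subgroup_T by (simp add: closed_subgroup_def)
qed

text \<open>The last weight is determined by the others, which are arbitrary.\<close>

definition complete :: "(nat \<Rightarrow> 'k) \<Rightarrow> nat \<Rightarrow> 'k"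
  where "complete x i = (if i < q - 1 then x i else (\<Prod>j<q - 1. inverse (x j)))"

lemma prod_split_last: "(\<Prod>i<q. f i) = (\<Prod>i<q - 1. f i) * (f (q - 1) :: 'k)"
proof -
  have "q = Suc (q - 1)" using q2 by simp
  then show ?thesis by (metis prod.lessThan_Suc)
qed

lemma prod_complete:
  assumes "\<And>i. i < q - 1 \<Longrightarrow> x i \<noteq> 0"
  shows "(\<Prod>i<q. complete x i) = 1"
proof -
  have "(\<Prod>i<q. complete x i) = (\<Prod>i<q - 1. x i) * (\<Prod>i<q - 1. inverse (x i))"
    unfolding prod_split_last by (simp add: complete_def)
  also have "\<dots> = (\<Prod>i<q - 1. x i * inverse (x i))" by (simp add: prod.distrib)
  also have "\<dots> = 1" using assms by (intro prod.neutral) auto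
  finally show ?thesis .
qed

lemma carrier_mult_grp_power: "carrier (mult_grp_power r) = ({..<r} \<rightarrow>\<^sub>E - {0 :: 'k})"
  by (simp add: mult_grp_power_def mult_grp_def)

lemma mult_mult_grp_power: "x \<otimes>\<^bsub>mult_grp_power r\<^esub> y = (\<lambda>i\<in>{..<r}. x i * (y i :: 'k))"
  by (simp add: mult_grp_power_def mult_grp_def)

lemma torus_T: "torus (q - 1) T"
proof -
  let ?G = "mult_grp_power (q - 1) :: (nat \<Rightarrow> 'k) monoid"
  let ?A = "mult_grp_power_coords (q - 1) :: ((nat \<Rightarrow> 'k) \<Rightarrow> 'k) set"
  let ?\<phi> = "\<lambda>x. diag (complete x)" and ?\<psi> = "\<lambda>g. restrict (wt g) {..<q - 1}"
  have G: "x i \<noteq> 0" if "x \<in> carrier ?G" "i < q - 1" for x i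
    using that by (auto simp: carrier_mult_grp_power PiE_iff)
  have \<phi>T: "?\<phi> x \<in> T" if "x \<in> carrier ?G" for x
    using prod_complete[of x] G[OF that] by (auto simp: T_def)
  have \<psi>G: "?\<psi> g \<in> carrier ?G" if "g \<in> T" for g
    using wt_nonzero[OF that] by (auto simp: carrier_mult_grp_power)
  have \<psi>\<phi>: "?\<psi> (?\<phi> x) = x" if "x \<in> carrier ?G" for x
    using that by (auto simp: carrier_mult_grp_power wt_diag complete_def fun_eq_iff restrict_def PiE_iff extensional_def)
  have \<phi>\<psi>: "?\<phi> (?\<psi> g) = g" if g: "g \<in> T" for g
  proof -
    have "complete (?\<psi> g) i = wt g i" if i: "i < q" for i
    proof (cases "i < q - 1")
      case False
      then have "i = q - 1" using i by simp
      moreover have "(\<Prod>j<q - 1. wt g j) * wt g (q - 1) = 1" using T_wt(2)[OF g] prod_split_last by simp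
      then have "inverse (\<Prod>j<q - 1. wt g j) = wt g (q - 1)" by (rule inverse_unique)
      ultimately show ?thesis by (simp add: complete_def prod_inverse)
    qed (simp add: complete_def)
    then show ?thesis using diag_cong T_wt(1)[OF g] by metis
  qed
  have "group_isomorphisms ?G (subgrp T) ?\<phi> ?\<psi>"
    unfolding group_isomorphisms_def
  proof (intro conjI)
    show "?\<phi> \<in> hom ?G (subgrp T)"
    proof (rule homI)
      fix x y assume "x \<in> carrier ?G" "y \<in> carrier ?G"
      have "complete (x \<otimes>\<^bsub>?G\<^esub> y) i = complete x i * complete y i" for i
        by (simp add: complete_def mult_mult_grp_power prod.distrib)
      then have "?\<phi> (x \<otimes>\<^bsub>?G\<^esub> y) = diag (\<lambda>i. complete x i * complete y i)"
        by (intro diag_cong)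
      then show "?\<phi> (x \<otimes>\<^bsub>?G\<^esub> y) = ?\<phi> x \<otimes>\<^bsub>subgrp T\<^esub> ?\<phi> y"
        by (simp add: diag_comp)
    qed (use \<phi>T in simp)
    show "?\<psi> \<in> hom (subgrp T) ?G"
    proof (rule homI)
      fix g h assume "g \<in> carrier (subgrp T)" "h \<in> carrier (subgrp T)"
      then show "?\<psi> (g \<otimes>\<^bsub>subgrp T\<^esub> h) = ?\<psi> g \<otimes>\<^bsub>?G\<^esub> ?\<psi> h"
        using wt_comp[of g h] by (auto simp: mult_mult_grp_power fun_eq_iff restrict_def)
    qed (use \<psi>G in simp)
  qed (use \<psi>\<phi> \<phi>\<psi> in auto)
  moreover have "regular_map (carrier ?G) ?A T end_coords ?\<phi>"
    unfolding regular_map_def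
  proof (intro conjI ballI)
    show "?\<phi> \<in> carrier ?G \<rightarrow> T" using \<phi>T by blast
    fix f :: "('v \<Rightarrow> 'v) \<Rightarrow> 'k" assume "f \<in> end_coords"
    let ?Q = "\<lambda>f. \<exists>a\<in>?A. \<forall>x\<in>carrier ?G. f x = a x"
    have A_mult: "(\<lambda>x. f x * h x) \<in> ?A" if "f \<in> ?A" "h \<in> ?A" for f h
      using that unfolding mult_grp_power_coords_def by (rule fun_algebra.mult)
    have A_const: "(\<lambda>_. c) \<in> ?A" for c
      unfolding mult_grp_power_coords_def by (rule fun_algebra.const)
    have A_prod: "(\<lambda>x. \<Prod>j\<in>I. f j x) \<in> ?A" if "\<And>j. j \<in> I \<Longrightarrow> f j \<in> ?A" for I :: "nat set" and f
      using that by (induction I rule: infinite_finite_induct) (auto intro: A_const A_mult simp del: One_nat_def)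
    have A_gen: "(\<lambda>x. x i) \<in> ?A" "(\<lambda>x. inverse (x i)) \<in> ?A" if "i < q - 1" for i
      using that unfolding mult_grp_power_coords_def by (auto intro!: fun_algebra.gen)
    have A_complete: "(\<lambda>x. complete x i) \<in> ?A" for i
      unfolding complete_def by (cases "i < q - 1") (auto intro!: A_gen A_prod simp del: One_nat_def)
    from \<open>f \<in> end_coords\<close> show "?Q (\<lambda>x. f (?\<phi> x))"
    proof (rule end_coords_pullback[where X = "carrier ?G" and Q = ?Q])
      show "?Q (\<lambda>x. f x + h x)" if f: "?Q f" and h: "?Q h" for f h
      proof -
        obtain a b where ab: "a \<in> ?A" "\<forall>x\<in>carrier ?G. f x = a x" "b \<in> ?A" "\<forall>x\<in>carrier ?G. h x = b x"
          using f h by blast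
        then have "(\<lambda>x. a x + b x) \<in> ?A"
          unfolding mult_grp_power_coords_def by (intro fun_algebra.add)
        then show ?thesis using ab by (intro bexI[of _ "\<lambda>x. a x + b x"]) auto
      qed
      show "?Q (\<lambda>x. f x * h x)" if f: "?Q f" and h: "?Q h" for f h
      proof -
        obtain a b where ab: "a \<in> ?A" "\<forall>x\<in>carrier ?G. f x = a x" "b \<in> ?A" "\<forall>x\<in>carrier ?G. h x = b x"
          using f h by blast
        then show ?thesis using A_mult[OF ab(1,3)] by (intro bexI[of _ "\<lambda>x. a x * b x"]) auto
      qed
      show "?Q (\<lambda>_. c)" for c by (intro bexI[OF _ A_const[of c]] ballI refl)
      show "?Q h" if "?Q f" "\<And>x. x \<in> carrier ?G \<Longrightarrow> f x = h x" for f h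
        using that by metis
      fix i j assume ij: "i < n" "j < n"
      have "(\<lambda>x. complete x (i mod q) * (if i = j then 1 else 0)) \<in> ?A"
        by (intro A_mult A_complete A_const)
      then show "?Q (\<lambda>x. crd i (?\<phi> x (e j)))"
        by (rule bexI[rotated]) (use ij in \<open>simp add: crd_diag crd_e\<close>)
    qed (rule lin_diag)
  qed
  moreover have "regular_map T end_coords (carrier ?G) ?A ?\<psi>"
    unfolding regular_map_def
  proof (intro conjI ballI)
    show "?\<psi> \<in> T \<rightarrow> carrier ?G" using \<psi>G by blast
    fix b assume "b \<in> ?A"
    then show "\<exists>a\<in>end_coords. \<forall>g\<in>T. b (?\<psi> g) = a g"
      unfolding mult_grp_power_coords_def
    proof induction
      case (gen f)
      then obtain i where i: "i < q - 1" and f: "f = (\<lambda>x. x i) \<or> f = (\<lambda>x. inverse (x i))" by auto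
      have "f (?\<psi> g) = (\<Prod>j\<in>{..<q} - {i}. wt g j)" if g: "g \<in> T" "f = (\<lambda>x. inverse (x i))" for g
      proof -
        have "wt g i * (\<Prod>j\<in>{..<q} - {i}. wt g j) = 1"
          using T_wt(2)[OF g(1)] i prod.remove[of "{..<q}" i "wt g"] by simp
        from inverse_unique[OF this] show ?thesis using g(2) i by simp
      qed
      then show ?case
        using f
      proof (elim disjE)
        assume "f = (\<lambda>x. x i)"
        then show ?thesis using i by (intro bexI[OF _ end_coords_wt[of i]]) auto
      next
        assume "f = (\<lambda>x. inverse (x i))"
        then show ?thesis
          using \<open>\<And>g. g \<in> T \<Longrightarrow> f = (\<lambda>x. inverse (x i)) \<Longrightarrow> f (?\<psi> g) = (\<Prod>j\<in>{..<q} - {i}. wt g j)\<close>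
          by (intro bexI[of _ "\<lambda>g. \<Prod>j\<in>{..<q} - {i}. wt g j"] ballI end_coords_prod end_coords_wt)
      qed
    next
      case (const c)
      then show ?case by (intro bexI[OF _ end_coords_const[of c]]) simp
    next
      case (add f h)
      then obtain a b where "a \<in> end_coords" "\<forall>g\<in>T. f (?\<psi> g) = a g" "b \<in> end_coords" "\<forall>g\<in>T. h (?\<psi> g) = b g"
        by blast
      then show ?case by (intro bexI[of _ "\<lambda>g. a g + b g"] end_coords_add ballI) (simp_all only:)
    next
      case (mult f h)
      then obtain a b where "a \<in> end_coords" "\<forall>g\<in>T. f (?\<psi> g) = a g" "b \<in> end_coords" "\<forall>g\<in>T. h (?\<psi> g) = b g"
        by blast
      then show ?case by (intro bexI[of _ "\<lambda>g. a g * b g"] end_coords_mult ballI) (simp_all only:)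
    qed
  qed
  ultimately show ?thesis unfolding torus_def using closed_subgroup_T by blast
qed

subsection \<open>Weight spaces\<close>

text \<open>
  Put \<open>s\<close> and \<open>s\<inverse>\<close> at the positions \<open>r\<close> and \<open>r'\<close>, where \<open>s\<^sup>3 \<noteq> s\<close>; such an \<open>s\<close> exists as the field is
  infinite.
\<close>

lemma T_separates:
  assumes "r < q" "r' < q" "r \<noteq> r'"
  shows "\<exists>t :: nat \<Rightarrow> 'k. (\<Prod>i<q. t i) = 1 \<and> t r \<noteq> t r'"
proof -
  have "finite {s. poly [:0, -1, 0, 1 :: 'k:] s = 0}" by (rule poly_roots_finite) auto
  then obtain s where s: "poly [:0, -1, 0, 1 :: 'k:] s \<noteq> 0" using infinite_field
    by (metis (mono_tags, lifting) ex_new_if_finite mem_Collect_eq)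
  then have s': "s \<noteq> 0" "s * s \<noteq> 1" by (auto simp: algebra_simps)
  define t where "t i = (if i = r then s else if i = r' then inverse s else 1)" for i
  have "(\<Prod>i<q. t i) = (\<Prod>i\<in>{r, r'}. t i)"
    using assms by (intro prod.mono_neutral_right) (auto simp: t_def)
  also have "\<dots> = 1" using assms(3) s' by (simp add: t_def)
  finally have "(\<Prod>i<q. t i) = 1" .
  moreover have "t r \<noteq> t r'" using assms(3) s' by (auto simp: t_def field_simps)
  ultimately show ?thesis by blast
qed

text \<open>
  A weight vector has a non-zero coordinate \<open>m\<close>, which forces its weight to be \<open>t \<mapsto> t (m mod q)\<close>. As
  distinct residues are separated by \<open>T\<close>, its weight space is spanned by the \<open>d\<close> basis vectors
  with index congruent to \<open>m\<close>.
\<close>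

lemma weight_space_dim:
  assumes "W \<in> weight_spaces T"
  shows "dim W = d"
proof -
  obtain \<chi> where W: "W = {v. \<forall>t\<in>T. t v = \<chi> t *s v}" and "W \<noteq> {0}"
    using assms by (auto simp: weight_spaces_def)
  have W_iff: "v \<in> W \<longleftrightarrow> (\<forall>t. (\<Prod>i<q. t i) = 1 \<longrightarrow> diag t v = \<chi> (diag t) *s v)" for v
    by (auto simp: W T_def)
  have "0 \<in> W" by (simp add: W_iff lin_0[OF lin_diag])
  then obtain v where v: "v \<in> W" "v \<noteq> 0" using \<open>W \<noteq> {0}\<close> by blast
  then obtain m where m: "m < n" "crd m v \<noteq> 0" using crd_eqI[of v 0] by auto
  define r where "r = m mod q"
  have \<chi>: "\<chi> (diag t) = t r" if "(\<Prod>i<q. t i) = 1" for t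
  proof -
    have "crd m (diag t v) = \<chi> (diag t) * crd m v" using v(1) that W_iff by simp
    then show ?thesis using m by (simp add: crd_diag r_def)
  qed
  let ?I = "{i. i < n \<and> i mod q = r}"
  have "W = {v. \<forall>i<n. i mod q \<noteq> r \<longrightarrow> crd i v = 0}"
  proof (intro equalityI subsetI CollectI allI impI)
    fix w i assume w: "w \<in> W" and i: "i < n" "i mod q \<noteq> r"
    obtain t :: "nat \<Rightarrow> 'k" where t: "(\<Prod>i<q. t i) = 1" "t r \<noteq> t (i mod q)"
      using T_separates[of r "i mod q"] i(2) unfolding r_def by auto
    have "crd i (diag t w) = t r * crd i w" using w t(1) \<chi> W_iff by simp
    then show "crd i w = 0" using t(2) i(1) by (simp add: crd_diag)
  next
    fix w assume w: "w \<in> {v. \<forall>i<n. i mod q \<noteq> r \<longrightarrow> crd i v = 0}"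
    have "diag t w = t r *s w" for t
      by (rule crd_eqI) (use w in \<open>auto simp: crd_diag\<close>)
    then show "w \<in> W" using \<chi> W_iff by simp
  qed
  also have "\<dots> = span (e ` ?I)"
  proof (intro equalityI subsetI)
    fix w assume w: "w \<in> {v. \<forall>i<n. i mod q \<noteq> r \<longrightarrow> crd i v = 0}"
    have "w = (\<Sum>i<n. crd i w *s e i)" by (simp add: expand)
    also have "\<dots> = (\<Sum>i\<in>?I. crd i w *s e i)"
      using w by (intro sum.mono_neutral_right) auto
    also have "\<dots> \<in> span (e ` ?I)" by (intro span_sum span_scale span_base) auto
    finally show "w \<in> span (e ` ?I)" .
  next
    have "subspace {v. \<forall>i<n. i mod q \<noteq> r \<longrightarrow> crd i v = 0}" by (rule subspaceI) auto
    moreover have "e ` ?I \<subseteq> {v. \<forall>i<n. i mod q \<noteq> r \<longrightarrow> crd i v = 0}" by (auto simp: crd_e)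
    ultimately show "w \<in> {v. \<forall>i<n. i mod q \<noteq> r \<longrightarrow> crd i v = 0}" if "w \<in> span (e ` ?I)" for w
      using span_minimal that by blast
  qed
  finally have W: "W = span (e ` ?I)" .
  have sub: "?I \<subseteq> {..<n}" by auto
  have "independent (e ` ?I)" by (rule independent_mono[OF indep_e image_mono[OF sub]])
  then have "dim W = card (e ` ?I)" unfolding W by (rule dim_span_eq_card_independent)
  also have "\<dots> = card ?I" using card_image[OF inj_on_subset[OF inj_e sub]] .
  also have "?I = (\<lambda>j. q * j + r) ` {..<d}"
  proof (intro equalityI subsetI)
    fix i assume i: "i \<in> ?I"
    then have "i div q < d" using n_eq by (simp add: less_mult_imp_div_less mult.commute)
    then show "i \<in> (\<lambda>j. q * j + r) ` {..<d}"
      using i by (intro image_eqI[of _ _ "i div q"]) auto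
  next
    fix i assume "i \<in> (\<lambda>j. q * j + r) ` {..<d}"
    then obtain j where j: "j < d" "i = q * j + r" by auto
    have r: "r < q" by (simp add: r_def)
    have "q * j + r < q * Suc j" using r by simp
    also have "\<dots> \<le> n" unfolding n_eq using j by (intro mult_le_mono2) simp
    finally show "i \<in> ?I" using j r by simp
  qed
  also have "card \<dots> = d" using q2 by (subst card_image) (auto simp: inj_on_def)
  finally show ?thesis .
qed

end

section \<open>The unipotent element\<close>

context torus_space
begin

text \<open>
  \<open>u\<close> permutes the weight spaces cyclically, and its \<open>q\<close>-th power acts on each of them as a single
  Jordan block: \<open>u\<close> moves \<open>e m\<close> to \<open>e (m + 1)\<close> as long as both lie in the same block of \<open>q\<close>
  consecutive indices; the last vector of a block goes to the first vector of that block plus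
  the first vector of the preceding block, if there is one.
\<close>

definition u :: "'v \<Rightarrow> 'v"
  where "u = ext (\<lambda>m. if Suc m mod q \<noteq> 0 then e (Suc m)
    else e (Suc m - q) + (if Suc m < 2 * q then 0 else e (Suc m - 2 * q)))"

lemma lin_u: "lin u"
  by (simp add: u_def lin_ext)

lemma index_lt: "j < d \<Longrightarrow> i < q \<Longrightarrow> q * j + i < n"
proof -
  assume "j < d" "i < q"
  then have "q * j + i < q * Suc j" by simp
  also have "\<dots> \<le> n" unfolding n_eq using \<open>j < d\<close> by (intro mult_le_mono2) simp
  finally show ?thesis .
qed

lemma index_cases:
  assumes "m < n"
  shows "\<exists>j i. j < d \<and> i < q \<and> m = q * j + i"
proof (intro exI conjI)
  show "m div q < d" using assms n_eq by (simp add: less_mult_imp_div_less mult.commute)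
  show "m mod q < q" "m = q * (m div q) + m mod q" by simp_all
qed

lemma u_e_next: "j < d \<Longrightarrow> Suc i < q \<Longrightarrow> u (e (q * j + i)) = e (q * j + Suc i)"
proof -
  assume j: "j < d" and i: "Suc i < q"
  have "Suc (q * j + i) mod q = Suc i"
    using i by (metis add_Suc_right mod_less mod_mult_self4 mult.commute)
  then show ?thesis using index_lt[of j i] j i by (simp add: u_def)
qed

lemma u_e_last: "j < d \<Longrightarrow> u (e (q * j + (q - 1))) = e (q * j) + (if j = 0 then 0 else e (q * (j - 1)))"
proof -
  assume j: "j < d"
  let ?m = "q * j + (q - 1)"
  have S: "Suc ?m = q * j + q" using q2 by simp
  have "?m < n" using index_lt[of j "q - 1"] j q2 by simp
  moreover have "Suc ?m mod q = 0" unfolding S by simp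
  moreover have "Suc ?m - q = q * j" unfolding S by simp
  moreover have "Suc ?m < 2 * q \<longleftrightarrow> j = 0" unfolding S using q2 by (cases j) auto
  moreover have "Suc ?m - 2 * q = q * (j - 1)" unfolding S by (simp add: diff_mult_distrib2)
  ultimately show ?thesis by (simp add: u_def del: add_Suc_right)
qed

lemma lin_funpow: "lin f \<Longrightarrow> lin (f ^^ k)"
  by (induction k) (auto simp: lin_id lin_comp)

lemma u_pow_e: "j < d \<Longrightarrow> i + k < q \<Longrightarrow> (u ^^ k) (e (q * j + i)) = e (q * j + i + k)"
proof (induction k)
  case (Suc k)
  then show ?case using u_e_next[of j "i + k"] by (simp add: add.assoc)
qed simp

lemma u_pow_q:
  assumes j: "j < d" and i: "i < q"
  shows "(u ^^ q) (e (q * j + i)) = e (q * j + i) + (if j = 0 then 0 else e (q * (j - 1) + i))"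
proof -
  have "q = i + Suc (q - 1 - i)" using i by simp
  then have "(u ^^ q) (e (q * j + i)) = (u ^^ (i + Suc (q - 1 - i))) (e (q * j + i))" by simp
  also have "\<dots> = (u ^^ i) (u ((u ^^ (q - 1 - i)) (e (q * j + i))))"
    unfolding funpow_add by simp
  also have "(u ^^ (q - 1 - i)) (e (q * j + i)) = e (q * j + (q - 1))"
    using u_pow_e[OF j, of i "q - 1 - i"] i by (simp add: add.assoc)
  also have "(u ^^ i) (u \<dots>) = (u ^^ i) (e (q * j)) + (if j = 0 then 0 else (u ^^ i) (e (q * (j - 1))))"
    unfolding u_e_last[OF j]
    using lin_add[OF lin_funpow[OF lin_u, of i]] lin_0[OF lin_funpow[OF lin_u, of i]] by simp
  also have "\<dots> = e (q * j + i) + (if j = 0 then 0 else e (q * (j - 1) + i))"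
    using u_pow_e[of j 0 i] u_pow_e[of "j - 1" 0 i] j i by auto
  finally show ?thesis .
qed

definition N :: "'v \<Rightarrow> 'v"
  where "N v = u v - v"

lemma lin_N: "lin N"
  by (rule linI) (auto simp: N_def lin_add[OF lin_u] lin_scale[OF lin_u] scale_right_diff_distrib)

lemma N_pow_0: "(N ^^ k) 0 = 0"
  by (rule lin_0[OF lin_funpow[OF lin_N]])

text \<open>The freshman's dream \<open>(X - 1)\<^sup>q = X\<^sup>q - 1\<close> for polynomials, evaluated at \<open>u\<close>.\<close>

lemma N_pow_q:
  assumes "prime CHAR('k)" "q = CHAR('k) ^ a"
  shows "(N ^^ q) v = (u ^^ q) v - v"
proof -
  let ?X = "[:0, 1 :: 'k:]" and ?Y = "[:-1, 1 :: 'k:]"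
  have X: "poly_op u ?X = u" and Y: "poly_op u ?Y = N"
    by (auto simp: fun_eq_iff poly_op_pCons[OF lin_u] lin_0[OF lin_u] N_def)
  have "?X ^ q = (?Y + 1) ^ q" by (simp add: one_pCons)
  also have "\<dots> = ?Y ^ q + 1" using assms by (subst freshmans_dream'[where n = a]) auto
  finally have "poly_op u (?X ^ q) v = poly_op u (?Y ^ q) v + v"
    by (simp add: poly_op_add[OF lin_u] poly_op_1[OF lin_u])
  then show ?thesis by (simp add: poly_op_power[OF lin_u] X Y)
qed

lemma N_pow_q_e:
  assumes "prime CHAR('k)" "q = CHAR('k) ^ a" "m < n"
  shows "(N ^^ q) (e m) = (if m < q then 0 else e (m - q))"
proof -
  obtain j i where ji: "j < d" "i < q" "m = q * j + i" using index_cases[OF assms(3)] by blast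
  have "m < q \<longleftrightarrow> j = 0" using ji by (cases j) auto
  moreover have "m - q = q * (j - 1) + i" if "j \<noteq> 0" using ji that by (cases j) auto
  ultimately show ?thesis
    using N_pow_q[OF assms(1,2)] u_pow_q[OF ji(1,2)] ji(3) by auto
qed

lemma N_pow_mult_e:
  assumes "prime CHAR('k)" "q = CHAR('k) ^ a" "m < n"
  shows "(N ^^ (q * k)) (e m) = (if m < q * k then 0 else e (m - q * k))"
proof (induction k)
  case (Suc k)
  have "(N ^^ (q * Suc k)) (e m) = (N ^^ q) ((N ^^ (q * k)) (e m))"
    by (simp add: funpow_add)
  also have "\<dots> = (if m < q * Suc k then 0 else e (m - q * Suc k))"
  proof (cases "m < q * k")
    case False
    then have "(m - q * k < q \<longleftrightarrow> m < q * Suc k) \<and> m - q * k - q = m - q * Suc k" by auto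
    then show ?thesis
      using False Suc N_pow_q_e[OF assms(1,2), of "m - q * k"] assms(3) by simp
  qed (simp add: Suc N_pow_0)
  finally show ?case .
qed simp

lemma N_pow_n:
  assumes "prime CHAR('k)" "q = CHAR('k) ^ a"
  shows "N ^^ n = (\<lambda>_. 0)"
proof (rule lin_eqI[OF lin_funpow[OF lin_N]])
  show "lin (\<lambda>_. 0)" by (rule linI) auto
  show "(N ^^ n) (e j) = 0" if "j < n" for j
    using N_pow_mult_e[OF assms that, of d] that by (simp add: n_eq[symmetric])
qed

text \<open>Below index \<open>q\<close> the map \<open>u\<close> is a shift, so \<open>(u - 1)\<^sup>k\<close> has leading term \<open>e 0 \<mapsto> e k\<close>.\<close>

lemma N_pow_e_0: "k < q \<Longrightarrow> (N ^^ k) (e 0) \<in> flag (Suc k) \<and> crd k ((N ^^ k) (e 0)) = 1"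
proof (induction k)
  case 0
  then show ?case using n_pos by (simp add: e_in_flag crd_e)
next
  case (Suc k)
  define x where "x = (N ^^ k) (e 0)"
  have x: "x \<in> flag (Suc k)" "crd k x = 1" using Suc by (auto simp: x_def)
  have kn: "Suc k < n" using Suc.prems q_le_n by simp
  have ue: "u (e j) = e (Suc j)" if "j < Suc k" for j
    using u_e_next[of 0 j] d1 that Suc.prems by simp
  have "u x = (\<Sum>j<n. crd j x *s u (e j))" by (rule lin_expand[OF lin_u])
  also have "\<dots> = (\<Sum>j<Suc k. crd j x *s u (e j))"
    using x(1) kn by (intro sum.mono_neutral_right) (auto simp: flag_def)
  also have "\<dots> = (\<Sum>j<Suc k. crd j x *s e (Suc j))"
    using ue by (intro sum.cong) auto
  finally have ux: "u x = (\<Sum>j<Suc k. crd j x *s e (Suc j))" .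
  have "u x \<in> flag (Suc (Suc k))"
    unfolding ux using kn by (intro subspace_sum[OF subspace_flag] subspace_scale[OF subspace_flag]) (auto simp: e_in_flag)
  then have "N x \<in> flag (Suc (Suc k))"
    using x(1) flag_mono[of "Suc k" "Suc (Suc k)"] unfolding N_def
    by (intro subspace_diff[OF subspace_flag]) auto
  moreover have "crd (Suc k) (u x) = (\<Sum>j<Suc k. if j = k then crd j x else 0)"
    unfolding ux crd_sum using kn by (intro sum.cong) (auto simp: crd_e)
  then have "crd (Suc k) (N x) = 1" using x kn by (simp add: N_def flag_def)
  ultimately show ?case by (simp add: x_def)
qed

lemma N_pow_pred_n:
  assumes "prime CHAR('k)" "q = CHAR('k) ^ a"
  shows "(N ^^ (n - 1)) (e (q * (d - 1))) \<noteq> 0"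
proof -
  obtain d' where d': "d = Suc d'" using d1 by (cases d) auto
  have n1: "n - 1 = (q - 1) + q * d'" using q2 by (simp add: n_eq d')
  have lt: "q * d' < n" using index_lt[of d' 0] q2 d' by simp
  have "(N ^^ (q * d')) (e (q * d')) = e 0"
    using N_pow_mult_e[OF assms lt, of d'] by simp
  then have "(N ^^ (n - 1)) (e (q * (d - 1))) = (N ^^ (q - 1)) (e 0)"
    unfolding n1 funpow_add by (simp add: d')
  moreover have "crd (q - 1) ((N ^^ (q - 1)) (e 0)) = 1" using N_pow_e_0[of "q - 1"] q2 by simp
  ultimately show ?thesis by (metis crd_0 zero_neq_one)
qed

text \<open>
  As \<open>N\<^sup>n\<^sup>-\<^sup>1 w \<noteq> 0\<close>, the vectors \<open>N\<^sup>n\<^sup>-\<^sup>1 w, \<dots>, N w, w\<close> form a basis: \<open>N\<^sup>j\<close> kills the first \<open>j\<close> of them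
  but not the next one. In this basis \<open>u\<close> is a Jordan block, so its determinant is 1.
\<close>

lemma u_unipotent_single_block:
  assumes "prime CHAR('k)" "q = CHAR('k) ^ a"
  shows "unipotent u" "single_jordan_block u" "u \<in> carrier SL"
proof -
  have "(\<lambda>v. u v - v) = N" by (auto simp: N_def)
  then show "unipotent u" using N_pow_n[OF assms] unfolding unipotent_def by auto
  obtain w where w: "(N ^^ (n - 1)) w \<noteq> 0" using N_pow_pred_n[OF assms] by blast
  define b where "b j = (N ^^ (n - 1 - j)) w" for j
  have zero: "(N ^^ k) w = 0" if "n \<le> k" for k
  proof -
    have "N ^^ k = N ^^ (k - n) \<circ> N ^^ n" using that by (simp flip: funpow_add)
    then show ?thesis by (simp add: N_pow_n[OF assms] N_pow_0)
  qed
  have "b j \<notin> span (b ` {..<j})" if j: "j < n" for j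
  proof
    assume "b j \<in> span (b ` {..<j})"
    moreover have "span (b ` {..<j}) \<subseteq> {v. (N ^^ j) v = 0}"
    proof (rule span_minimal)
      have "(N ^^ j) (b i) = 0" if "i < j" for i
      proof -
        have "(N ^^ j) (b i) = (N ^^ (j + (n - 1 - i))) w" by (simp add: b_def funpow_add)
        then show ?thesis using zero that j by simp
      qed
      then show "b ` {..<j} \<subseteq> {v. (N ^^ j) v = 0}" by auto
      show "subspace {v. (N ^^ j) v = 0}"
        using lin_funpow[OF lin_N, of j]
        by (intro subspaceI) (auto simp: lin_0 lin_add lin_scale)
    qed
    ultimately have "(N ^^ j) (b j) = 0" by blast
    moreover have "(N ^^ j) (b j) = (N ^^ (j + (n - 1 - j))) w" by (simp add: b_def funpow_add)
    ultimately show False using w j by simp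
  qed
  then have "independent (b ` {..<n}) \<and> inj_on b {..<n}" by (rule triangular_independent)
  then interpret J: based_space scale b n by (intro based_spaceI_independent) auto
  have ub: "u (b j) = b j + (if j = 0 then 0 else b (j - 1))" if j: "j < n" for j
  proof -
    have "N (b j) = (N ^^ Suc (n - 1 - j)) w" by (simp add: b_def)
    moreover have "Suc (n - 1 - j) = (if j = 0 then n else n - 1 - (j - 1))" using j by auto
    ultimately have "N (b j) = (N ^^ (if j = 0 then n else n - 1 - (j - 1))) w" by (simp only:)
    also have "\<dots> = (if j = 0 then 0 else b (j - 1))"
      using zero[of n] by (simp add: b_def del: One_nat_def)
    finally have "N (b j) = (if j = 0 then 0 else b (j - 1))" .
    then show ?thesis unfolding N_def by (simp add: diff_eq_eq add.commute)
  qed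
  have entry: "J.crd i (u (b j)) = (if i = j then 1 else if Suc i = j then 1 else 0)"
    if "i < n" "j < n" for i j
    using that by (auto simp: ub J.crd_e)
  have "matrix_wrt (map b [0..<n]) u = jordan_block (length (map b [0..<n])) 1"
    unfolding J.matrix_wrt_e by (rule eq_matI) (auto simp: entry)
  then show "single_jordan_block u"
    unfolding single_jordan_block_def using J.ordered_basis_e by blast
  have "Determinant.det (J.mtx u) = (\<Prod>i<n. J.crd i (u (b i)))"
    by (rule J.det_mtx_triangular) (simp add: entry)
  also have "\<dots> = 1" by (simp add: entry)
  finally show "u \<in> carrier SL" by (simp add: J.SL_iff lin_u)
qed

subsection \<open>The normaliser of the torus\<close>

text \<open>The weights of \<open>u t u\<inverse>\<close> are those of \<open>t\<close>, rotated by one step.\<close>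

definition rot :: "(nat \<Rightarrow> 'k) \<Rightarrow> nat \<Rightarrow> 'k"
  where "rot s i = (if i = 0 then s (q - 1) else s (i - 1))"

lemma prod_rot: "(\<Prod>i<q. rot s i) = (\<Prod>i<q. s i)"
proof -
  have "(\<Prod>i<Suc (q - 1). rot s i) = rot s 0 * (\<Prod>i<q - 1. rot s (Suc i))"
    by (rule prod.lessThan_Suc_shift)
  then show ?thesis using q2 by (simp add: rot_def prod_split_last mult.commute)
qed

lemma u_diag: "u \<circ> diag s = diag (rot s) \<circ> u"
proof (rule lin_eqI)
  show "lin (u \<circ> diag s)" "lin (diag (rot s) \<circ> u)" by (simp_all add: lin_comp lin_u lin_diag)
  fix m assume "m < n"
  then obtain j i where ji: "j < d" "i < q" "m = q * j + i" using index_cases by blast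
  have lhs: "u (diag s (e m)) = s i *s u (e m)"
    using ji \<open>m < n\<close> by (simp add: diag_e lin_scale[OF lin_u])
  have "diag (rot s) (u (e m)) = s i *s u (e m)"
  proof (cases "Suc i < q")
    case True
    then show ?thesis
      using ji u_e_next[OF ji(1) True] index_lt[OF ji(1) True] by (simp add: diag_e rot_def)
  next
    case False
    then have i: "i = q - 1" using ji by simp
    have "q * j < n" "q * (j - 1) < n" using index_lt[of _ 0] ji(1) q2 by auto
    then show ?thesis
      using u_e_last[OF ji(1)] unfolding ji(3) i
      by (simp add: lin_add[OF lin_diag] lin_0[OF lin_diag] diag_e rot_def scale_right_distrib)
  qed
  then show "(u \<circ> diag s) (e m) = (diag (rot s) \<circ> u) (e m)" using lhs by simp
qed

lemma u_normalizes_T: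
  assumes u: "u \<in> carrier SL"
  shows "u \<in> normalizer SL T"
proof -
  let ?i = "inv\<^bsub>SL\<^esub> u"
  have conj: "u \<circ> diag s \<circ> ?i = diag (rot s)" for s
    using SL_inv_right[OF u] by (simp add: u_diag fun_eq_iff)
  have "u <#\<^bsub>SL\<^esub> T #>\<^bsub>SL\<^esub> ?i = {u \<circ> t \<circ> ?i | t. t \<in> T}"
    by (auto simp: l_coset_def r_coset_def)
  also have "\<dots> = T"
  proof (intro equalityI subsetI)
    fix g assume "g \<in> {u \<circ> t \<circ> ?i | t. t \<in> T}"
    then obtain s where "g = diag (rot s)" "(\<Prod>i<q. s i) = 1" using conj by (auto simp: T_def)
    then show "g \<in> T" using prod_rot[of s] by (auto simp: T_def)
  next
    fix g assume "g \<in> T"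
    then obtain t where t: "g = diag t" "(\<Prod>i<q. t i) = 1" by (auto simp: T_def)
    define s where "s i = (if i = q - 1 then t 0 else t (Suc i))" for i
    have rot: "rot s i = t i" if "i < q" for i using that by (auto simp: rot_def s_def)
    then have "(\<Prod>i<q. s i) = 1" using t(2) prod_rot[of s] by simp
    then have "diag s \<in> T" by (auto simp: T_def)
    moreover have "g = u \<circ> diag s \<circ> ?i" unfolding conj t(1) using rot by (intro diag_cong) simp
    ultimately show "g \<in> {u \<circ> t \<circ> ?i | t. t \<in> T}" by blast
  qed
  finally show ?thesis
    using u subgroup.subset[OF subgroup_T] by (simp add: normalizer_def stabilizer_def)
qed

section \<open>Subspaces stable under the torus and the unipotent element\<close>

lemma u_stab_flag:
  assumes u: "u \<in> carrier SL"
  shows "u \<in> stab (flag q)"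
proof -
  have ue: "u (e j) \<in> flag q" if j: "j < q" for j
  proof (cases "Suc j < q")
    case True
    then have "Suc j < n" using q_le_n by simp
    then show ?thesis using u_e_next[of 0 j] True d1 e_in_flag[of "Suc j" q] by simp
  next
    case False
    then have "j = q - 1" using j by simp
    then show ?thesis using u_e_last[of 0] d1 e_in_flag[OF n_pos, of q] q2 by simp
  qed
  have "u v \<in> flag q" if v: "v \<in> flag q" for v
  proof -
    have "crd j v *s u (e j) \<in> flag q" if "j < n" for j
    proof (cases "j < q")
      case True
      then show ?thesis using ue subspace_scale[OF subspace_flag] by blast
    next
      case False
      then have "crd j v = 0" using v that by (simp add: flag_def)
      then show ?thesis using subspace_0[OF subspace_flag] by simp
    qed
    then have "(\<Sum>j<n. crd j v *s u (e j)) \<in> flag q" by (intro subspace_sum[OF subspace_flag]) auto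
    then show ?thesis using lin_expand[OF lin_u, of v] by simp
  qed
  then show ?thesis using u by (auto simp: stab_def)
qed

text \<open>
  For \<open>d = 1\<close> the weight spaces are lines. A vector of minimal support in a \<open>T\<close>-stable subspace
  spans one of them, and \<open>u\<close> permutes them transitively.
\<close>

lemma T_u_irreducible:
  assumes d: "d = 1" and Y: "subspace Y" "Y \<noteq> {0}"
    and Tst: "\<And>t v. t \<in> T \<Longrightarrow> v \<in> Y \<Longrightarrow> t v \<in> Y" and ust: "\<And>v. v \<in> Y \<Longrightarrow> u v \<in> Y"
  shows "Y = UNIV"
proof -
  have nq: "n = q" using n_eq d by simp
  define supp where "supp v = {i. i < n \<and> crd i v \<noteq> 0}" for v
  have fin: "finite (supp v)" for v by (simp add: supp_def)
  obtain v0 where "v0 \<in> Y" "v0 \<noteq> 0" using Y subspace_0 by blast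
  then obtain v where v: "v \<in> Y" "v \<noteq> 0" and
    min: "\<And>w. w \<in> Y \<Longrightarrow> w \<noteq> 0 \<Longrightarrow> card (supp v) \<le> card (supp w)"
    using ex_has_least_nat[of "\<lambda>v. v \<in> Y \<and> v \<noteq> 0" v0 "\<lambda>v. card (supp v)"] by blast
  obtain r where r: "r < n" "crd r v \<noteq> 0" using v(2) crd_eqI[of v 0] by auto
  have other: "crd j v = 0" if j: "j < n" "j \<noteq> r" for j
  proof (rule ccontr)
    assume cj: "crd j v \<noteq> 0"
    obtain t :: "nat \<Rightarrow> 'k" where t: "(\<Prod>i<q. t i) = 1" "t r \<noteq> t j"
      using T_separates[of r j] r(1) j nq by auto
    let ?w = "diag t v - t j *s v"
    have "diag t \<in> T" using t(1) by (auto simp: T_def)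
    then have wY: "?w \<in> Y" using Tst v(1) by (intro subspace_diff[OF Y(1)] subspace_scale[OF Y(1)]) auto
    have cw: "crd i ?w = (t i - t j) * crd i v" if "i < n" for i
    proof -
      have "i mod q = i" using that nq by simp
      then show ?thesis using crd_diag[OF that] by (simp add: left_diff_distrib)
    qed
    then have "crd r ?w \<noteq> 0" using r t(2) by simp
    then have w0: "?w \<noteq> 0" by (metis crd_0)
    have "supp ?w \<subset> supp v"
    proof
      show "supp ?w \<subseteq> supp v"
      proof
        fix i assume "i \<in> supp ?w"
        then have "i < n \<and> crd i ?w \<noteq> 0" unfolding supp_def mem_Collect_eq .
        then have "i < n" "crd i ?w \<noteq> 0" by (rule conjunct1, rule conjunct2)
        then have "crd i v \<noteq> 0" using cw[of i] by (metis mult_zero_right)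
        with \<open>i < n\<close> show "i \<in> supp v" by (simp add: supp_def)
      qed
      have "j \<in> supp v" "j \<notin> supp ?w" using cj j cw[OF j(1)] by (simp_all add: supp_def)
      then show "supp ?w \<noteq> supp v" by blast
    qed
    then have "card (supp ?w) < card (supp v)" by (rule psubset_card_mono[OF fin])
    moreover have "card (supp v) \<le> card (supp ?w)" by (rule min[OF wY w0])
    ultimately show False by simp
  qed
  have "v = (\<Sum>i<n. crd i v *s e i)" by (simp add: expand)
  also have "\<dots> = crd r v *s e r"
    using r(1) other by (subst sum.mono_neutral_right[of _ "{r}"]) auto
  finally have "v = crd r v *s e r" .
  then have "inverse (crd r v) *s v = inverse (crd r v) *s (crd r v *s e r)" by (rule arg_cong)
  also have "\<dots> = e r" using r(2) by simp
  finally have "inverse (crd r v) *s v = e r" .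
  then have er: "e r \<in> Y" using subspace_scale[OF Y(1) v(1)] by metis
  have step: "e (Suc j) \<in> Y" if "e j \<in> Y" "Suc j < n" for j
    using ust[OF that(1)] u_e_next[of 0 j] that(2) nq d by simp
  have wrap: "e 0 \<in> Y" if "e (n - 1) \<in> Y"
    using ust[OF that] u_e_last[of 0] nq d by simp
  have up: "e (r + k) \<in> Y" if "r + k < n" for k
    using that by (induction k) (auto intro: er step)
  have "e (n - 1) \<in> Y" using up[of "n - 1 - r"] r(1) by simp
  then have e0: "e 0 \<in> Y" by (rule wrap)
  have "e k \<in> Y" if "k < n" for k
    using that by (induction k) (auto intro: e0 step)
  then have "e ` {..<n} \<subseteq> Y" by auto
  then have "span (e ` {..<n}) \<subseteq> Y" by (rule span_minimal[OF _ Y(1)])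
  then show ?thesis using span_e by blast
qed

lemma in_proper_parabolic_iff:
  assumes u: "u \<in> carrier SL"
  shows "(\<exists>P. parabolic_subgroup P \<and> P \<noteq> carrier SL \<and> T <#>\<^bsub>SL\<^esub> generate SL {u} \<subseteq> P) \<longleftrightarrow> d > 1"
proof
  assume "\<exists>P. parabolic_subgroup P \<and> P \<noteq> carrier SL \<and> T <#>\<^bsub>SL\<^esub> generate SL {u} \<subseteq> P"
  then obtain P where P: "parabolic_subgroup P" "P \<noteq> carrier SL" "T <#>\<^bsub>SL\<^esub> generate SL {u} \<subseteq> P" by blast
  from parabolic_reducible[OF P(1,2) n_pos]
  obtain Y where Y: "subspace Y" "Y \<noteq> {0}" "Y \<noteq> UNIV" and st: "\<forall>g\<in>P. g ` Y \<subseteq> Y"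
    by (elim exE conjE)
  have Yst: "g v \<in> Y" if "g \<in> P" "v \<in> Y" for g v
    using bspec[OF st that(1)] that(2) by (rule subsetD[OF _ imageI])
  have prod: "t \<circ> h \<in> P" if "t \<in> T" "h \<in> generate SL {u}" for t h
    using P(3) that by (auto simp: set_mult_def)
  have TP: "t \<in> P" if "t \<in> T" for t
    using prod[OF that generate.one] by simp
  have "id \<in> T" using subgroup.one_closed[OF subgroup_T] by simp
  then have uP: "u \<in> P" using prod[of id u] generate.incl[of u "{u}" SL] by simp
  show "d > 1"
  proof (rule ccontr)
    assume "\<not> d > 1"
    then have "d = 1" using d1 by simp
    then have "Y = UNIV"
      by (rule T_u_irreducible[OF _ Y(1,2)]) (rule Yst[OF TP], assumption+, rule Yst[OF uP])
    with Y(3) show False by contradiction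
  qed
next
  assume d: "d > 1"
  have qn: "q < n" using n_eq d q2 by simp
  have sub: "subgroup (stab (flag q)) SL" by (rule stab_subgroup[OF subspace_flag])
  have "generate SL {u} \<subseteq> stab (flag q)"
    using u_stab_flag[OF u] by (intro SLg.generate_subgroup_incl[OF _ sub]) simp
  moreover have "T \<subseteq> stab (flag q)" using T_upper by (auto simp: upper_def)
  ultimately have "T <#>\<^bsub>SL\<^esub> generate SL {u} \<subseteq> stab (flag q)"
    using subgroup.m_closed[OF sub] by (auto simp: set_mult_def)
  then show "\<exists>P. parabolic_subgroup P \<and> P \<noteq> carrier SL \<and> T <#>\<^bsub>SL\<^esub> generate SL {u} \<subseteq> P"
    using stab_flag_parabolic[OF n_pos] stab_flag_proper[OF _ qn] q2 by auto
qed

end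

lemma (in linear_group) basis_enumeration:
  assumes "dim UNIV = n" "0 < n"
  shows "\<exists>e. based_space scale e n"
proof -
  obtain B where B: "independent B" "UNIV \<subseteq> span B" "card B = n"
    using basis_exists[of UNIV] assms(1) by metis
  then have "finite B" using assms(2) card_ge_0_finite by blast
  then obtain e where "bij_betw e {0..<card B} B" using ex_bij_betw_nat_finite by blast
  then have "inj_on e {..<n}" "e ` {..<n} = B" using B(3) by (auto simp: bij_betw_def atLeast0LessThan)
  then have "based_space scale e n"
    using B by unfold_locales auto
  then show ?thesis by blast
qed

theorem proposition7p2:
  fixes scale :: "'k::alg_closed_field \<Rightarrow> 'v::ab_group_add \<Rightarrow> 'v"
    and p n a d :: nat
  assumes "vector_space scale"
    and "CHAR('k) = p" and "p > 0"
    and "a > 0" and "d \<ge> 1" and "n = p ^ a * d"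
    and "vector_space.dim scale (UNIV :: 'v set) = n"
  shows "\<exists>T u.
    linear_group.torus scale (p ^ a - 1) T \<and>
    (\<forall>W \<in> linear_group.weight_spaces scale T. vector_space.dim scale W = d) \<and>
    u \<in> carrier (linear_group.SL scale) \<and>
    linear_group.unipotent u \<and>
    linear_group.single_jordan_block scale u \<and>
    u \<in> normalizer (linear_group.SL scale) T \<and>
    ((\<exists>P. linear_group.parabolic_subgroup scale P \<and> P \<noteq> carrier (linear_group.SL scale) \<and>
          T <#>\<^bsub>linear_group.SL scale\<^esub> generate (linear_group.SL scale) {u} \<subseteq> P)
      \<longleftrightarrow> d > 1)"
proof -
  interpret L: linear_group scale using assms(1) by (simp add: linear_group_def)
  have p: "prime p" using prime_CHAR_semidom[where ?'a = 'k] assms(2,3) by simp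
  then have q: "2 \<le> p ^ a"
    using assms(4) by (metis one_less_power prime_gt_1_nat Suc_1 Suc_leI)
  then have "0 < n" using assms(3,5,6) by simp
  then obtain e where "based_space scale e n" using L.basis_enumeration assms(7) by blast
  then interpret V: torus_space scale e n "p ^ a" d
    using assms(5,6) q by (simp add: torus_space_def torus_space_axioms_def closed_field_space_def)
  have C: "prime CHAR('k)" "p ^ a = CHAR('k) ^ a" using p assms(2) by simp_all
  note u = V.u_unipotent_single_block[OF C]
  show ?thesis
    using V.torus_T V.weight_space_dim u V.u_normalizes_T[OF u(3)] V.in_proper_parabolic_iff[OF u(3)]
    by (intro exI[of _ V.T] exI[of _ V.u] conjI ballI)
qed

end
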